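(* Let $\boldsymbol{\sigma}$ be a primitive directive sequence with alphabet rank $n$ and let $\mathsf V$ be a pseudovariety of semigroups containing $\mathsf{LSl}$. (i) If $\mathsf V$ contains some non-orthodox simple semigroup, then the upper bound $n^2-n+1$ for the rank of $G_{\mathsf V}(\boldsymbol{\sigma})$, given by bound (a) recalled in the context, is optimal. (ii) If $\mathsf V$ contains only orthodox simple semigroups (that is, every simple semigroup in $\mathsf V$ is orthodox) and contains some nontrivial group, then the upper bound $n$ for the rank of $G_{\mathsf V}(\boldsymbol{\sigma})$, given by bound (b) recalled in the context, is optimal.
   Context: For a finite alphabet $A$, $A^+$ is the free semigroup on $A$, $|w|$ is the length of $w$, and $\mathrm{fac}(w)$ is the set of nonempty factors of $w$. A directive sequence is a sequence $\boldsymbol{\sigma}=(\sigma_k)_{k\in\mathbb N}$ of homomorphisms $\sigma_k\colon A_{k+1}^+\to A_k^+$, each $A_k$ a finite nonempty alphabet; its alphabet rank is $\liminf_{k\to\infty}\mathrm{Card}(A_k)$. Put $\sigma_{k,m}=\sigma_k\circ\cdots\circ\sigma_{m-1}$ for $k\le m$ (identity if $k=m$) and $L(\boldsymbol{\sigma})=\bigcup_{k\ge 0}\bigcup_{a\in A_k}\mathrm{fac}(\sigma_{0,k}(a))$. A homomorphism $\varphi\colon A^+\to B^+$ is positive if for every $a\in A$ one has $|\varphi(a)|\ge 2$ and every letter of $B$ occurs in $\varphi(a)$; $\boldsymbol{\sigma}$ is primitive if for every $k$ there is $m>k$ with $\sigma_{k,m}$ positive (then $L(\boldsymbol{\sigma})$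 is the language of a minimal shift space). A pseudovariety of semigroups is a class of finite semigroups closed under subsemigroups, homomorphic images and finite direct products. $\mathsf{LSl}$ is the pseudovariety of finite semigroups $S$ such that $eSe$ is a semilattice (commutative with all elements idempotent) for every idempotent $e\in S$. A semigroup is simple if its Green relation $\mathcal J$ is universal, and orthodox if the product of any two idempotents is idempotent. $\overline{\Omega}_A\mathsf V$ is the free pro-$\mathsf V$ semigroup on $A$ (pro-$\mathsf V$: inverse limit of members of $\mathsf V$ with discrete topologies); for the $\mathsf V$ considered it contains $A^+$ as a dense subsemigroup, and every homomorphism $\varphi\colon A^+\to B^+$ extends uniquely to a continuous homomorphism $\varphi^{\mathsf V}\colon\overline{\Omega}_A\mathsf V\to\overline{\Omega}_B\mathsf V$. For $\boldsymbol{\sigma}$ primitive, the set $\overline{L(\boldsymbol{\sigma})}\setminus L(\boldsymbol{\sigma})$ (closure in $\overline{\Omega}_{A_0}\mathsf V$) lies in a single regular $\mathcal J$-class $J_{\mathsf V}(\boldsymbol{\sigma})$ of $\overline{\Omega}_{A_0}\mathsf V$; its maximal subgroups are all isomorphic as profinite groups, and $G_{\mathsf V}(\boldsymbol{\sigma})$ (the $\mathsf V$-Schützenberger group) denotes any of them. The rank of a finitely generated profinite semigroup $S$ is the least positive integer $k$ such that some subset of $S$ with at most $k$ elements generates a dense subsemigroup. Put $\mathrm{Im}_{\mathsf V}(\boldsymbol{\sigma})=\bigcap_{k\in\mathbb N}\mathrm{Im}(\sigma_{0,k}^{\mathsf V})$, a closed subsemigroup of $\overline{\Omega}_{A_0}\mathsf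 V$; for $\boldsymbol{\sigma}$ primitive, $J_{\mathsf V}(\boldsymbol{\sigma})\cap\mathrm{Im}_{\mathsf V}(\boldsymbol{\sigma})$ is a regular $\mathcal J$-class of $\mathrm{Im}_{\mathsf V}(\boldsymbol{\sigma})$. The known upper bounds referred to in the claim are the following, for $\boldsymbol{\sigma}$ primitive with finite alphabet rank $n$ and $\mathsf V\supseteq\mathsf{LSl}$: (a) the maximal subgroups of $J_{\mathsf V}(\boldsymbol{\sigma})\cap\mathrm{Im}_{\mathsf V}(\boldsymbol{\sigma})$ are profinite groups of rank at most $n^2-n+1$; (b) if every simple semigroup in $\mathsf V$ is orthodox, then these maximal subgroups have rank at most $n$. When $\boldsymbol{\sigma}$ is $\mathsf V$-saturating, meaning that $\mathrm{Im}_{\mathsf V}(\boldsymbol{\sigma})$ contains a maximal subgroup of $J_{\mathsf V}(\boldsymbol{\sigma})$, these maximal subgroups are isomorphic to $G_{\mathsf V}(\boldsymbol{\sigma})$, so (a) and (b) bound the rank of $G_{\mathsf V}(\boldsymbol{\sigma})$. *)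

theory Defs
  imports "HOL-Analysis.Analysis" "HOL-Algebra.Group" "HOL-Library.Sublist"
    "HOL-Library.Extended_Nat" "HOL-Library.Liminf_Limsup"
begin

section \<open>Semigroups\<close>

text \<open>Semigroups are nonempty, so subsemigroups are nonempty as well.\<close>

record 'a sgrp = "'a partial_object" +
  sg_mult :: "'a \<Rightarrow> 'a \<Rightarrow> 'a"

definition sgroup_axioms :: "'a sgrp \<Rightarrow> bool" where
  "sgroup_axioms S \<longleftrightarrow> carrier S \<noteq> {} \<and>
     (\<forall>x\<in>carrier S. \<forall>y\<in>carrier S. sg_mult S x y \<in> carrier S) \<and>
     (\<forall>x\<in>carrier S. \<forall>y\<in>carrier S. \<forall>z\<in>carrier S.
        sg_mult S (sg_mult S x y) z = sg_mult S x (sg_mult S y z))"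

definition sg_hom :: "'a sgrp \<Rightarrow> 'b sgrp \<Rightarrow> ('a \<Rightarrow> 'b) set" where
  "sg_hom S T = {f \<in> carrier S \<rightarrow> carrier T.
     \<forall>x\<in>carrier S. \<forall>y\<in>carrier S. f (sg_mult S x y) = sg_mult T (f x) (f y)}"

definition subsemigroup :: "'a set \<Rightarrow> 'a sgrp \<Rightarrow> bool" where
  "subsemigroup X S \<longleftrightarrow> X \<noteq> {} \<and> X \<subseteq> carrier S \<and> (\<forall>x\<in>X. \<forall>y\<in>X. sg_mult S x y \<in> X)"

definition sg_prod :: "'a sgrp \<Rightarrow> 'b sgrp \<Rightarrow> ('a \<times> 'b) sgrp" where
  "sg_prod S T = \<lparr>carrier = carrier S \<times> carrier T,
     sg_mult = (\<lambda>(x, y) (x', y'). (sg_mult S x x', sg_mult T y y'))\<rparr>"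

definition sg_generated :: "'a sgrp \<Rightarrow> 'a set \<Rightarrow> 'a set" where
  "sg_generated S X = \<Inter>{Y. X \<subseteq> Y \<and> Y \<subseteq> carrier S \<and> (\<forall>x\<in>Y. \<forall>y\<in>Y. sg_mult S x y \<in> Y)}"

definition idempotents :: "'a sgrp \<Rightarrow> 'a set" where
  "idempotents S = {e \<in> carrier S. sg_mult S e e = e}"

definition is_group :: "'a sgrp \<Rightarrow> bool" where
  "is_group S \<longleftrightarrow> (\<exists>e. group \<lparr>carrier = carrier S, monoid.mult = sg_mult S, one = e\<rparr>)"

text \<open>The principal two-sided ideal \<open>S\<^sup>1 a S\<^sup>1\<close>.\<close>

definition principal_ideal :: "'a sgrp \<Rightarrow> 'a \<Rightarrow> 'a set" where
  "principal_ideal S a = {a} \<union> {sg_mult S x a | x. x \<in> carrier S}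
     \<union> {sg_mult S a y | y. y \<in> carrier S}
     \<union> {sg_mult S (sg_mult S x a) y | x y. x \<in> carrier S \<and> y \<in> carrier S}"

definition green_J :: "'a sgrp \<Rightarrow> 'a \<Rightarrow> 'a \<Rightarrow> bool" where
  "green_J S a b \<longleftrightarrow> a \<in> carrier S \<and> b \<in> carrier S \<and> principal_ideal S a = principal_ideal S b"

definition simple_sgrp :: "'a sgrp \<Rightarrow> bool" where
  "simple_sgrp S \<longleftrightarrow> (\<forall>a\<in>carrier S. \<forall>b\<in>carrier S. green_J S a b)"

definition orthodox :: "'a sgrp \<Rightarrow> bool" where
  "orthodox S \<longleftrightarrow> (\<forall>e\<in>idempotents S. \<forall>f\<in>idempotents S. sg_mult S e f \<in> idempotents S)"

definition subgroup_of :: "'a set \<Rightarrow> 'a sgrp \<Rightarrow> bool" where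
  "subgroup_of H S \<longleftrightarrow> H \<subseteq> carrier S \<and> is_group (S\<lparr>carrier := H\<rparr>)"

definition maximal_subgroup :: "'a set \<Rightarrow> 'a sgrp \<Rightarrow> bool" where
  "maximal_subgroup H S \<longleftrightarrow> subgroup_of H S \<and> (\<forall>K. subgroup_of K S \<and> H \<subseteq> K \<longrightarrow> K = H)"


section \<open>Pseudovarieties\<close>

text \<open>Every finite semigroup is isomorphic to one whose carrier consists of natural numbers, and
  a class of finite semigroups closed under homomorphic images is closed under isomorphism. A
  class of finite semigroups is therefore given by its members with carrier in \<open>nat\<close>; closure
  under products speaks about the copies of a product in \<open>nat\<close>, and the empty product is
  accounted for by nonemptiness.\<close>

definition finite_sgrps :: "nat sgrp set" where
  "finite_sgrps = {S. sgroup_axioms S \<and> finite (carrier S)}"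

definition pseudovariety :: "nat sgrp set \<Rightarrow> bool" where
  "pseudovariety V \<longleftrightarrow> V \<noteq> {} \<and> V \<subseteq> finite_sgrps \<and>
     (\<forall>S\<in>V. \<forall>X. subsemigroup X S \<longrightarrow> S\<lparr>carrier := X\<rparr> \<in> V) \<and>
     (\<forall>S\<in>V. \<forall>T\<in>finite_sgrps. (\<exists>f\<in>sg_hom S T. f ` carrier S = carrier T) \<longrightarrow> T \<in> V) \<and>
     (\<forall>S\<in>V. \<forall>T\<in>V. \<forall>U\<in>finite_sgrps.
        (\<exists>f\<in>sg_hom (sg_prod S T) U. bij_betw f (carrier (sg_prod S T)) (carrier U)) \<longrightarrow> U \<in> V)"

definition LSl :: "nat sgrp set" where
  "LSl = {S \<in> finite_sgrps. \<forall>e\<in>idempotents S.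
     let M = {sg_mult S (sg_mult S e x) e | x. x \<in> carrier S} in
       (\<forall>x\<in>M. \<forall>y\<in>M. sg_mult S x y = sg_mult S y x) \<and> (\<forall>x\<in>M. sg_mult S x x = x)}"


section \<open>Free semigroups and free pro-\<open>V\<close> semigroups\<close>

definition free_sgrp :: "'a set \<Rightarrow> 'a list sgrp" where
  "free_sgrp A = \<lparr>carrier = {w. w \<noteq> [] \<and> set w \<subseteq> A}, sg_mult = (@)\<rparr>"

text \<open>Value of a nonempty word under the homomorphism from the free semigroup that extends
  the map \<open>f\<close> on letters.\<close>

fun word_value :: "'s sgrp \<Rightarrow> ('a \<Rightarrow> 's) \<Rightarrow> 'a list \<Rightarrow> 's" where
  "word_value S f [] = undefined"
| "word_value S f [a] = f a"
| "word_value S f (a # b # w) = sg_mult S (f a) (word_value S f (b # w))"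

text \<open>The free pro-\<open>V\<close> semigroup on \<open>A\<close> is the inverse limit, in the product of the discrete
  semigroups \<open>S\<close>, of all \<open>S \<in> V\<close> equipped with a map \<open>f : A \<rightarrow> S\<close>; the connecting morphisms are
  the homomorphisms that commute with the maps from \<open>A\<close>. As \<open>(S, f)\<close> receives a morphism from
  the subsemigroup of \<open>S\<close> generated by \<open>f ` A\<close>, this is the inverse limit of the \<open>A\<close>-generated
  members of \<open>V\<close>.\<close>

type_synonym 'a prof = "nat sgrp \<times> ('a \<Rightarrow> nat) \<Rightarrow> nat"

definition gen_maps :: "nat sgrp set \<Rightarrow> 'a set \<Rightarrow> (nat sgrp \<times> ('a \<Rightarrow> nat)) set" where
  "gen_maps V A = {(S, f). S \<in> V \<and> f \<in> A \<rightarrow>\<^sub>E carrier S}"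

definition free_pro :: "nat sgrp set \<Rightarrow> 'a set \<Rightarrow> 'a prof sgrp" where
  "free_pro V A =
     \<lparr>carrier = {x \<in> (\<Pi>\<^sub>E (S, f)\<in>gen_maps V A. carrier S).
        \<forall>(S, f)\<in>gen_maps V A. \<forall>(T, g)\<in>gen_maps V A. \<forall>h\<in>sg_hom S T.
          (\<forall>a\<in>A. h (f a) = g a) \<longrightarrow> h (x (S, f)) = x (T, g)},
      sg_mult = (\<lambda>x y. \<lambda>(S, f)\<in>gen_maps V A. sg_mult S (x (S, f)) (y (S, f)))\<rparr>"

definition free_pro_top :: "nat sgrp set \<Rightarrow> 'a set \<Rightarrow> 'a prof topology" where
  "free_pro_top V A =
     subtopology (product_topology (\<lambda>(S, f). discrete_topology (carrier S)) (gen_maps V A))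
       (carrier (free_pro V A))"

definition word_embed :: "nat sgrp set \<Rightarrow> 'a set \<Rightarrow> 'a list \<Rightarrow> 'a prof" where
  "word_embed V A w = (\<lambda>(S, f)\<in>gen_maps V A. word_value S f w)"

text \<open>The unique continuous homomorphism extending \<open>\<phi>\<close> (as an extensional function).\<close>

definition pro_ext :: "nat sgrp set \<Rightarrow> 'a set \<Rightarrow> 'b set \<Rightarrow> ('a list \<Rightarrow> 'b list) \<Rightarrow> 'a prof \<Rightarrow> 'b prof" where
  "pro_ext V A B \<phi> = (THE F. F \<in> extensional (carrier (free_pro V A)) \<and>
     F \<in> sg_hom (free_pro V A) (free_pro V B) \<and>
     continuous_map (free_pro_top V A) (free_pro_top V B) F \<and>
     (\<forall>w\<in>carrier (free_sgrp A). F (word_embed V A w) = word_embed V B (\<phi> w)))"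

text \<open>Rank of a sub-semigroup \<open>H\<close> of \<open>S\<close>, with the topology induced by \<open>X\<close>; it is \<open>\<infinity>\<close> if \<open>H\<close> is
  not topologically finitely generated. It is positive by definition.\<close>

definition top_rank :: "'a topology \<Rightarrow> 'a sgrp \<Rightarrow> 'a set \<Rightarrow> enat" where
  "top_rank X S H = Inf {enat k | k. k \<ge> 1 \<and>
     (\<exists>G\<subseteq>H. finite G \<and> card G \<le> k \<and> subtopology X H closure_of (sg_generated S G) = H)}"


section \<open>Directive sequences\<close>

text \<open>A directive sequence is given by its alphabets \<open>A k\<close> and its homomorphisms \<open>\<sigma> k\<close> on words.\<close>

definition directive_sequence :: "(nat \<Rightarrow> 'a set) \<Rightarrow> (nat \<Rightarrow> 'a list \<Rightarrow> 'a list) \<Rightarrow> bool" where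
  "directive_sequence A \<sigma> \<longleftrightarrow> (\<forall>k. finite (A k) \<and> A k \<noteq> {} \<and>
     \<sigma> k \<in> sg_hom (free_sgrp (A (Suc k))) (free_sgrp (A k)))"

definition alphabet_rank :: "(nat \<Rightarrow> 'a set) \<Rightarrow> enat" where
  "alphabet_rank A = liminf (\<lambda>k. enat (card (A k)))"

text \<open>\<open>dcomp \<sigma> k j\<close> is \<open>\<sigma>\<^bsub>k,k+j\<^esub> = \<sigma>\<^sub>k \<circ> \<dots> \<circ> \<sigma>\<^bsub>k+j-1\<^esub>\<close>.\<close>

primrec dcomp :: "(nat \<Rightarrow> 'a list \<Rightarrow> 'a list) \<Rightarrow> nat \<Rightarrow> nat \<Rightarrow> 'a list \<Rightarrow> 'a list" where
  "dcomp \<sigma> k 0 = id"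
| "dcomp \<sigma> k (Suc j) = dcomp \<sigma> k j \<circ> \<sigma> (k + j)"

definition dseq :: "(nat \<Rightarrow> 'a list \<Rightarrow> 'a list) \<Rightarrow> nat \<Rightarrow> nat \<Rightarrow> 'a list \<Rightarrow> 'a list" where
  "dseq \<sigma> k m = dcomp \<sigma> k (m - k)"

definition positive_hom :: "'a set \<Rightarrow> 'b set \<Rightarrow> ('a list \<Rightarrow> 'b list) \<Rightarrow> bool" where
  "positive_hom A B \<phi> \<longleftrightarrow> (\<forall>a\<in>A. length (\<phi> [a]) \<ge> 2 \<and> B \<subseteq> set (\<phi> [a]))"

definition primitive :: "(nat \<Rightarrow> 'a set) \<Rightarrow> (nat \<Rightarrow> 'a list \<Rightarrow> 'a list) \<Rightarrow> bool" where
  "primitive A \<sigma> \<longleftrightarrow> (\<forall>k. \<exists>m>k. positive_hom (A m) (A k) (dseq \<sigma> k m))"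

definition factors :: "'a list \<Rightarrow> 'a list set" where
  "factors w = {u. u \<noteq> [] \<and> sublist u w}"

definition lang :: "(nat \<Rightarrow> 'a set) \<Rightarrow> (nat \<Rightarrow> 'a list \<Rightarrow> 'a list) \<Rightarrow> 'a list set" where
  "lang A \<sigma> = (\<Union>k. \<Union>a\<in>A k. factors (dseq \<sigma> 0 k [a]))"

text \<open>The \<open>\<J>\<close>-class \<open>J\<^sub>V(\<sigma>)\<close>: the class of the elements of the closure of \<open>L(\<sigma>)\<close> outside \<open>L(\<sigma>)\<close>,
  all of which are \<open>\<J>\<close>-equivalent when \<open>\<sigma>\<close> is primitive and \<open>LSl \<subseteq> V\<close>.\<close>

definition J_class :: "nat sgrp set \<Rightarrow> (nat \<Rightarrow> 'a set) \<Rightarrow> (nat \<Rightarrow> 'a list \<Rightarrow> 'a list) \<Rightarrow> 'a prof set" where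
  "J_class V A \<sigma> = (let L = word_embed V (A 0) ` lang A \<sigma> in
     {y. \<exists>x \<in> (free_pro_top V (A 0) closure_of L) - L. green_J (free_pro V (A 0)) x y})"

definition Im_dseq :: "nat sgrp set \<Rightarrow> (nat \<Rightarrow> 'a set) \<Rightarrow> (nat \<Rightarrow> 'a list \<Rightarrow> 'a list) \<Rightarrow> 'a prof set" where
  "Im_dseq V A \<sigma> = (\<Inter>k. pro_ext V (A k) (A 0) (dseq \<sigma> 0 k) ` carrier (free_pro V (A k)))"

text \<open>The maximal subgroups contained in \<open>J\<^sub>V(\<sigma>)\<close>; each of them represents the
  \<open>V\<close>-Schuetzenberger group \<open>G\<^sub>V(\<sigma>)\<close>.\<close>

definition schutz_groups :: "nat sgrp set \<Rightarrow> (nat \<Rightarrow> 'a set) \<Rightarrow> (nat \<Rightarrow> 'a list \<Rightarrow> 'a list) \<Rightarrow> 'a prof set set" where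
  "schutz_groups V A \<sigma> = {H. maximal_subgroup H (free_pro V (A 0)) \<and> H \<subseteq> J_class V A \<sigma>}"

definition saturating :: "nat sgrp set \<Rightarrow> (nat \<Rightarrow> 'a set) \<Rightarrow> (nat \<Rightarrow> 'a list \<Rightarrow> 'a list) \<Rightarrow> bool" where
  "saturating V A \<sigma> \<longleftrightarrow> (\<exists>H\<in>schutz_groups V A \<sigma>. H \<subseteq> Im_dseq V A \<sigma>)"

definition schutz_rank_is :: "nat sgrp set \<Rightarrow> (nat \<Rightarrow> 'a set) \<Rightarrow> (nat \<Rightarrow> 'a list \<Rightarrow> 'a list) \<Rightarrow> nat \<Rightarrow> bool" where
  "schutz_rank_is V A \<sigma> r \<longleftrightarrow> schutz_groups V A \<sigma> \<noteq> {} \<and>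
     (\<forall>G\<in>schutz_groups V A \<sigma>. top_rank (free_pro_top V (A 0)) (free_pro V (A 0)) G = enat r)"

text \<open>The bound \<open>r\<close> for the rank of \<open>G\<^sub>V(\<sigma>)\<close> at alphabet rank \<open>n\<close> is optimal if it is attained.
  The bound concerns saturating sequences, so the witness is required to be saturating. The
  exception is \<open>n = 1\<close>: there the shift space is periodic, its Schuetzenberger group is
  procyclic, and for instance for the pseudovariety of all finite semigroups no primitive
  directive sequence of alphabet rank 1 is saturating.\<close>

definition rank_bound_optimal :: "nat sgrp set \<Rightarrow> nat \<Rightarrow> nat \<Rightarrow> bool" where
  "rank_bound_optimal V n r \<longleftrightarrow> (\<exists>(A :: nat \<Rightarrow> nat set) \<sigma>.
     directive_sequence A \<sigma> \<and> primitive A \<sigma> \<and> alphabet_rank A = enat n \<and>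
     (n \<ge> 2 \<longrightarrow> saturating V A \<sigma>) \<and> schutz_rank_is V A \<sigma> r)"

end

theory Submission
  imports Defs
begin

text \<open>For \<open>n \<ge> 2\<close> the witness is a stationary sequence given by one substitution \<open>\<tau>\<close> of constant
  length on \<open>n\<close> letters such that every \<open>\<tau> c\<close> contains all two-letter words and a marker by
  which cutting points are recognised locally; the latter makes the sequence saturating, because
  \<open>LSl\<close> tests factors of bounded length. In a coordinate \<open>(S, f)\<close> the maps \<open>f \<circ> \<tau>\<^sup>k\<close> are ultimately
  periodic in \<open>k\<close>, so that they converge along \<open>k = j!\<close> to some \<open>f'\<close>, and the values of \<open>f'\<close> at the
  words that start and end with \<open>0\<close> form the coordinate of a maximal subgroup. These words are
  closed walks at \<open>0\<close> in the complete directed graph with loops, whose cycle space has dimension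
  \<open>n\<^sup>2 - n + 1\<close>. If \<open>\<tau> c\<close> starts and ends with \<open>c\<close> and contains each two-letter word a multiple of \<open>q\<close>
  times, then the numbers of occurrences of two-letter words modulo \<open>q\<close> are invariants of the limit;
  they are detected by a non-orthodox simple semigroup in which the product of two idempotents has
  order \<open>q\<close>. If every \<open>\<tau> c\<close> starts and ends with \<open>0\<close>, the images of the letters generate the group, and
  the numbers of occurrences of letters modulo \<open>q\<close> are detected by a cyclic group of order \<open>q\<close>.\<close>

subsection \<open>Words and their values\<close>

text \<open>All questions are settled one coordinate \<open>(S, f)\<close> at a time: products of
  members of V dominate any finite set of coordinates, so closure, division and equality reduce to
  finite semigroups, and compactness glues the answers. The obstacle is that the values of words in
  \<open>W\<close> give a subgroup which could be smaller than the full maximal subgroup. An element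
  x of the latter is approximated by words u w u with u in \<open>W N\<close>. As x divides a limit
  of the language, a test semigroup in \<open>LSl\<close> forces the short factors of u w u into the
  language, and unique desubstitution puts u w u into \<open>W N\<close>. The other maximal
  subgroups are handled by conjugation along J-equivalence. For the lower bounds, a quotient onto r
  cyclic groups of order q needs r generators. Of the \<open>n\<^sup>2\<close> pair counts of a
  closed walk only \<open>n\<^sup>2 - n + 1\<close> are independent, since at each vertex as many
  arcs enter as leave. To count pairs, information has to pass between neighbouring letters; two
  idempotents e and f carry it, one contributed by each neighbour. For n = 1 both bounds are 1, and
  a doubling sequence over a single letter serves.\<close>

definition words :: "'a set \<Rightarrow> 'a list set" where
  "words A = {w. w \<noteq> [] \<and> set w \<subseteq> A}"

lemma carrier_free_sgrp [simp]: "carrier (free_sgrp A) = words A"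
  and mult_free_sgrp [simp]: "sg_mult (free_sgrp A) = (@)"
  by (auto simp: free_sgrp_def words_def)

lemma words_append: "u \<in> words A \<Longrightarrow> set v \<subseteq> A \<Longrightarrow> u @ v \<in> words A"
  and words_append2: "v \<in> words A \<Longrightarrow> set u \<subseteq> A \<Longrightarrow> u @ v \<in> words A"
  and words_singleton [simp]: "[a] \<in> words A \<longleftrightarrow> a \<in> A"
  and words_Cons: "a # w \<in> words A \<longleftrightarrow> a \<in> A \<and> set w \<subseteq> A"
  and words_nonempty: "u \<in> words A \<Longrightarrow> u \<noteq> []"
  and words_set: "u \<in> words A \<Longrightarrow> set u \<subseteq> A"
  by (auto simp: words_def)

lemma words_appendI [intro]: "u \<in> words A \<Longrightarrow> v \<in> words A \<Longrightarrow> u @ v \<in> words A"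
  by (auto simp: words_def)

lemma sgroup_closed: "sgroup_axioms S \<Longrightarrow> x \<in> carrier S \<Longrightarrow> y \<in> carrier S \<Longrightarrow> sg_mult S x y \<in> carrier S"
  and sgroup_assoc: "sgroup_axioms S \<Longrightarrow> x \<in> carrier S \<Longrightarrow> y \<in> carrier S \<Longrightarrow> z \<in> carrier S \<Longrightarrow>
    sg_mult S (sg_mult S x y) z = sg_mult S x (sg_mult S y z)"
  by (simp_all add: sgroup_axioms_def)

lemma word_value_Cons:
  "w \<noteq> [] \<Longrightarrow> word_value S f (a # w) = sg_mult S (f a) (word_value S f w)"
  by (cases w) auto

lemma word_value_closed:
  assumes "sgroup_axioms S" "f \<in> A \<rightarrow> carrier S" "w \<in> words A"
  shows "word_value S f w \<in> carrier S"
  using assms(3)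
proof (induction w)
  case (Cons a w)
  then show ?case using assms(1,2)
    by (cases "w = []") (auto simp: words_def word_value_Cons intro!: sgroup_closed)
qed (simp add: words_def)

lemma word_value_append:
  assumes "sgroup_axioms S" "f \<in> A \<rightarrow> carrier S" "u \<in> words A" "v \<in> words A"
  shows "word_value S f (u @ v) = sg_mult S (word_value S f u) (word_value S f v)"
  using assms(3)
proof (induction u)
  case (Cons a u)
  have v: "v \<noteq> []" using assms(4) by (simp add: words_def)
  show ?case
  proof (cases "u = []")
    case True
    then show ?thesis using v by (simp add: word_value_Cons)
  next
    case False
    then have u: "u \<in> words A" "a \<in> A" using Cons.prems by (auto simp: words_def)
    have "f a \<in> carrier S" using u assms(2) by auto
    then show ?thesis using Cons.IH[OF u(1)] False
      sgroup_assoc[OF assms(1) _ word_value_closed[OF assms(1,2) u(1)] word_value_closed[OF assms(1,2,4)]]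
      by (simp add: word_value_Cons)
  qed
qed (simp add: words_def)

lemma word_value_hom:
  assumes "h \<in> sg_hom S T" "sgroup_axioms S" "f \<in> A \<rightarrow> carrier S" "w \<in> words A"
    and "\<And>a. a \<in> A \<Longrightarrow> h (f a) = g a"
  shows "h (word_value S f w) = word_value T g w"
  using assms(4)
proof (induction w)
  case (Cons a w)
  show ?case
  proof (cases "w = []")
    case False
    then have "w \<in> words A" "a \<in> A" using Cons.prems by (auto simp: words_def)
    then show ?thesis using Cons.IH False assms word_value_closed[OF assms(2,3)]
      by (auto simp: word_value_Cons sg_hom_def Pi_iff)
  qed (use Cons assms in \<open>auto simp: words_def\<close>)
qed (simp add: words_def)

lemma sg_hom_comp: "h \<in> sg_hom S T \<Longrightarrow> k \<in> sg_hom T U \<Longrightarrow> k \<circ> h \<in> sg_hom S U"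
  by (auto simp: sg_hom_def Pi_iff)

lemma hom_words_closed:
  assumes "\<phi> \<in> sg_hom (free_sgrp A) (free_sgrp B)" "w \<in> words A"
  shows "\<phi> w \<in> words B"
  using assms by (auto simp: sg_hom_def)

lemma word_value_free_hom:
  assumes "sgroup_axioms S" "f \<in> B \<rightarrow> carrier S" "\<phi> \<in> sg_hom (free_sgrp A) (free_sgrp B)" "w \<in> words A"
  shows "word_value S f (\<phi> w) = word_value S (\<lambda>a\<in>A. word_value S f (\<phi> [a])) w"
  using assms(4)
proof (induction w)
  case (Cons a w)
  show ?case
  proof (cases "w = []")
    case False
    then have w: "w \<in> words A" "a \<in> A" using Cons.prems by (auto simp: words_def)
    have "[a] \<in> words A" using w by simp
    then have "\<phi> ([a] @ w) = \<phi> [a] @ \<phi> w" using assms(3) w unfolding sg_hom_def mult_free_sgrp carrier_free_sgrp by blast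
    then have "word_value S f (\<phi> (a # w)) = sg_mult S (word_value S f (\<phi> [a])) (word_value S f (\<phi> w))"
      using word_value_append[OF assms(1,2) hom_words_closed[OF assms(3)] hom_words_closed[OF assms(3)], of "[a]" w] w
      by simp
    then show ?thesis using False w Cons.IH by (simp add: word_value_Cons)
  qed (use Cons in \<open>auto simp: words_def\<close>)
qed (simp add: words_def)

subsection \<open>Copies of countable semigroups in the natural numbers\<close>

text \<open>Members of a pseudovariety have their carrier in \<open>nat\<close>, whereas products
  live on pairs and test values on options; this moves them there.\<close>

definition nat_copy :: "'b::countable sgrp \<Rightarrow> nat sgrp" where
  "nat_copy S = \<lparr>carrier = to_nat ` carrier S,
     sg_mult = (\<lambda>x y. to_nat (sg_mult S (from_nat x) (from_nat y)))\<rparr>"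

lemma carrier_nat_copy [simp]: "carrier (nat_copy S) = to_nat ` carrier S"
  and mult_nat_copy [simp]:
    "sg_mult (nat_copy S) (to_nat x) (to_nat y) = to_nat (sg_mult S x y)"
  by (simp_all add: nat_copy_def)

lemma nat_copy_finite_sgrps:
  assumes "sgroup_axioms S" "finite (carrier S)"
  shows "nat_copy S \<in> finite_sgrps"
  using assms sgroup_closed[OF assms(1)] sgroup_assoc[OF assms(1)]
  by (simp add: finite_sgrps_def sgroup_axioms_def)

lemma to_nat_hom: "to_nat \<in> sg_hom S (nat_copy S)"
  by (auto simp: sg_hom_def)

lemma from_nat_hom: "from_nat \<in> sg_hom (nat_copy S) S"
  by (auto simp: sg_hom_def)

lemma bij_to_nat_copy: "bij_betw to_nat (carrier S) (carrier (nat_copy S))"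
  by (auto simp: bij_betw_def inj_on_def)

lemma sg_prod_sgroup:
  assumes S: "sgroup_axioms S" and T: "sgroup_axioms T"
  shows "sgroup_axioms (sg_prod S T)"
  using sgroup_closed[OF S] sgroup_closed[OF T] sgroup_assoc[OF S] sgroup_assoc[OF T] S T
  by (simp add: sg_prod_def sgroup_axioms_def split_beta mem_Times_iff)

subsection \<open>Powers in finite semigroups\<close>

text \<open>Pigeonhole on the orbit of \<open>x\<close>. The preperiod is taken at least 1 so that
  the idempotent powers derived from it have a positive exponent index.\<close>

lemma funpow_periodic:
  assumes "finite X" "x \<in> X" "\<And>y. y \<in> X \<Longrightarrow> F y \<in> X"
  obtains i p :: nat where "p \<ge> 1" "i \<ge> 1" "\<And>m k. m \<ge> i \<Longrightarrow> (F ^^ (m + p * k)) x = (F ^^ m) x"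
proof -
  have X: "(F ^^ m) x \<in> X" for m by (induction m) (use assms in auto)
  have "\<not> inj_on (\<lambda>m. (F ^^ m) x) {1..}"
    using X assms(1) by (metis finite_imageD finite_subset image_subsetI infinite_Ici)
  then obtain i j where ij: "i \<ge> 1" "j \<ge> 1" "(F ^^ i) x = (F ^^ j) x" "i < j"
    by (auto simp: inj_on_def) (metis linorder_neqE_nat)
  define p where "p = j - i"
  have p: "(F ^^ (m + p)) x = (F ^^ m) x" if "m \<ge> i" for m
  proof -
    have "(F ^^ (m + p)) x = (F ^^ ((m - i) + j)) x" using that ij by (simp add: p_def)
    also have "\<dots> = (F ^^ (m - i)) ((F ^^ j) x)" by (simp add: funpow_add)
    also have "\<dots> = (F ^^ ((m - i) + i)) x" using ij by (simp add: funpow_add)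
    finally show ?thesis using that by simp
  qed
  have "(F ^^ (m + p * k)) x = (F ^^ m) x" if "m \<ge> i" for m k
  proof (induction k)
    case (Suc k)
    have "(F ^^ (m + p * Suc k)) x = (F ^^ ((m + p * k) + p)) x" by (simp add: algebra_simps)
    also have "\<dots> = (F ^^ (m + p * k)) x" using that by (intro p) simp
    finally show ?case using Suc by simp
  qed simp
  with that[of p i] ij show ?thesis by (simp add: p_def)
qed

text \<open>\<open>s\<^bsup>m+1\<^esup>\<close>; the shift keeps the power inside the semigroup.\<close>

definition spow :: "'s sgrp \<Rightarrow> 's \<Rightarrow> nat \<Rightarrow> 's" where
  "spow S s m = word_value S (\<lambda>_. s) (replicate (Suc m) (0::nat))"

lemma spow_0 [simp]: "spow S s 0 = s"
  by (simp add: spow_def)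

lemma spow_Suc: "spow S s (Suc m) = sg_mult S s (spow S s m)"
  by (simp add: spow_def)

lemma spow_closed: "sgroup_axioms S \<Longrightarrow> s \<in> carrier S \<Longrightarrow> spow S s m \<in> carrier S"
  unfolding spow_def by (rule word_value_closed[where A = UNIV]) (auto simp: words_def)

lemma spow_mult:
  assumes "sgroup_axioms S" "s \<in> carrier S"
  shows "sg_mult S (spow S s m) (spow S s k) = spow S s (Suc (m + k))"
proof -
  have "replicate (Suc (Suc (m + k))) (0::nat) = replicate (Suc m) 0 @ replicate (Suc k) 0"
    by (subst replicate_add[symmetric]) simp
  then show ?thesis unfolding spow_def
    by (subst word_value_append[OF assms(1), where A = UNIV, symmetric]) (use assms in \<open>auto simp: words_def\<close>)
qed

lemma spow_mem:
  assumes "s \<in> X" "\<And>x y. x \<in> X \<Longrightarrow> y \<in> X \<Longrightarrow> sg_mult S x y \<in> X"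
  shows "spow S s m \<in> X"
  by (induction m) (use assms in \<open>auto simp: spow_Suc\<close>)

lemma spow_idempotent:
  assumes "sgroup_axioms S" "finite (carrier S)" "s \<in> carrier S"
  obtains k where "k \<ge> 1" "sg_mult S (spow S s k) (spow S s k) = spow S s k"
proof -
  define F where "F = sg_mult S s"
  obtain i p where ip: "p \<ge> 1" "i \<ge> 1" "\<And>m k. m \<ge> i \<Longrightarrow> (F ^^ (m + p * k)) s = (F ^^ m) s"
    by (rule funpow_periodic[OF assms(2,3), of F]) (use assms in \<open>auto simp: F_def sgroup_closed\<close>)
  have sp: "spow S s m = (F ^^ m) s" for m
    by (induction m) (auto simp: spow_Suc F_def)
  \<comment> \<open>Multiplying by the same power raises the index by \<open>Suc k\<close>. This is
    a multiple of the period and \<open>k\<close> is past the preperiod, so the power is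
    idempotent.\<close>
  define k where "k = p * (i + 1) - 1"
  have "p * (i + 1) \<ge> i + 1" using mult_le_mono1[OF ip(1), of "i + 1"] by simp
  then have k: "k \<ge> i" "k \<ge> 1" "Suc k = p * (i + 1)" using ip(2) unfolding k_def by linarith+
  have "sg_mult S (spow S s k) (spow S s k) = spow S s (k + p * (i + 1))"
    using spow_mult[OF assms(1,3), of k k] k(3) by (metis add_Suc_right)
  also have "\<dots> = spow S s k" using ip(3)[OF k(1), of "i + 1"] by (simp add: sp)
  finally show ?thesis using that k by blast
qed

subsection \<open>Free pro-\<open>V\<close> semigroups\<close>

locale pv =
  fixes V :: "nat sgrp set"
  assumes pv: "pseudovariety V"
begin

lemma V_ne: "V \<noteq> {}"
  and V_finite_sgrps: "V \<subseteq> finite_sgrps"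
  and V_sub: "S \<in> V \<Longrightarrow> subsemigroup X S \<Longrightarrow> S\<lparr>carrier := X\<rparr> \<in> V"
  using pv unfolding pseudovariety_def by blast+

lemma V_sgroup: "S \<in> V \<Longrightarrow> sgroup_axioms S"
  and V_finite: "S \<in> V \<Longrightarrow> finite (carrier S)"
  using V_finite_sgrps by (auto simp: finite_sgrps_def)

lemma V_prod: "S \<in> V \<Longrightarrow> T \<in> V \<Longrightarrow> U \<in> finite_sgrps \<Longrightarrow> f \<in> sg_hom (sg_prod S T) U \<Longrightarrow>
   bij_betw f (carrier (sg_prod S T)) (carrier U) \<Longrightarrow> U \<in> V"
  using pv unfolding pseudovariety_def by blast

lemma gen_mapsD:
  assumes "(S, f) \<in> gen_maps V A"
  shows "S \<in> V" "f \<in> A \<rightarrow> carrier S" "f \<in> extensional A" "sgroup_axioms S" "finite (carrier S)"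
  using assms V_sgroup V_finite by (auto simp: gen_maps_def PiE_def)

lemma gen_mapsI: "S \<in> V \<Longrightarrow> f \<in> A \<rightarrow>\<^sub>E carrier S \<Longrightarrow> (S, f) \<in> gen_maps V A"
  by (simp add: gen_maps_def)

text \<open>The coordinates are directed: the product of the two semigroups with the paired
  generator map projects onto both.\<close>

lemma joint_map:
  assumes "(S1, f1) \<in> gen_maps V A" "(S2, f2) \<in> gen_maps V A"
  obtains T g h1 h2 where "(T, g) \<in> gen_maps V A" "h1 \<in> sg_hom T S1" "h2 \<in> sg_hom T S2"
    "\<And>a. a \<in> A \<Longrightarrow> h1 (g a) = f1 a" "\<And>a. a \<in> A \<Longrightarrow> h2 (g a) = f2 a"
proof -
  note d = gen_mapsD[OF assms(1)] gen_mapsD[OF assms(2)]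
  let ?P = "sg_prod S1 S2"
  have P: "sgroup_axioms ?P" "finite (carrier ?P)"
    using d by (simp_all add: sg_prod_sgroup) (simp add: sg_prod_def)
  then have TV: "nat_copy ?P \<in> V"
    using V_prod[OF d(1,6) _ to_nat_hom bij_to_nat_copy] nat_copy_finite_sgrps by blast
  define g where "g = (\<lambda>a\<in>A. to_nat (f1 a, f2 a))"
  have "(f1 a, f2 a) \<in> carrier ?P" if "a \<in> A" for a
    using that d(2,7) by (auto simp: sg_prod_def)
  then have "(nat_copy ?P, g) \<in> gen_maps V A"
    using TV by (intro gen_mapsI) (auto simp: g_def)
  moreover have "fst \<in> sg_hom ?P S1" "snd \<in> sg_hom ?P S2"
    by (auto simp: sg_hom_def sg_prod_def)
  then have "fst \<circ> (from_nat :: nat \<Rightarrow> nat \<times> nat) \<in> sg_hom (nat_copy ?P) S1"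
    "snd \<circ> (from_nat :: nat \<Rightarrow> nat \<times> nat) \<in> sg_hom (nat_copy ?P) S2"
    by (auto intro: sg_hom_comp[OF from_nat_hom])
  moreover have "(fst \<circ> (from_nat :: nat \<Rightarrow> nat \<times> nat)) (g a) = f1 a"
    "(snd \<circ> (from_nat :: nat \<Rightarrow> nat \<times> nat)) (g a) = f2 a" if "a \<in> A" for a
    using that by (simp_all add: g_def)
  ultimately show ?thesis using that by blast
qed

text \<open>Every argument that involves finitely many coordinates, such as one about a basic open
  set, is reduced by this to a single coordinate.\<close>

lemma joint_maps:
  assumes "finite F" "F \<subseteq> gen_maps V A"
  obtains T g where "(T, g) \<in> gen_maps V A"
    "\<And>S f. (S, f) \<in> F \<Longrightarrow> \<exists>h\<in>sg_hom T S. \<forall>a\<in>A. h (g a) = f a"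
proof -
  have "\<exists>T g. (T, g) \<in> gen_maps V A \<and> (\<forall>(S, f)\<in>F. \<exists>h\<in>sg_hom T S. \<forall>a\<in>A. h (g a) = f a)"
    using assms
  proof (induction F rule: finite_induct)
    case empty
    obtain S where S: "S \<in> V" using V_ne by blast
    then obtain s where "s \<in> carrier S" using V_sgroup[OF S] by (auto simp: sgroup_axioms_def)
    then have "(S, \<lambda>a\<in>A. s) \<in> gen_maps V A" using S by (intro gen_mapsI) auto
    then show ?case by blast
  next
    case (insert c F)
    then obtain T g where T: "(T, g) \<in> gen_maps V A"
      "\<forall>(S, f)\<in>F. \<exists>h\<in>sg_hom T S. \<forall>a\<in>A. h (g a) = f a" by auto
    obtain S0 f0 where c: "c = (S0, f0)" by (cases c)
    have "(S0, f0) \<in> gen_maps V A" using insert c by auto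
    from joint_map[OF T(1) this] obtain T' g' h1 h2 where
      T': "(T', g') \<in> gen_maps V A" "h1 \<in> sg_hom T' T" "h2 \<in> sg_hom T' S0"
      "\<And>a. a \<in> A \<Longrightarrow> h1 (g' a) = g a" "\<And>a. a \<in> A \<Longrightarrow> h2 (g' a) = f0 a" by metis
    have "\<exists>h\<in>sg_hom T' S. \<forall>a\<in>A. h (g' a) = f a" if "(S, f) \<in> insert c F" for S f
    proof (cases "(S, f) = c")
      case True
      then show ?thesis using T' c by auto
    next
      case False
      then have "(S, f) \<in> F" using that by simp
      then obtain h where h: "h \<in> sg_hom T S" "\<forall>a\<in>A. h (g a) = f a" using T(2) by blast
      then have "h \<circ> h1 \<in> sg_hom T' S" using sg_hom_comp T'(2) by blast
      moreover have "\<forall>a\<in>A. (h \<circ> h1) (g' a) = f a" using T'(4) h by simp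
      ultimately show ?thesis by blast
    qed
    then show ?case using T' by blast
  qed
  then show ?thesis using that by fast
qed

lemma free_pro_carrier:
  "x \<in> carrier (free_pro V A) \<longleftrightarrow> x \<in> extensional (gen_maps V A) \<and>
     (\<forall>S f. (S, f) \<in> gen_maps V A \<longrightarrow> x (S, f) \<in> carrier S) \<and>
     (\<forall>S f T g h. (S, f) \<in> gen_maps V A \<longrightarrow> (T, g) \<in> gen_maps V A \<longrightarrow> h \<in> sg_hom S T \<longrightarrow>
        (\<forall>a\<in>A. h (f a) = g a) \<longrightarrow> h (x (S, f)) = x (T, g))"
  unfolding free_pro_def by (auto simp: PiE_def Pi_iff) blast+

lemma free_pro_value: "x \<in> carrier (free_pro V A) \<Longrightarrow> (S, f) \<in> gen_maps V A \<Longrightarrow> x (S, f) \<in> carrier S"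
  and free_pro_compat: "x \<in> carrier (free_pro V A) \<Longrightarrow> (S, f) \<in> gen_maps V A \<Longrightarrow> (T, g) \<in> gen_maps V A \<Longrightarrow>
     h \<in> sg_hom S T \<Longrightarrow> (\<And>a. a \<in> A \<Longrightarrow> h (f a) = g a) \<Longrightarrow> h (x (S, f)) = x (T, g)"
  by (simp_all add: free_pro_carrier)

lemma free_pro_eqI:
  assumes "x \<in> carrier (free_pro V A)" "y \<in> carrier (free_pro V A)"
    "\<And>S f. (S, f) \<in> gen_maps V A \<Longrightarrow> x (S, f) = y (S, f)"
  shows "x = y"
  using assms by (intro extensionalityI[of x "gen_maps V A" y]) (auto simp: free_pro_carrier)

lemma free_pro_mult:
  "(S, f) \<in> gen_maps V A \<Longrightarrow> sg_mult (free_pro V A) x y (S, f) = sg_mult S (x (S, f)) (y (S, f))"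
  by (simp add: free_pro_def)

lemma free_pro_closed:
  assumes "x \<in> carrier (free_pro V A)" "y \<in> carrier (free_pro V A)"
  shows "sg_mult (free_pro V A) x y \<in> carrier (free_pro V A)"
  unfolding free_pro_carrier
proof (intro conjI allI impI)
  show "sg_mult (free_pro V A) x y \<in> extensional (gen_maps V A)"
    by (simp add: free_pro_def)
next
  fix S f assume "(S, f) \<in> gen_maps V A"
  then show "sg_mult (free_pro V A) x y (S, f) \<in> carrier S"
    using assms by (simp add: free_pro_mult sgroup_closed gen_mapsD free_pro_value)
next
  fix S f T g h
  assume *: "(S, f) \<in> gen_maps V A" "(T, g) \<in> gen_maps V A" "h \<in> sg_hom S T" "\<forall>a\<in>A. h (f a) = g a"
  then have "h (sg_mult S (x (S, f)) (y (S, f))) = sg_mult T (h (x (S, f))) (h (y (S, f)))"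
    using free_pro_value[OF assms(1) *(1)] free_pro_value[OF assms(2) *(1)] by (simp add: sg_hom_def)
  then show "h (sg_mult (free_pro V A) x y (S, f)) = sg_mult (free_pro V A) x y (T, g)"
    using * free_pro_compat[OF assms(1) *(1-3)] free_pro_compat[OF assms(2) *(1-3)]
    by (simp add: free_pro_mult)
qed

lemma word_embed_apply [simp]:
  "(S, f) \<in> gen_maps V A \<Longrightarrow> word_embed V A w (S, f) = word_value S f w"
  by (simp add: word_embed_def)

lemma word_embed_carrier:
  assumes "w \<in> words A"
  shows "word_embed V A w \<in> carrier (free_pro V A)"
  unfolding free_pro_carrier
proof (intro conjI allI impI)
  fix S f assume "(S, f) \<in> gen_maps V A"
  then show "word_embed V A w (S, f) \<in> carrier S"
    using word_value_closed[OF gen_mapsD(4,2) assms] by simp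
next
  fix S f T g h
  assume *: "(S, f) \<in> gen_maps V A" "(T, g) \<in> gen_maps V A" "h \<in> sg_hom S T" "\<forall>a\<in>A. h (f a) = g a"
  then show "h (word_embed V A w (S, f)) = word_embed V A w (T, g)"
    using word_value_hom[OF *(3) _ _ assms, of f g] gen_mapsD[OF *(1)] by simp
qed (simp add: word_embed_def)

lemma free_pro_sgroup:
  assumes "A \<noteq> {}"
  shows "sgroup_axioms (free_pro V A)"
  unfolding sgroup_axioms_def
proof (intro conjI ballI)
  obtain a where "a \<in> A" using assms by blast
  then show "carrier (free_pro V A) \<noteq> {}" using word_embed_carrier[of "[a]" A] by auto
next
  fix x y z
  assume xyz: "x \<in> carrier (free_pro V A)" "y \<in> carrier (free_pro V A)" "z \<in> carrier (free_pro V A)"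
  show "sg_mult (free_pro V A) (sg_mult (free_pro V A) x y) z = sg_mult (free_pro V A) x (sg_mult (free_pro V A) y z)"
    using xyz
    by (intro free_pro_eqI[where A = A] free_pro_closed)
      (auto simp: free_pro_mult intro!: sgroup_assoc gen_mapsD(4) free_pro_value)
qed (rule free_pro_closed)

text \<open>Compatibility with the inclusion of the subsemigroup generated by the image of
  \<open>f\<close>, itself a coordinate, forces the value of \<open>x\<close> into that
  subsemigroup.\<close>

lemma free_pro_coord_word:
  assumes x: "x \<in> carrier (free_pro V A)" and Sf: "(S, f) \<in> gen_maps V A" and "A \<noteq> {}"
  shows "\<exists>w\<in>words A. x (S, f) = word_value S f w"
proof -
  note d = gen_mapsD[OF Sf]
  define X where "X = word_value S f ` words A"
  have "subsemigroup X S"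
    unfolding subsemigroup_def
  proof (intro conjI ballI)
    obtain a where "a \<in> A" using assms by blast
    then show "X \<noteq> {}" unfolding X_def using words_singleton by (metis empty_iff image_is_empty)
    show "X \<subseteq> carrier S" using word_value_closed[OF d(4,2)] by (auto simp: X_def)
    fix y z assume "y \<in> X" "z \<in> X"
    then obtain u v where "u \<in> words A" "v \<in> words A" "y = word_value S f u" "z = word_value S f v"
      by (auto simp: X_def)
    then show "sg_mult S y z \<in> X"
      using word_value_append[OF d(4,2), of u v] by (auto simp: X_def intro!: image_eqI[of _ _ "u @ v"])
  qed
  then have T: "S\<lparr>carrier := X\<rparr> \<in> V" using V_sub d by blast
  have "f a \<in> X" if "a \<in> A" for a
    unfolding X_def using that by (intro image_eqI[of _ _ "[a]"]) auto
  then have Tf: "(S\<lparr>carrier := X\<rparr>, f) \<in> gen_maps V A"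
    using T d by (intro gen_mapsI) (auto simp: PiE_def)
  have "(\<lambda>y. y) \<in> sg_hom (S\<lparr>carrier := X\<rparr>) S"
    using \<open>subsemigroup X S\<close> by (auto simp: sg_hom_def subsemigroup_def)
  then have "x (S\<lparr>carrier := X\<rparr>, f) = x (S, f)"
    by (rule free_pro_compat[OF x Tf Sf]) simp
  moreover have "x (S\<lparr>carrier := X\<rparr>, f) \<in> X" using free_pro_value[OF x Tf] by simp
  ultimately show ?thesis by (auto simp: X_def)
qed

text \<open>A word that is right at a dominating coordinate is right at all coordinates below it, by
  applying the connecting homomorphisms to both sides.\<close>

lemma joint_word:
  assumes x: "x \<in> carrier (free_pro V A)" and F: "finite F" "F \<subseteq> gen_maps V A"
    and W: "W \<subseteq> words A" "\<And>S f. (S, f) \<in> gen_maps V A \<Longrightarrow> \<exists>w\<in>W. x (S, f) = word_value S f w"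
  shows "\<exists>w\<in>W. \<forall>(S, f)\<in>F. x (S, f) = word_value S f w"
proof -
  obtain T g where T: "(T, g) \<in> gen_maps V A"
    "\<And>S f. (S, f) \<in> F \<Longrightarrow> \<exists>h\<in>sg_hom T S. \<forall>a\<in>A. h (g a) = f a"
    using joint_maps[OF F] by metis
  then obtain w where w: "w \<in> W" "x (T, g) = word_value T g w" using W by blast
  have "x (S, f) = word_value S f w" if Sf: "(S, f) \<in> F" for S f
  proof -
    obtain h where h: "h \<in> sg_hom T S" "\<forall>a\<in>A. h (g a) = f a" using T(2) Sf by blast
    have "x (S, f) = h (x (T, g))"
      using free_pro_compat[OF x T(1) _ h(1), of f] h(2) F Sf by auto
    also have "\<dots> = word_value S f w"
      unfolding w using word_value_hom[OF h(1), of g A w f] gen_mapsD[OF T(1)] h(2) w W by auto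
    finally show ?thesis .
  qed
  then show ?thesis using w by auto
qed

lemma joint_elt:
  assumes x: "x \<in> carrier (free_pro V A)" and F: "finite F" "F \<subseteq> gen_maps V A"
    and X: "X \<subseteq> carrier (free_pro V A)" "\<And>S f. (S, f) \<in> gen_maps V A \<Longrightarrow> \<exists>y\<in>X. x (S, f) = y (S, f)"
  shows "\<exists>y\<in>X. \<forall>(S, f)\<in>F. x (S, f) = y (S, f)"
proof -
  obtain T g where T: "(T, g) \<in> gen_maps V A"
    "\<And>S f. (S, f) \<in> F \<Longrightarrow> \<exists>h\<in>sg_hom T S. \<forall>a\<in>A. h (g a) = f a"
    using joint_maps[OF F] by metis
  then obtain y where y: "y \<in> X" "x (T, g) = y (T, g)" using X by blast
  have "x (S, f) = y (S, f)" if Sf: "(S, f) \<in> F" for S f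
  proof -
    obtain h where h: "h \<in> sg_hom T S" "\<forall>a\<in>A. h (g a) = f a" using T(2) Sf by blast
    have "x (S, f) = h (x (T, g))"
      using free_pro_compat[OF x T(1) _ h(1), of f] h(2) F Sf by auto
    also have "\<dots> = y (S, f)"
      using free_pro_compat[OF _ T(1) _ h(1), of y f] h(2) F Sf y X by auto
    finally show ?thesis .
  qed
  then show ?thesis using y by auto
qed

subsection \<open>The topology\<close>

abbreviation coord_top :: "nat sgrp \<times> ('a \<Rightarrow> nat) \<Rightarrow> nat topology" where
  "coord_top \<equiv> \<lambda>(S, f). discrete_topology (carrier S)"

lemma topspace_free_pro [simp]: "topspace (free_pro_top V A) = carrier (free_pro V A)"
proof -
  have "carrier (free_pro V A) \<subseteq> (\<Pi>\<^sub>E c\<in>gen_maps V A. topspace (coord_top c))"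
    by (auto simp: free_pro_carrier PiE_def Pi_iff)
  then show ?thesis unfolding free_pro_top_def topspace_subtopology topspace_product_topology by blast
qed

lemma continuous_coord:
  assumes "(S, f) \<in> gen_maps V A"
  shows "continuous_map (free_pro_top V A) (discrete_topology (carrier S)) (\<lambda>x. x (S, f))"
proof -
  have "continuous_map (product_topology coord_top (gen_maps V A)) (coord_top (S, f)) (\<lambda>x. x (S, f))"
    using assms by (rule continuous_map_product_projection)
  then show ?thesis unfolding free_pro_top_def by (simp add: continuous_map_from_subtopology)
qed

lemma openin_coord:
  assumes "(S, f) \<in> gen_maps V A" "U \<subseteq> carrier S"
  shows "openin (free_pro_top V A) {y \<in> carrier (free_pro V A). y (S, f) \<in> U}"
  using openin_continuous_map_preimage[OF continuous_coord[OF assms(1)], of U] assms(2) by simp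

text \<open>A basic open set constrains finitely many coordinates, and directedness replaces these
  by one. Hence closure can be tested coordinate by coordinate.\<close>

lemma closure_free_pro_iff:
  assumes X: "X \<subseteq> carrier (free_pro V A)"
  shows "x \<in> free_pro_top V A closure_of X \<longleftrightarrow> x \<in> carrier (free_pro V A) \<and>
    (\<forall>S f. (S, f) \<in> gen_maps V A \<longrightarrow> (\<exists>y\<in>X. x (S, f) = y (S, f)))" (is "?l = ?r")
proof
  assume l: ?l
  then have x: "x \<in> carrier (free_pro V A)" by (simp add: in_closure_of)
  have "\<exists>y\<in>X. x (S, f) = y (S, f)" if Sf: "(S, f) \<in> gen_maps V A" for S f
  proof -
    let ?T = "{y \<in> carrier (free_pro V A). y (S, f) \<in> {x (S, f)}}"
    have "openin (free_pro_top V A) ?T"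
      using free_pro_value[OF x Sf] by (intro openin_coord[OF Sf]) auto
    moreover have "x \<in> ?T" using x by simp
    moreover have "\<forall>T. x \<in> T \<and> openin (free_pro_top V A) T \<longrightarrow> (\<exists>y. y \<in> X \<and> y \<in> T)"
      using l by (auto simp only: in_closure_of)
    ultimately obtain y where y: "y \<in> X" "y \<in> ?T" by meson
    then have "x (S, f) = y (S, f)" by simp
    with y(1) show ?thesis by (intro bexI)
  qed
  with x show ?r by (intro conjI allI impI)
next
  assume r: ?r
  show ?l
    unfolding in_closure_of
  proof (intro conjI allI impI)
    show "x \<in> topspace (free_pro_top V A)" using r by simp
  next
    fix T assume T: "x \<in> T \<and> openin (free_pro_top V A) T"
    then obtain T' where T': "openin (product_topology coord_top (gen_maps V A)) T'"
      "T = T' \<inter> carrier (free_pro V A)"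
      unfolding free_pro_top_def openin_subtopology by blast
    then have "x \<in> T'" using T by blast
    with T'(1) obtain U where U: "finite {i \<in> gen_maps V A. U i \<noteq> topspace (coord_top i)}"
      "x \<in> PiE (gen_maps V A) U" "PiE (gen_maps V A) U \<subseteq> T'"
      unfolding openin_product_topology_alt by blast
    let ?F = "{i \<in> gen_maps V A. U i \<noteq> topspace (coord_top i)}"
    obtain y where y: "y \<in> X" "\<forall>(S, f)\<in>?F. x (S, f) = y (S, f)"
      using joint_elt[OF _ U(1) _ X, of x] r by blast
    have "y \<in> PiE (gen_maps V A) U"
    proof (rule PiE_I)
      fix c assume c: "c \<in> gen_maps V A"
      show "y c \<in> U c"
      proof (cases "c \<in> ?F")
        case True
        then have "y c = x c" using y(2) by (cases c) auto
        then show ?thesis using U(2) c by auto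
      next
        case False
        then show ?thesis using c y(1) X free_pro_value[of y A] by (cases c) auto
      qed
    qed (use y(1) X free_pro_carrier[of y A] in \<open>auto simp: extensional_def\<close>)
    then show "\<exists>y. y \<in> X \<and> y \<in> T" using y X U T' by blast
  qed
qed

lemma Hausdorff_free_pro: "Hausdorff_space (free_pro_top V A)"
  unfolding free_pro_top_def
  by (intro Hausdorff_space_subtopology) (auto simp: Hausdorff_space_product_topology)

lemma closedin_coord_rel:
  assumes "(S, f) \<in> gen_maps V A" "(T, g) \<in> gen_maps V A"
  shows "closedin (product_topology coord_top (gen_maps V A))
    {x \<in> (\<Pi>\<^sub>E c\<in>gen_maps V A. topspace (coord_top c)). h (x (S, f)) = x (T, g)}"
proof -
  let ?P = "product_topology coord_top (gen_maps V A)"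
  have cm: "continuous_map ?P (coord_top (S, f)) (\<lambda>x. x (S, f))"
    "continuous_map ?P (coord_top (T, g)) (\<lambda>x. x (T, g))"
    by (rule continuous_map_product_projection[OF assms(1)] continuous_map_product_projection[OF assms(2)])+
  have "continuous_map (discrete_topology (carrier S)) (discrete_topology (UNIV :: nat set)) h" by simp
  then have "continuous_map ?P (discrete_topology (UNIV :: nat set)) (\<lambda>x. h (x (S, f)))"
    using continuous_map_compose[OF cm(1), of "discrete_topology (UNIV :: nat set)" h] by (simp add: o_def)
  moreover have "continuous_map ?P (discrete_topology (UNIV :: nat set)) (\<lambda>x. x (T, g))"
    using continuous_map_compose[OF cm(2), of "discrete_topology (UNIV :: nat set)" id] by (simp add: o_def)
  ultimately have "closedin ?P {x \<in> topspace ?P. h (x (S, f)) = x (T, g)}"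
    by (intro closedin_continuous_maps_eq[of "discrete_topology (UNIV :: nat set)"]) (auto simp: Hausdorff_space_discrete_topology)
  then show ?thesis by simp
qed

text \<open>Tychonoff for finite discrete factors; each compatibility condition is a closed relation
  between two coordinates. The identity homomorphism of one coordinate guarantees that the family of
  conditions is nonempty.\<close>

lemma compact_free_pro: "compact_space (free_pro_top V A)"
proof -
  let ?P = "product_topology coord_top (gen_maps V A)"
  let ?E = "\<Pi>\<^sub>E c\<in>gen_maps V A. topspace (coord_top c)"
  have "compact_space ?P"
    using gen_mapsD(5) by (auto simp: compact_space_product_topology compact_space_discrete_topology)
  moreover have "closedin ?P (carrier (free_pro V A))"
  proof -
    have "closedin ?P (\<Inter>(S, f, T, g, h)\<in>{(S, f, T, g, h). (S, f) \<in> gen_maps V A \<and> (T, g) \<in> gen_maps V A \<and>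
       h \<in> sg_hom S T \<and> (\<forall>a\<in>A. h (f a) = g a)}. {x \<in> ?E. h (x (S, f)) = x (T, g)})" (is "closedin _ ?I")
    proof (rule closedin_INT)
      obtain T g where "(T, g) \<in> gen_maps V A"
        using joint_maps[of "{}" A] by (metis empty_subsetI finite.emptyI)
      moreover have "id \<in> sg_hom T T" by (auto simp: sg_hom_def)
      ultimately show "{(S, f, T, g, h). (S, f) \<in> gen_maps V A \<and> (T, g) \<in> gen_maps V A \<and>
         h \<in> sg_hom S T \<and> (\<forall>a\<in>A. h (f a) = g a)} \<noteq> {}" by force
    qed (use closedin_coord_rel in auto)
    also have "?I = carrier (free_pro V A)"
    proof -
      obtain T g where "(T, g) \<in> gen_maps V A"
        using joint_maps[of "{}" A] by (metis empty_subsetI finite.emptyI)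
      moreover have "id \<in> sg_hom T T" by (auto simp: sg_hom_def)
      ultimately have "?I \<subseteq> ?E" by force
      moreover have E: "x \<in> ?E \<longleftrightarrow> x \<in> extensional (gen_maps V A) \<and>
          (\<forall>S f. (S, f) \<in> gen_maps V A \<longrightarrow> x (S, f) \<in> carrier S)" for x
        by (simp add: PiE_iff Ball_def split_paired_All conj_commute)
      ultimately have "x \<in> ?I \<longleftrightarrow> x \<in> ?E \<and> x \<in> ?I" for x by blast
      then show ?thesis
        unfolding set_eq_iff free_pro_carrier E by blast
    qed
    finally show ?thesis .
  qed
  ultimately show ?thesis
    unfolding free_pro_top_def using closedin_compact_space compact_space_subtopology by blast
qed

end

context pv
begin

subsection \<open>Extensions of homomorphisms\<close>

text \<open>The action of a homomorphism on coordinates, in the contravariant direction: evaluating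
  an image under \<open>\<phi>\<close> at \<open>f\<close> is evaluating the argument at the
  pulled-back map.\<close>

definition pull :: "'a set \<Rightarrow> ('a list \<Rightarrow> 'b list) \<Rightarrow> nat sgrp \<Rightarrow> ('b \<Rightarrow> nat) \<Rightarrow> 'a \<Rightarrow> nat" where
  "pull A \<phi> S f = (\<lambda>a\<in>A. word_value S f (\<phi> [a]))"

lemma pull_gen_maps:
  assumes \<phi>: "\<phi> \<in> sg_hom (free_sgrp A) (free_sgrp B)" and Sf: "(S, f) \<in> gen_maps V B"
  shows "(S, pull A \<phi> S f) \<in> gen_maps V A"
proof (rule gen_mapsI)
  show "pull A \<phi> S f \<in> A \<rightarrow>\<^sub>E carrier S"
    using word_value_closed[OF gen_mapsD(4,2)[OF Sf] hom_words_closed[OF \<phi>]]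
    by (auto simp: pull_def)
qed (rule gen_mapsD(1)[OF Sf])

lemma word_value_pull:
  assumes "\<phi> \<in> sg_hom (free_sgrp A) (free_sgrp B)" "(S, f) \<in> gen_maps V B" "w \<in> words A"
  shows "word_value S (pull A \<phi> S f) w = word_value S f (\<phi> w)"
  using word_value_free_hom[OF gen_mapsD(4,2)[OF assms(2)] assms(1,3)] by (simp add: pull_def)

text \<open>Words are dense, since every single coordinate of an element is attained by a word, and
  the target is Hausdorff.\<close>

lemma continuous_free_pro_words_eq:
  assumes "A \<noteq> {}" and F: "continuous_map (free_pro_top V A) (free_pro_top V B) F"
    and G: "continuous_map (free_pro_top V A) (free_pro_top V B) G"
    and eq: "\<And>w. w \<in> words A \<Longrightarrow> F (word_embed V A w) = G (word_embed V A w)"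
    and x: "x \<in> carrier (free_pro V A)"
  shows "F x = G x"
proof -
  let ?W = "word_embed V A ` words A"
  have W: "?W \<subseteq> carrier (free_pro V A)" using word_embed_carrier by blast
  have cl: "x \<in> free_pro_top V A closure_of ?W"
    unfolding closure_free_pro_iff[OF W]
  proof (intro conjI allI impI x)
    fix S f assume Sf: "(S, f) \<in> gen_maps V A"
    obtain w where "w \<in> words A" "x (S, f) = word_value S f w"
      using free_pro_coord_word[OF x Sf assms(1)] by blast
    then show "\<exists>y\<in>?W. x (S, f) = y (S, f)" using Sf by (intro bexI[of _ "word_embed V A w"]) auto
  qed
  show ?thesis
    by (rule forall_in_closure_of_eq[OF cl Hausdorff_free_pro F G]) (use eq in auto)
qed

text \<open>The extension is given explicitly: its coordinate at \<open>(S, f)\<close> is the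
  coordinate of the argument at the pulled-back map. Density of words identifies it with the
  definite description.\<close>

lemma pro_ext:
  assumes \<phi>: "\<phi> \<in> sg_hom (free_sgrp A) (free_sgrp B)" and "A \<noteq> {}"
  shows pro_ext_continuous: "continuous_map (free_pro_top V A) (free_pro_top V B) (pro_ext V A B \<phi>)"
    and pro_ext_word: "\<And>w. w \<in> words A \<Longrightarrow> pro_ext V A B \<phi> (word_embed V A w) = word_embed V B (\<phi> w)"
proof -
  let ?CA = "carrier (free_pro V A)" and ?CB = "carrier (free_pro V B)"
  define F where "F = restrict (\<lambda>x. \<lambda>(S, f)\<in>gen_maps V B. x (S, pull A \<phi> S f)) ?CA"
  have F: "F x (S, f) = x (S, pull A \<phi> S f)" if "x \<in> ?CA" "(S, f) \<in> gen_maps V B" for x S f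
    using that by (simp add: F_def)
  have Fcar: "F x \<in> ?CB" if x: "x \<in> ?CA" for x
    unfolding free_pro_carrier
  proof (intro conjI allI impI)
    fix S f T g h
    assume *: "(S, f) \<in> gen_maps V B" "(T, g) \<in> gen_maps V B" "h \<in> sg_hom S T" "\<forall>b\<in>B. h (f b) = g b"
    have "h (pull A \<phi> S f a) = pull A \<phi> T g a" if "a \<in> A" for a
      using word_value_hom[OF *(3) gen_mapsD(4,2)[OF *(1)] hom_words_closed[OF \<phi>], of "[a]" g] that *(4)
      by (simp add: pull_def)
    then have "h (x (S, pull A \<phi> S f)) = x (T, pull A \<phi> T g)"
      by (rule free_pro_compat[OF x pull_gen_maps[OF \<phi> *(1)] pull_gen_maps[OF \<phi> *(2)] *(3)])
    then show "h (F x (S, f)) = F x (T, g)" using F[OF x] * by simp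
  next
    fix S f assume "(S, f) \<in> gen_maps V B"
    then show "F x (S, f) \<in> carrier S" using F[OF x] free_pro_value[OF x] pull_gen_maps[OF \<phi>] by simp
  qed (use x in \<open>simp add: F_def\<close>)
  have Fhom: "F \<in> sg_hom (free_pro V A) (free_pro V B)"
    unfolding sg_hom_def
  proof (intro CollectI conjI ballI Pi_I Fcar)
    fix x y assume xy: "x \<in> ?CA" "y \<in> ?CA"
    show "F (sg_mult (free_pro V A) x y) = sg_mult (free_pro V B) (F x) (F y)"
    proof (rule free_pro_eqI)
      fix S f assume "(S, f) \<in> gen_maps V B"
      then show "F (sg_mult (free_pro V A) x y) (S, f) = sg_mult (free_pro V B) (F x) (F y) (S, f)"
        using xy free_pro_closed[OF xy] pull_gen_maps[OF \<phi>] by (simp add: F free_pro_mult)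
    qed (use xy in \<open>simp_all add: Fcar free_pro_closed\<close>)
  qed
  have Fcont: "continuous_map (free_pro_top V A) (free_pro_top V B) F"
  proof -
    have "continuous_map (free_pro_top V A) (product_topology coord_top (gen_maps V B)) F"
      unfolding continuous_map_componentwise
    proof (intro conjI ballI)
      show "F ` topspace (free_pro_top V A) \<subseteq> extensional (gen_maps V B)"
        by (auto simp: F_def)
      fix c assume "c \<in> gen_maps V B"
      then obtain S f where c: "c = (S, f)" "(S, f) \<in> gen_maps V B" by (cases c) auto
      have "continuous_map (free_pro_top V A) (discrete_topology (carrier S)) (\<lambda>x. x (S, pull A \<phi> S f))"
        by (rule continuous_coord[OF pull_gen_maps[OF \<phi> c(2)]])
      then show "continuous_map (free_pro_top V A) (coord_top c) (\<lambda>x. F x c)"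
        unfolding c prod.case by (rule continuous_map_eq) (use F c in auto)
    qed
    then show ?thesis
      unfolding free_pro_top_def[of V B] continuous_map_in_subtopology using Fcar by auto
  qed
  have Fword: "F (word_embed V A w) = word_embed V B (\<phi> w)" if w: "w \<in> words A" for w
  proof (rule free_pro_eqI)
    show "F (word_embed V A w) \<in> ?CB" using Fcar word_embed_carrier[OF w] by blast
    show "word_embed V B (\<phi> w) \<in> ?CB" using word_embed_carrier hom_words_closed[OF \<phi> w] by blast
    fix S f assume "(S, f) \<in> gen_maps V B"
    then show "F (word_embed V A w) (S, f) = word_embed V B (\<phi> w) (S, f)"
      using F[OF word_embed_carrier[OF w]] word_value_pull[OF \<phi> _ w] pull_gen_maps[OF \<phi>] by simp
  qed
  have "pro_ext V A B \<phi> = F"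
    unfolding pro_ext_def
  proof (rule the_equality)
    show "F \<in> extensional ?CA \<and> F \<in> sg_hom (free_pro V A) (free_pro V B) \<and>
      continuous_map (free_pro_top V A) (free_pro_top V B) F \<and>
      (\<forall>w\<in>carrier (free_sgrp A). F (word_embed V A w) = word_embed V B (\<phi> w))"
      using Fhom Fcont Fword by (simp add: F_def)
    fix G assume G: "G \<in> extensional ?CA \<and> G \<in> sg_hom (free_pro V A) (free_pro V B) \<and>
      continuous_map (free_pro_top V A) (free_pro_top V B) G \<and>
      (\<forall>w\<in>carrier (free_sgrp A). G (word_embed V A w) = word_embed V B (\<phi> w))"
    show "G = F"
    proof (rule extensionalityI[of _ ?CA])
      show "F \<in> extensional ?CA" by (simp add: F_def)
      fix x assume "x \<in> ?CA"
      then show "G x = F x"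
        using continuous_free_pro_words_eq[OF assms(2) _ Fcont, of G x] G Fword by simp
    qed (use G in blast)
  qed
  then show "continuous_map (free_pro_top V A) (free_pro_top V B) (pro_ext V A B \<phi>)"
    and "\<And>w. w \<in> words A \<Longrightarrow> pro_ext V A B \<phi> (word_embed V A w) = word_embed V B (\<phi> w)"
    using Fcont Fword by simp_all
qed

text \<open>The image of a compact space in a Hausdorff space is closed, so it contains the closure
  of the images of words. This turns membership in the image into a condition on each coordinate and
  is the tool for saturation.\<close>

lemma pro_ext_imageI:
  assumes \<phi>: "\<phi> \<in> sg_hom (free_sgrp A) (free_sgrp B)" and A: "A \<noteq> {}"
    and x: "x \<in> carrier (free_pro V B)"
    and xw: "\<And>S f. (S, f) \<in> gen_maps V B \<Longrightarrow> \<exists>v\<in>words A. x (S, f) = word_value S f (\<phi> v)"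
  shows "x \<in> pro_ext V A B \<phi> ` carrier (free_pro V A)"
proof -
  let ?K = "pro_ext V A B \<phi> ` carrier (free_pro V A)"
  let ?W = "(\<lambda>v. word_embed V B (\<phi> v)) ` words A"
  have "compactin (free_pro_top V A) (carrier (free_pro V A))"
    using compact_free_pro[of A] by (simp add: compact_space_def)
  then have "compactin (free_pro_top V B) ?K"
    using image_compactin pro_ext_continuous[OF \<phi> A] by blast
  then have K: "closedin (free_pro_top V B) ?K"
    using compactin_imp_closedin[OF Hausdorff_free_pro] by blast
  have W: "?W \<subseteq> carrier (free_pro V B)"
    using word_embed_carrier hom_words_closed[OF \<phi>] by blast
  have "?W \<subseteq> ?K"
    using pro_ext_word[OF \<phi> A] word_embed_carrier by force
  have "x \<in> free_pro_top V B closure_of ?W"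
    unfolding closure_free_pro_iff[OF W]
  proof (intro conjI allI impI x)
    fix S f assume Sf: "(S, f) \<in> gen_maps V B"
    then obtain v where "v \<in> words A" "x (S, f) = word_value S f (\<phi> v)" using xw by blast
    then show "\<exists>y\<in>?W. x (S, f) = y (S, f)" using Sf by (intro bexI[of _ "word_embed V B (\<phi> v)"]) auto
  qed
  then show ?thesis using closure_of_minimal[OF \<open>?W \<subseteq> ?K\<close> K] by blast
qed

end

subsection \<open>Testing the factors of bounded length\<close>

definition lastn :: "nat \<Rightarrow> 'a list \<Rightarrow> 'a list" where
  "lastn m w = drop (length w - m) w"

definition tested :: "'a list set \<Rightarrow> nat \<Rightarrow> 'a list set" where
  "tested L m = {w. \<forall>u. sublist u w \<longrightarrow> u \<noteq> [] \<longrightarrow> length u \<le> m \<longrightarrow> u \<in> L}"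

text \<open>A locally testable congruence: the prefix and suffix of length \<open>m\<close>, and
  whether a short factor outside \<open>L\<close> occurs. \<open>None\<close> collects the words
  with a forbidden factor and becomes the zero.\<close>

definition test :: "'a list set \<Rightarrow> nat \<Rightarrow> 'a list \<Rightarrow> ('a list \<times> 'a list) option" where
  "test L m w = (if w \<in> tested L m then Some (take m w, lastn m w) else None)"

definition test_mult :: "'a list set \<Rightarrow> nat \<Rightarrow> ('a list \<times> 'a list) option \<Rightarrow> ('a list \<times> 'a list) option \<Rightarrow>
    ('a list \<times> 'a list) option" where
  "test_mult L m x y = (case (x, y) of (Some (p, s), Some (p', s')) \<Rightarrow>
       if s @ p' \<in> tested L m then Some (take m (p @ p'), lastn m (s @ s')) else None
     | _ \<Rightarrow> None)"

lemma tested_sublist: "w \<in> tested L m \<Longrightarrow> sublist u w \<Longrightarrow> u \<in> tested L m"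
  unfolding tested_def using sublist_order.order.trans by blast

lemma suffix_lastn: "suffix (lastn m w) w"
  by (simp add: lastn_def suffix_drop)

lemma suffix_lastn_short: "suffix u w \<Longrightarrow> length u \<le> m \<Longrightarrow> suffix u (lastn m w)"
  by (auto simp: suffix_def lastn_def)

lemma prefix_take_short: "prefix u w \<Longrightarrow> length u \<le> m \<Longrightarrow> prefix u (take m w)"
  by (auto simp: prefix_def)

lemma sublist_append_mono:
  assumes "suffix a a'" "prefix b b'"
  shows "sublist (a @ b) (a' @ b')"
proof -
  obtain x y where "a' = x @ a" "b' = b @ y" using assms by (auto simp: suffix_def prefix_def)
  then have "a' @ b' = x @ (a @ b) @ y" by simp
  then show ?thesis unfolding sublist_def by blast
qed

text \<open>A short factor of a product lies in one of the two words or straddles the cut, and then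
  it reaches at most \<open>m\<close> letters to each side.\<close>

lemma tested_append:
  "u @ v \<in> tested L m \<longleftrightarrow> u \<in> tested L m \<and> v \<in> tested L m \<and> lastn m u @ take m v \<in> tested L m"
proof (intro iffI conjI)
  assume *: "u @ v \<in> tested L m"
  show "u \<in> tested L m" "v \<in> tested L m" using tested_sublist[OF *] by auto
  have "sublist (lastn m u @ take m v) (u @ v)"
    by (intro sublist_append_mono suffix_lastn take_is_prefix)
  then show "lastn m u @ take m v \<in> tested L m" by (rule tested_sublist[OF *])
next
  assume *: "u \<in> tested L m \<and> v \<in> tested L m \<and> lastn m u @ take m v \<in> tested L m"
  show "u @ v \<in> tested L m"
    unfolding tested_def
  proof (intro CollectI allI impI)
    fix z assume z: "sublist z (u @ v)" "z \<noteq> []" "length z \<le> m"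
    consider "sublist z u" | "sublist z v" | z1 z2 where "z = z1 @ z2" "suffix z1 u" "prefix z2 v"
      using z(1) unfolding sublist_append by blast
    then show "z \<in> L"
    proof cases
      case 3
      then have "sublist z (lastn m u @ take m v)"
        using z(3) by (auto intro!: sublist_append_mono suffix_lastn_short prefix_take_short)
      then show ?thesis using * z unfolding tested_def by blast
    qed (use * z in \<open>auto simp: tested_def\<close>)
  qed
qed

lemma take_append_take: "take m (u @ v) = take m (take m u @ take m v)"
  by (simp add: min_def)

lemma lastn_append_lastn: "lastn m (u @ v) = lastn m (lastn m u @ lastn m v)"
  by (cases "length v \<ge> m"; cases "length u + length v \<ge> m"; cases "length u \<ge> m")
    (auto simp: lastn_def add.commute)

lemma test_append: "test L m (u @ v) = test_mult L m (test L m u) (test L m v)"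
  unfolding test_def test_mult_def tested_append[of u v]
  using take_append_take[of m u v] lastn_append_lastn[of m u v] by simp

definition test_sgrp :: "'a::countable set \<Rightarrow> 'a list set \<Rightarrow> nat \<Rightarrow> nat sgrp" where
  "test_sgrp A L m = nat_copy \<lparr>carrier = test L m ` words A, sg_mult = test_mult L m\<rparr>"

definition test_map :: "'a::countable set \<Rightarrow> 'a list set \<Rightarrow> nat \<Rightarrow> 'a \<Rightarrow> nat" where
  "test_map A L m = (\<lambda>a\<in>A. to_nat (test L m [a]))"

text \<open>If the class of \<open>w\<close> is idempotent and not the zero, then \<open>w\<close>
  and \<open>w @ w\<close> have prefixes of equal length, so \<open>w\<close> has at least
  \<open>m\<close> letters and determines both ends of \<open>w @ v @ w\<close>. Hence each local
  monoid is contained in a set consisting of the zero and its idempotent, which is a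
  semilattice.\<close>

lemma test_mult_idem_sandwich:
  assumes m: "m \<ge> 1" and w: "w \<noteq> []" and idem: "test L m (w @ w) = test L m w"
  shows "test L m (w @ v @ w) \<in> {None, test L m w}"
proof (cases "w @ v @ w \<in> tested L m")
  case True
  then have "w \<in> tested L m" using tested_sublist[of "w @ v @ w" L m w] by simp
  then have "take m (w @ w) = take m w" using idem by (auto simp: test_def split: if_splits)
  then have "length (take m (w @ w)) = length (take m w)" by (rule arg_cong)
  moreover have "length w > 0" using w by simp
  ultimately have "length w \<ge> m" unfolding length_take length_append by linarith
  then have "m - length w = 0" by simp
  then have "take m (w @ v @ w) = take m w" "lastn m (w @ v @ w) = lastn m w"
    by (simp_all add: lastn_def)
  then show ?thesis using True \<open>w \<in> tested L m\<close> by (simp add: test_def)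
qed (simp add: test_def)

lemma test_sgrp_LSl:
  assumes A: "finite A" "A \<noteq> {}" and m: "m \<ge> 1"
  shows "test_sgrp A L m \<in> LSl"
proof -
  define U where "U = \<lparr>carrier = test L m ` words A, sg_mult = test_mult L m\<rparr>"
  have U: "test_sgrp A L m = nat_copy U" by (simp add: test_sgrp_def U_def)
  have mU: "sg_mult U (test L m u) (test L m v) = test L m (u @ v)" for u v
    by (simp add: U_def test_append)
  have cU: "x \<in> carrier U \<longleftrightarrow> (\<exists>w\<in>words A. x = test L m w)" for x
    by (auto simp: U_def)
  have "sgroup_axioms U"
    unfolding sgroup_axioms_def
  proof (intro conjI ballI)
    obtain a where "a \<in> A" using A by blast
    then show "carrier U \<noteq> {}" using cU[of "test L m [a]"] by auto
    fix x y assume "x \<in> carrier U" "y \<in> carrier U"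
    then obtain u v where uv: "u \<in> words A" "v \<in> words A" "x = test L m u" "y = test L m v"
      unfolding cU by blast
    then show "sg_mult U x y \<in> carrier U" unfolding uv(3,4) mU cU by blast
    fix z assume "z \<in> carrier U"
    then obtain w where "z = test L m w" unfolding cU by blast
    then show "sg_mult U (sg_mult U x y) z = sg_mult U x (sg_mult U y z)"
      by (simp add: uv mU)
  qed
  moreover have "finite (carrier U)"
  proof (rule finite_subset)
    let ?B = "{w. set w \<subseteq> A \<and> length w \<le> m}"
    have "test L m w \<in> insert None (Some ` (?B \<times> ?B))" if w: "w \<in> words A" for w
    proof -
      have "take m w \<in> ?B" "lastn m w \<in> ?B"
        using w by (auto simp: words_def lastn_def dest: in_set_takeD in_set_dropD)
      then show ?thesis unfolding test_def by simp
    qed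
    then show "carrier U \<subseteq> insert None (Some ` (?B \<times> ?B))" by (auto simp: U_def)
    show "finite (insert None (Some ` (?B \<times> ?B)))"
      using finite_lists_length_le[OF A(1)] by blast
  qed
  ultimately have fin: "test_sgrp A L m \<in> finite_sgrps" unfolding U by (rule nat_copy_finite_sgrps)
  let ?T = "test_sgrp A L m"
  have mT: "sg_mult ?T (to_nat (test L m u)) (to_nat (test L m v)) = to_nat (test L m (u @ v))" for u v
    by (simp add: U mU)
  have mN: "sg_mult ?T (to_nat (None :: ('a list \<times> 'a list) option)) (to_nat x) =
      to_nat (None :: ('a list \<times> 'a list) option)"
    "sg_mult ?T (to_nat x) (to_nat (None :: ('a list \<times> 'a list) option)) =
      to_nat (None :: ('a list \<times> 'a list) option)" for x :: "('a list \<times> 'a list) option"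
    by (simp_all add: U U_def test_mult_def split: option.splits)
  have "let M = {sg_mult ?T (sg_mult ?T e x) e | x. x \<in> carrier ?T} in
     (\<forall>x\<in>M. \<forall>y\<in>M. sg_mult ?T x y = sg_mult ?T y x) \<and> (\<forall>x\<in>M. sg_mult ?T x x = x)"
    if e: "e \<in> idempotents ?T" for e
  proof -
    have "e \<in> carrier ?T" using e by (simp add: idempotents_def)
    then obtain w where w: "w \<in> words A" "e = to_nat (test L m w)" by (auto simp: U cU)
    have "sg_mult ?T e e = e" using e by (simp add: idempotents_def)
    then have idem: "test L m (w @ w) = test L m w" unfolding w(2) mT by simp
    have M: "sg_mult ?T (sg_mult ?T e x) e \<in> {to_nat (None :: ('a list \<times> 'a list) option), e}"
      if x: "x \<in> carrier ?T" for x
    proof -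
      obtain v where "x = to_nat (test L m v)" using x by (auto simp: U cU)
      then have "sg_mult ?T (sg_mult ?T e x) e = to_nat (test L m (w @ v @ w))"
        by (simp add: w mT)
      then show ?thesis
        using test_mult_idem_sandwich[OF m words_nonempty[OF w(1)] idem, of v] w(2) by auto
    qed
    define N where "N = to_nat (None :: ('a list \<times> 'a list) option)"
    have ee: "sg_mult ?T e e = e" using e by (simp add: idempotents_def)
    have N: "sg_mult ?T e N = N" "sg_mult ?T N e = N" "sg_mult ?T N N = N"
      unfolding w(2) N_def by (rule mN)+
    show ?thesis
      unfolding Let_def
    proof (intro conjI ballI)
      fix x y
      assume "x \<in> {sg_mult ?T (sg_mult ?T e x) e | x. x \<in> carrier ?T}"
        "y \<in> {sg_mult ?T (sg_mult ?T e x) e | x. x \<in> carrier ?T}"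
      then have "x = N \<or> x = e" "y = N \<or> y = e" using M unfolding N_def by fast+
      then show "sg_mult ?T x y = sg_mult ?T y x" using N by (elim disjE) simp_all
    next
      fix x
      assume "x \<in> {sg_mult ?T (sg_mult ?T e x) e | x. x \<in> carrier ?T}"
      then have "x = N \<or> x = e" using M unfolding N_def by fast
      then show "sg_mult ?T x x = x" using N ee by (elim disjE) simp_all
    qed
  qed
  then show ?thesis using fin unfolding LSl_def by (intro CollectI conjI ballI)
qed

lemma mult_test_sgrp:
  "sg_mult (test_sgrp A L m) (to_nat (test L m u)) (to_nat (test L m v)) = to_nat (test L m (u @ v))"
  by (simp add: test_sgrp_def test_append)

lemma word_value_test:
  assumes "w \<in> words A"
  shows "word_value (test_sgrp A L m) (test_map A L m) w = to_nat (test L m w)"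
  using assms
proof (induction w)
  case (Cons a w)
  have a: "test_map A L m a = to_nat (test L m [a])"
    using Cons.prems by (simp add: words_Cons test_map_def)
  show ?case
  proof (cases "w = []")
    case False
    then have "w \<in> words A" using Cons.prems by (auto simp: words_def)
    then have "word_value (test_sgrp A L m) (test_map A L m) (a # w) = to_nat (test L m ([a] @ w))"
      using Cons.IH mult_test_sgrp[of A L m "[a]" w] by (simp only: word_value_Cons[OF False] a)
    then show ?thesis by simp
  qed (simp only: word_value.simps a)
qed (simp add: words_def)

lemma (in pv) test_gen_maps:
  assumes "finite A" "A \<noteq> {}" "m \<ge> 1" "LSl \<subseteq> V"
  shows "(test_sgrp A L m, test_map A L m) \<in> gen_maps V A"
proof (rule gen_mapsI)
  show "test_sgrp A L m \<in> V" using test_sgrp_LSl[OF assms(1-3)] assms(4) by blast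
  show "test_map A L m \<in> A \<rightarrow>\<^sub>E carrier (test_sgrp A L m)"
    unfolding test_map_def test_sgrp_def by (rule restrict_PiE_iff[THEN iffD2]) auto
qed

subsection \<open>Maximal subgroups\<close>

text \<open>The group of units of the local monoid eSe, which for idempotent \<open>e\<close> is the
  H-class of \<open>e\<close>.\<close>

definition units_at :: "'s sgrp \<Rightarrow> 's \<Rightarrow> 's set" where
  "units_at S e = {x \<in> carrier S. sg_mult S e x = x \<and> sg_mult S x e = x \<and>
     (\<exists>y\<in>carrier S. sg_mult S e y = y \<and> sg_mult S y e = y \<and> sg_mult S x y = e \<and> sg_mult S y x = e)}"

lemma units_at_closed:
  assumes S: "sgroup_axioms S" and x: "x \<in> units_at S e" and y: "y \<in> units_at S e"
  shows "sg_mult S x y \<in> units_at S e"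
proof -
  obtain x' where x': "x' \<in> carrier S" "sg_mult S e x' = x'" "sg_mult S x' e = x'"
    "sg_mult S x x' = e" "sg_mult S x' x = e" using x unfolding units_at_def by blast
  obtain y' where y': "y' \<in> carrier S" "sg_mult S e y' = y'" "sg_mult S y' e = y'"
    "sg_mult S y y' = e" "sg_mult S y' y = e" using y unfolding units_at_def by blast
  have xe: "x \<in> carrier S" "sg_mult S e x = x" "sg_mult S x e = x" using x by (auto simp: units_at_def)
  have ye: "y \<in> carrier S" "sg_mult S e y = y" "sg_mult S y e = y" using y by (auto simp: units_at_def)
  have e: "e \<in> carrier S" using sgroup_closed[OF S xe(1) x'(1)] x' by simp
  note c = sgroup_closed[OF S] and as = sgroup_assoc[OF S]
  have "sg_mult S (sg_mult S x y) (sg_mult S y' x') = sg_mult S x (sg_mult S (sg_mult S y y') x')"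
    using xe(1) ye(1) x'(1) y'(1) by (simp only: as c)
  then have 1: "sg_mult S (sg_mult S x y) (sg_mult S y' x') = e" by (simp add: x' y')
  have "sg_mult S (sg_mult S y' x') (sg_mult S x y) = sg_mult S y' (sg_mult S (sg_mult S x' x) y)"
    using xe(1) ye(1) x'(1) y'(1) by (simp only: as c)
  then have 2: "sg_mult S (sg_mult S y' x') (sg_mult S x y) = e" by (simp add: x' y' ye)
  have 3: "sg_mult S e (sg_mult S x y) = sg_mult S x y" "sg_mult S (sg_mult S x y) e = sg_mult S x y"
    using as[OF e xe(1) ye(1)] as[OF xe(1) ye(1) e] xe ye by simp_all
  have 4: "sg_mult S e (sg_mult S y' x') = sg_mult S y' x'" "sg_mult S (sg_mult S y' x') e = sg_mult S y' x'"
    using as[OF e y'(1) x'(1)] as[OF y'(1) x'(1) e] x' y' by simp_all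
  show ?thesis
    unfolding units_at_def using 1 2 3 4 c[OF xe(1) ye(1)] c[OF y'(1) x'(1)] by blast
qed

lemma idempotent_units_at: "e \<in> idempotents S \<Longrightarrow> e \<in> units_at S e"
  unfolding idempotents_def units_at_def by blast

lemma subgroup_of_units_at:
  assumes S: "sgroup_axioms S" and e: "e \<in> idempotents S"
  shows "subgroup_of (units_at S e) S"
proof -
  have "group \<lparr>carrier = units_at S e, monoid.mult = sg_mult S, one = e\<rparr>" (is "group ?G")
  proof (rule groupI)
    fix x y z
    assume "x \<in> carrier ?G" "y \<in> carrier ?G" "z \<in> carrier ?G"
    then show "x \<otimes>\<^bsub>?G\<^esub> y \<otimes>\<^bsub>?G\<^esub> z = x \<otimes>\<^bsub>?G\<^esub> (y \<otimes>\<^bsub>?G\<^esub> z)"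
      using sgroup_assoc[OF S] by (simp add: units_at_def)
  next
    fix x assume x: "x \<in> carrier ?G"
    then obtain y where "y \<in> carrier S" "sg_mult S e y = y" "sg_mult S y e = y"
      "sg_mult S x y = e" "sg_mult S y x = e" unfolding units_at_def by auto
    moreover from this x have "y \<in> units_at S e" unfolding units_at_def by auto
    ultimately show "\<exists>y\<in>carrier ?G. y \<otimes>\<^bsub>?G\<^esub> x = \<one>\<^bsub>?G\<^esub>" by auto
  qed (use units_at_closed[OF S] idempotent_units_at[OF e] in \<open>auto simp: units_at_def\<close>)
  then show ?thesis
    unfolding subgroup_of_def is_group_def by (auto simp: units_at_def)
qed

lemma subgroup_ofE:
  assumes "subgroup_of H S"
  obtains e where "e \<in> idempotents S" "e \<in> H" "H \<subseteq> units_at S e"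
    "\<And>x y. x \<in> H \<Longrightarrow> y \<in> H \<Longrightarrow> sg_mult S x y \<in> H"
    "\<And>x. x \<in> H \<Longrightarrow> \<exists>y\<in>H. sg_mult S x y = e \<and> sg_mult S y x = e"
proof -
  obtain e where G: "group \<lparr>carrier = H, monoid.mult = sg_mult S, one = e\<rparr>" and H: "H \<subseteq> carrier S"
    using assms by (auto simp: subgroup_of_def is_group_def)
  let ?G = "\<lparr>carrier = H, monoid.mult = sg_mult S, one = e\<rparr>"
  interpret G: group ?G by (rule G)
  have e: "e \<in> H" using G.one_closed by simp
  have mul: "x \<in> H \<Longrightarrow> y \<in> H \<Longrightarrow> sg_mult S x y \<in> H" for x y using G.m_closed[of x y] by simp
  have l: "x \<in> H \<Longrightarrow> sg_mult S e x = x" and r: "x \<in> H \<Longrightarrow> sg_mult S x e = x" for x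
    using G.l_one[of x] G.r_one[of x] by simp_all
  have inv: "\<exists>y\<in>H. sg_mult S x y = e \<and> sg_mult S y x = e" if "x \<in> H" for x
    using G.l_inv[of x] G.r_inv[of x] G.inv_closed[of x] that by auto
  have "H \<subseteq> units_at S e"
  proof
    fix x assume x: "x \<in> H"
    obtain y where "y \<in> H" "sg_mult S x y = e" "sg_mult S y x = e" using inv[OF x] by blast
    then show "x \<in> units_at S e" unfolding units_at_def using x H l r by blast
  qed
  moreover have "e \<in> idempotents S" using e l H by (auto simp: idempotents_def)
  ultimately show ?thesis using that e mul inv by blast
qed

lemma idempotent_in_units_at:
  assumes S: "sgroup_axioms S" and f: "f \<in> units_at S e" "sg_mult S f f = f" 
  shows "f = e"
proof -
  obtain y where y: "y \<in> carrier S" "sg_mult S f y = e" "sg_mult S e f = f"  "sg_mult S f e = f" "f \<in> carrier S"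
    using f(1) unfolding units_at_def by blast
  have "f = sg_mult S f (sg_mult S f y)" using y by simp
  also have "\<dots> = sg_mult S (sg_mult S f f) y" using sgroup_assoc[OF S, of f f y] y by simp
  also have "\<dots> = e" using f y by simp
  finally show ?thesis .
qed

text \<open>Every subgroup consists of units at its identity. A group of units contains only one
  idempotent, so a larger subgroup has the same identity and stays inside the same group of
  units.\<close>

lemma maximal_subgroup_iff:
  assumes S: "sgroup_axioms S"
  shows "maximal_subgroup H S \<longleftrightarrow> (\<exists>e\<in>idempotents S. H = units_at S e)"
proof
  assume H: "maximal_subgroup H S"
  then have "subgroup_of H S" by (simp add: maximal_subgroup_def)
  then obtain e where e: "e \<in> idempotents S" "H \<subseteq> units_at S e" by (rule subgroup_ofE)
  with H have "H = units_at S e"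
    using subgroup_of_units_at[OF S e(1)] unfolding maximal_subgroup_def by blast
  with e show "\<exists>e\<in>idempotents S. H = units_at S e" by blast
next
  assume "\<exists>e\<in>idempotents S. H = units_at S e"
  then obtain e where e: "e \<in> idempotents S" "H = units_at S e" by blast
  have "K = H" if K: "subgroup_of K S" "H \<subseteq> K" for K
  proof -
    obtain f where f: "f \<in> idempotents S" "K \<subseteq> units_at S f" using subgroup_ofE[OF K(1)] by metis
    have "e \<in> units_at S f" using idempotent_units_at[OF e(1)] e(2) K(2) f(2) by blast
    then have "e = f" using idempotent_in_units_at[OF S] e(1) by (auto simp: idempotents_def)
    then show ?thesis using f e K by blast
  qed
  then show "maximal_subgroup H S"
    unfolding maximal_subgroup_def using subgroup_of_units_at[OF S e(1)] e(2) by blast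
qed

subsection \<open>Green's relation \<open>\<J>\<close>\<close>

lemma principal_ideal_closed:
  assumes S: "sgroup_axioms S" and b: "b \<in> carrier S" and a: "a \<in> principal_ideal S b" and x: "x \<in> carrier S"
  shows "a \<in> carrier S" "sg_mult S x a \<in> principal_ideal S b" "sg_mult S a x \<in> principal_ideal S b"
proof -
  note c = sgroup_closed[OF S] and as = sgroup_assoc[OF S]
  consider "a = b" | p where "p \<in> carrier S" "a = sg_mult S p b" | q where "q \<in> carrier S" "a = sg_mult S b q"
    | p q where "p \<in> carrier S" "q \<in> carrier S" "a = sg_mult S (sg_mult S p b) q"
    using a unfolding principal_ideal_def by blast
  then have "a \<in> carrier S \<and> sg_mult S x a \<in> principal_ideal S b \<and> sg_mult S a x \<in> principal_ideal S b"
  proof cases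
    case 1
    then show ?thesis using b x unfolding principal_ideal_def by blast
  next
    case 2
    then have "sg_mult S x a = sg_mult S (sg_mult S x p) b" using as b x by simp
    then show ?thesis using 2 b x c unfolding principal_ideal_def by blast
  next
    case 3
    then have "sg_mult S x a = sg_mult S (sg_mult S x b) q" "sg_mult S a x = sg_mult S b (sg_mult S q x)"
      using as b x by simp_all
    then show ?thesis using 3 b x c unfolding principal_ideal_def by blast
  next
    case 4
    then have "sg_mult S x a = sg_mult S (sg_mult S (sg_mult S x p) b) q"
      "sg_mult S a x = sg_mult S (sg_mult S p b) (sg_mult S q x)"
      using as b x c by simp_all
    then show ?thesis using 4 b x c unfolding principal_ideal_def by blast
  qed
  then show "a \<in> carrier S" "sg_mult S x a \<in> principal_ideal S b" "sg_mult S a x \<in> principal_ideal S b"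
    by blast+
qed

lemma principal_ideal_mono:
  assumes S: "sgroup_axioms S" and b: "b \<in> carrier S" and a: "a \<in> principal_ideal S b"
  shows "principal_ideal S a \<subseteq> principal_ideal S b"
proof
  fix x assume "x \<in> principal_ideal S a"
  then consider "x = a" | p where "p \<in> carrier S" "x = sg_mult S p a" | q where "q \<in> carrier S" "x = sg_mult S a q"
    | p q where "p \<in> carrier S" "q \<in> carrier S" "x = sg_mult S (sg_mult S p a) q"
    unfolding principal_ideal_def by blast
  then show "x \<in> principal_ideal S b"
    by cases (simp_all add: a principal_ideal_closed(2,3)[OF S b])
qed

lemma green_J_iff:
  assumes S: "sgroup_axioms S"
  shows "green_J S a b \<longleftrightarrow> a \<in> carrier S \<and> b \<in> carrier S \<and> a \<in> principal_ideal S b \<and> b \<in> principal_ideal S a"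
proof -
  have "x \<in> principal_ideal S x" for x by (simp add: principal_ideal_def)
  then show ?thesis
    using principal_ideal_mono[OF S, of b a] principal_ideal_mono[OF S, of a b]
    unfolding green_J_def by (metis subset_antisym)
qed

lemma principal_ideal_sandwich:
  "p \<in> carrier S \<Longrightarrow> q \<in> carrier S \<Longrightarrow> sg_mult S (sg_mult S p b) q \<in> principal_ideal S b"
  unfolding principal_ideal_def by blast

text \<open>A missing outer factor is supplied by \<open>f\<close> itself, which makes the one-sided
  cases two-sided.\<close>

lemma principal_ideal_idempotentE:
  assumes S: "sgroup_axioms S" and a: "a \<in> principal_ideal S f" and f: "f \<in> idempotents S"
  obtains p q where "p \<in> carrier S" "q \<in> carrier S" "a = sg_mult S (sg_mult S p f) q"
proof -
  note as = sgroup_assoc[OF S]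
  have ff: "f \<in> carrier S" "sg_mult S f f = f" using f by (auto simp: idempotents_def)
  consider "a = f" | p where "p \<in> carrier S" "a = sg_mult S p f" | q where "q \<in> carrier S" "a = sg_mult S f q"
    | p q where "p \<in> carrier S" "q \<in> carrier S" "a = sg_mult S (sg_mult S p f) q"
    using a unfolding principal_ideal_def by blast
  then show ?thesis
  proof cases
    case 1
    then show ?thesis using that[of f f] ff by simp
  next
    case 2
    then show ?thesis using that[of p f] ff as by simp
  next
    case 3
    then show ?thesis using that[of f q] ff by simp
  qed (use that in blast)
qed

text \<open>In a finite semigroup an idempotent below a \<open>\<J>\<close>-equivalent idempotent is equal to it.\<close>

lemma finite_idempotent_cancel:
  assumes S: "sgroup_axioms S" "finite (carrier S)"
    and f: "f \<in> carrier S" "sg_mult S f f = f"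
    and g: "g \<in> carrier S" "sg_mult S g g = g" "sg_mult S g f = g" "sg_mult S f g = g"
    and c: "c \<in> carrier S" "sg_mult S c f = c" and d: "d \<in> carrier S"
    and fcd: "f = sg_mult S (sg_mult S c g) d"
  shows "g = f"
proof -
  note cl = sgroup_closed[OF S(1)] and as = sgroup_assoc[OF S(1)]
  let ?h = "sg_mult S g d"
  have h: "?h \<in> carrier S" using g d cl by simp
  have fch: "sg_mult S c ?h = f" using fcd as g d c by simp
  \<comment> \<open>As \<open>c\<close> absorbs \<open>f\<close> on the right, the equation
    \<open>f = c ?h\<close> can be nested in itself. For an idempotent power \<open>?i\<close> of
    \<open>?h\<close> it gives \<open>f = f ?i = ?i\<close>; since \<open>?h\<close> begins with
    \<open>g\<close>, also \<open>g ?i = ?i\<close>, so \<open>g f = f\<close>.\<close>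
  have pow: "sg_mult S (spow S c k) (spow S ?h k) = f" for k
  proof (induction k)
    case (Suc k)
    have ck: "spow S c k \<in> carrier S" "spow S ?h k \<in> carrier S"
      using spow_closed[OF S(1)] c h by auto
    have cf: "sg_mult S (spow S c k) f = spow S c k"
    proof (cases k)
      case (Suc j)
      have "spow S c k = sg_mult S (spow S c j) c"
        using spow_mult[OF S(1) c(1), of j 0] Suc by simp
      then show ?thesis using as[OF spow_closed[OF S(1) c(1)] c(1) f(1), of j] c(2) by simp
    qed (simp add: c(2))
    have "sg_mult S (spow S c (Suc k)) (spow S ?h (Suc k)) =
        sg_mult S (sg_mult S (spow S c k) c) (sg_mult S ?h (spow S ?h k))"
      using spow_mult[OF S(1) c(1), of k 0] by (simp add: spow_Suc[of S ?h])
    also have "\<dots> = sg_mult S (sg_mult S (spow S c k) (sg_mult S c ?h)) (spow S ?h k)"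
      using ck c(1) h by (simp only: as cl)
    also have "\<dots> = f" using fch cf Suc by simp
    finally show ?case .
  qed (use fch in simp)
  obtain k where k: "sg_mult S (spow S ?h k) (spow S ?h k) = spow S ?h k"
    using spow_idempotent[OF S h] by blast
  let ?i = "spow S ?h k"
  have i: "?i \<in> carrier S" "spow S c k \<in> carrier S" using spow_closed[OF S(1)] h c by auto
  have gi: "sg_mult S g ?i = ?i" "sg_mult S f ?i = ?i"
  proof -
    have "sg_mult S g ?h = ?h" "sg_mult S f ?h = ?h" using as[of g g d] as[of f g d] g f d by simp_all
    then show "sg_mult S g ?i = ?i" "sg_mult S f ?i = ?i"
      using as[OF g(1) h] as[OF f(1) h] spow_closed[OF S(1) h]
      by (cases k; simp add: spow_Suc)+
  qed
  have "f = sg_mult S (spow S c k) (sg_mult S ?i ?i)" using pow[of k] k by simp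
  also have "\<dots> = sg_mult S f ?i" using as[OF i(2,1,1)] pow[of k] by simp
  finally have "f = ?i" using gi by simp
  then have "sg_mult S g f = f" using gi by simp
  then show ?thesis using g by simp
qed

context pv
begin

text \<open>In a profinite semigroup J-equivalent idempotents are D-equivalent. One direction of the
  equivalence yields \<open>a b = e\<close>; then \<open>b a\<close> is an idempotent below
  \<open>f\<close>, and it equals \<open>f\<close> because it does so in every finite
  coordinate.\<close>

lemma free_pro_J_idempotents:
  assumes A: "A \<noteq> {}" and e: "e \<in> idempotents (free_pro V A)" and f: "f \<in> idempotents (free_pro V A)"
    and J: "green_J (free_pro V A) e f"
  obtains a b where "a \<in> carrier (free_pro V A)" "b \<in> carrier (free_pro V A)"
    "sg_mult (free_pro V A) a b = e" "sg_mult (free_pro V A) b a = f"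
    "sg_mult (free_pro V A) e a = a" "sg_mult (free_pro V A) a f = a"
    "sg_mult (free_pro V A) f b = b" "sg_mult (free_pro V A) b e = b"
proof -
  let ?F = "free_pro V A" and ?m = "sg_mult (free_pro V A)"
  note S = free_pro_sgroup[OF A]
  note c = free_pro_closed and as = sgroup_assoc[OF S]
  have ee: "e \<in> carrier ?F" "?m e e = e" and ff: "f \<in> carrier ?F" "?m f f = f"
    using e f by (auto simp: idempotents_def)
  have "e \<in> principal_ideal ?F f" "f \<in> principal_ideal ?F e" using J unfolding green_J_iff[OF S] by auto
  then obtain p q s t where pq: "p \<in> carrier ?F" "q \<in> carrier ?F" "e = ?m (?m p f) q"
    and st: "s \<in> carrier ?F" "t \<in> carrier ?F" "f = ?m (?m s e) t"
    using principal_ideal_idempotentE[OF S _ f] principal_ideal_idempotentE[OF S _ e] by metis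
  define a where "a = ?m e (?m p f)"
  define b where "b = ?m f (?m q e)"
  have ab: "a \<in> carrier ?F" "b \<in> carrier ?F" unfolding a_def b_def by (intro c ee(1) ff(1) pq(1,2))+
  have ea: "?m e a = a" using as[OF ee(1) ee(1) c[OF pq(1) ff(1)]] ee by (simp add: a_def)
  have fb: "?m f b = b" using as[OF ff(1) ff(1) c[OF pq(2) ee(1)]] ff by (simp add: b_def)
  have af: "?m a f = a"
    using as[OF ee(1) c[OF pq(1) ff(1)] ff(1)] as[OF pq(1) ff(1) ff(1)] ff(2) by (simp add: a_def)
  have be: "?m b e = b"
    using as[OF ff(1) c[OF pq(2) ee(1)] ee(1)] as[OF pq(2) ee(1) ee(1)] ee(2) by (simp add: b_def)
  have "?m a b = ?m (?m e (?m p f)) (?m q e)"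
    using as[OF ab(1) ff(1) c[OF pq(2) ee(1)]] af by (simp add: a_def b_def)
  also have "\<dots> = ?m (?m e (?m (?m p f) q)) e"
    using ee(1) ff(1) pq(1,2) by (simp only: as c)
  also have "\<dots> = e" using pq(3) ee by simp
  finally have abe: "?m a b = e" .
  define g where "g = ?m b a"
  have g: "g \<in> carrier ?F" using ab c by (simp add: g_def)
  have "?m g g = ?m b (?m (?m a b) a)" unfolding g_def using ab(1,2) by (simp only: as c)
  then have gg: "?m g g = g" using abe ea by (simp add: g_def)
  have gf: "?m g f = g" using as[OF ab(2,1) ff(1)] af by (simp add: g_def)
  have fg: "?m f g = g" using as[OF ff(1) ab(2,1)] fb by (simp add: g_def)
  \<comment> \<open>Writing \<open>e\<close> in \<open>f = s e t\<close> as \<open>a b a b\<close>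
    exposes \<open>g = b a\<close> in the middle, so that \<open>u g v\<close> is again
    \<open>f\<close>.\<close>
  define u where "u = ?m f (?m s a)"
  define v where "v = ?m b (?m t f)"
  have uv: "u \<in> carrier ?F" "v \<in> carrier ?F"
    unfolding u_def v_def by (intro c ab(1,2) ff(1) st(1,2))+
  have uf: "?m u f = u" using as[OF ff(1) c[OF st(1) ab(1)] ff(1)] as[OF st(1) ab(1) ff(1)] af by (simp add: u_def)
  have "?m (?m u g) v = ?m f (?m (?m (?m s (?m (?m a b) (?m a b))) t) f)"
    unfolding u_def v_def g_def using ab(1,2) ff(1) st(1,2) by (simp only: as c)
  also have "\<dots> = f" using abe ee ff st by simp
  finally have fuv: "f = ?m (?m u g) v" by simp
  have "g = f"
  proof (rule free_pro_eqI[OF g ff(1)])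
    fix S h assume Sh: "(S, h) \<in> gen_maps V A"
    note val = free_pro_value[OF _ Sh]
    have ap: "sg_mult S (x (S, h)) (y (S, h)) = z (S, h)" if "?m x y = z" for x y z
      using free_pro_mult[OF Sh, of x y] that by simp
    have "f (S, h) = sg_mult S (sg_mult S (u (S, h)) (g (S, h))) (v (S, h))"
      using free_pro_mult[OF Sh, of "?m u g" v] free_pro_mult[OF Sh, of u g] fuv by simp
    then show "g (S, h) = f (S, h)"
      by (rule finite_idempotent_cancel[OF gen_mapsD(4,5)[OF Sh] val[OF ff(1)] ap[OF ff(2)] val[OF g]
        ap[OF gg] ap[OF gf] ap[OF fg] val[OF uv(1)] ap[OF uf] val[OF uv(2)]])
  qed
  then show ?thesis using that[OF ab abe _ ea af fb be] by (simp add: g_def)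
qed

text \<open>For each coordinate the pairs of cofactors that are correct there form a closed set.
  Finitely many of these sets meet by a solution at a dominating coordinate, so compactness provides
  cofactors correct everywhere.\<close>

lemma free_pro_divide:
  assumes A: "A \<noteq> {}" and a: "a \<in> carrier (free_pro V A)" and b: "b \<in> carrier (free_pro V A)"
    and co: "\<And>S f. (S, f) \<in> gen_maps V A \<Longrightarrow>
      \<exists>p\<in>words A. \<exists>q\<in>words A. a (S, f) = sg_mult S (sg_mult S (word_value S f p) (b (S, f))) (word_value S f q)"
  shows "\<exists>p\<in>carrier (free_pro V A). \<exists>q\<in>carrier (free_pro V A).
    a = sg_mult (free_pro V A) (sg_mult (free_pro V A) p b) q"
proof -
  let ?C = "carrier (free_pro V A)"
  let ?X = "prod_topology (free_pro_top V A) (free_pro_top V A)"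
  define C where "C = (\<lambda>(S, f). {(p, q) \<in> ?C \<times> ?C.
     a (S, f) = sg_mult S (sg_mult S (p (S, f)) (b (S, f))) (q (S, f))})"
  have X: "compact_space ?X" using compact_free_pro compact_space_prod_topology by blast
  have closed: "closedin ?X (C c)" if c': "c \<in> gen_maps V A" for c
  proof -
    obtain S f where c: "c = (S, f)" "(S, f) \<in> gen_maps V A" using c' by (cases c) auto
    let ?D = "discrete_topology (carrier S)"
    have cont: "continuous_map ?X (prod_topology ?D ?D) (\<lambda>(p, q). (p (S, f), q (S, f)))"
      unfolding continuous_map_prod_top using continuous_coord[OF c(2)] by simp
    have "closedin (prod_topology ?D ?D)
       {(s, t) \<in> carrier S \<times> carrier S. a (S, f) = sg_mult S (sg_mult S s (b (S, f))) t}"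
      by (auto simp: prod_topology_discrete_topology[symmetric])
    then have "closedin ?X {x \<in> topspace ?X. (\<lambda>(p, q). (p (S, f), q (S, f))) x \<in>
       {(s, t) \<in> carrier S \<times> carrier S. a (S, f) = sg_mult S (sg_mult S s (b (S, f))) t}}"
      by (rule closedin_continuous_map_preimage[OF cont])
    also have "{x \<in> topspace ?X. (\<lambda>(p, q). (p (S, f), q (S, f))) x \<in>
       {(s, t) \<in> carrier S \<times> carrier S. a (S, f) = sg_mult S (sg_mult S s (b (S, f))) t}} = C c"
      using free_pro_value[OF _ c(2)] by (auto simp: C_def c(1))
    finally show ?thesis .
  qed
  have fip: "\<Inter>\<F> \<noteq> {}" if F: "finite \<F>" "\<F> \<subseteq> C ` gen_maps V A" for \<F>
  proof -
    obtain G where G: "finite G" "G \<subseteq> gen_maps V A" "\<F> = C ` G"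
      using finite_subset_image[OF F] by blast
    obtain T g where T: "(T, g) \<in> gen_maps V A"
      "\<And>S f. (S, f) \<in> G \<Longrightarrow> \<exists>h\<in>sg_hom T S. \<forall>a\<in>A. h (g a) = f a"
      using joint_maps[OF G(1,2)] by metis
    obtain p q where pq: "p \<in> words A" "q \<in> words A"
      "a (T, g) = sg_mult T (sg_mult T (word_value T g p) (b (T, g))) (word_value T g q)"
      using co[OF T(1)] by blast
    have "(word_embed V A p, word_embed V A q) \<in> C c" if c: "c \<in> G" for c
    proof -
      obtain S f where cS: "c = (S, f)" "(S, f) \<in> gen_maps V A" using c G by (cases c) auto
      obtain h where h: "h \<in> sg_hom T S" "\<And>a. a \<in> A \<Longrightarrow> h (g a) = f a" using T(2) c cS by blast
      note Tg = gen_mapsD[OF T(1)]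
      have m: "word_value T g p \<in> carrier T" "word_value T g q \<in> carrier T" "b (T, g) \<in> carrier T"
        using word_value_closed[OF Tg(4,2)] pq free_pro_value[OF b T(1)] by auto
      have "a (S, f) = h (a (T, g))" using free_pro_compat[OF a T(1) cS(2) h] by simp
      also have "\<dots> = sg_mult S (sg_mult S (h (word_value T g p)) (h (b (T, g)))) (h (word_value T g q))"
        unfolding pq(3) using h(1) m sgroup_closed[OF Tg(4)] by (simp add: sg_hom_def)
      also have "\<dots> = sg_mult S (sg_mult S (word_value S f p) (b (S, f))) (word_value S f q)"
        using word_value_hom[OF h(1) Tg(4,2) _ h(2)] pq free_pro_compat[OF b T(1) cS(2) h] by simp
      finally show ?thesis
        using word_embed_carrier[OF pq(1)] word_embed_carrier[OF pq(2)] cS by (simp add: C_def)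
    qed
    then show ?thesis using G(3) by blast
  qed
  have "\<Inter>(C ` gen_maps V A) \<noteq> {}"
    using X closed fip unfolding compact_space_fip by blast
  then obtain p q where pq: "\<And>c. c \<in> gen_maps V A \<Longrightarrow> (p, q) \<in> C c" by auto
  obtain T g where "(T, g) \<in> gen_maps V A"
    using joint_maps[of "{}" A] by (metis empty_subsetI finite.emptyI)
  then have pq': "p \<in> ?C" "q \<in> ?C" using pq[of "(T, g)"] by (auto simp: C_def)
  have "a = sg_mult (free_pro V A) (sg_mult (free_pro V A) p b) q"
  proof (rule free_pro_eqI[OF a])
    fix S f assume "(S, f) \<in> gen_maps V A"
    then show "a (S, f) = sg_mult (free_pro V A) (sg_mult (free_pro V A) p b) q (S, f)"
      using pq[of "(S, f)"] by (simp add: C_def free_pro_mult)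
  qed (intro free_pro_closed pq' b)
  then show ?thesis using pq' by blast
qed

subsection \<open>Topological generation\<close>

text \<open>The density condition of \<open>top_rank\<close> in coordinate form. The generators
  generate a subsemigroup, so inverses have to be obtained as powers.\<close>

definition topgen :: "'a set \<Rightarrow> 'a prof set \<Rightarrow> nat \<Rightarrow> bool" where
  "topgen A H k \<longleftrightarrow> (\<exists>G\<subseteq>H. finite G \<and> card G \<le> k \<and>
     (\<forall>x\<in>H. \<forall>S f. (S, f) \<in> gen_maps V A \<longrightarrow> (\<exists>y\<in>sg_generated (free_pro V A) G. x (S, f) = y (S, f))))"

end

lemma sg_generated_least:
  assumes "G \<subseteq> Y" "Y \<subseteq> carrier S" "\<And>x y. x \<in> Y \<Longrightarrow> y \<in> Y \<Longrightarrow> sg_mult S x y \<in> Y"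
  shows "sg_generated S G \<subseteq> Y"
  unfolding sg_generated_def using assms by (intro Inter_lower) simp

lemma sg_generated_incl: "G \<subseteq> sg_generated S G"
  unfolding sg_generated_def by (intro Inter_greatest) simp

lemma sg_generated_closed:
  assumes "x \<in> sg_generated S G" "y \<in> sg_generated S G"
  shows "sg_mult S x y \<in> sg_generated S G"
  using assms unfolding sg_generated_def Inter_iff by simp

lemma (in pv) top_rank_eqI:
  assumes H: "H \<subseteq> carrier (free_pro V A)"
    "\<And>x y. x \<in> H \<Longrightarrow> y \<in> H \<Longrightarrow> sg_mult (free_pro V A) x y \<in> H"
    and r: "r \<ge> 1" "topgen A H r" "\<And>k. topgen A H k \<Longrightarrow> r \<le> k"
  shows "top_rank (free_pro_top V A) (free_pro V A) H = enat r"
proof -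
  have *: "subtopology (free_pro_top V A) H closure_of (sg_generated (free_pro V A) G) = H \<longleftrightarrow>
     (\<forall>x\<in>H. \<forall>S f. (S, f) \<in> gen_maps V A \<longrightarrow> (\<exists>y\<in>sg_generated (free_pro V A) G. x (S, f) = y (S, f)))"
    if G: "G \<subseteq> H" for G
  proof -
    have gen: "sg_generated (free_pro V A) G \<subseteq> H" using sg_generated_least[OF G H] .
    then have "subtopology (free_pro_top V A) H closure_of (sg_generated (free_pro V A) G) =
       H \<inter> free_pro_top V A closure_of (sg_generated (free_pro V A) G)"
      by (simp add: closure_of_subtopology Int_absorb1)
    moreover have "x \<in> free_pro_top V A closure_of (sg_generated (free_pro V A) G) \<longleftrightarrow>
       (\<forall>S f. (S, f) \<in> gen_maps V A \<longrightarrow> (\<exists>y\<in>sg_generated (free_pro V A) G. x (S, f) = y (S, f)))"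
      if "x \<in> H" for x
      using closure_free_pro_iff[OF order.trans[OF gen H(1)], of x] subsetD[OF H(1) that] by simp
    moreover have "H \<inter> C = H \<longleftrightarrow> (\<forall>x\<in>H. x \<in> C)" for C by blast
    ultimately show ?thesis by (simp only: cong: ball_cong)
  qed
  have "{enat k | k. k \<ge> 1 \<and> (\<exists>G\<subseteq>H. finite G \<and> card G \<le> k \<and>
      subtopology (free_pro_top V A) H closure_of (sg_generated (free_pro V A) G) = H)} =
    {enat k | k. k \<ge> 1 \<and> topgen A H k}"
    unfolding topgen_def by (intro Collect_cong ex_cong1 conj_cong refl) (rule *)
  moreover have "Inf {enat k | k. k \<ge> 1 \<and> topgen A H k} = enat r"
  proof (rule Inf_eqI)
    show "y \<le> enat r" if "\<And>i. i \<in> {enat k | k. k \<ge> 1 \<and> topgen A H k} \<Longrightarrow> y \<le> i" for y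
      using r(1,2) by (intro that) blast
    show "enat r \<le> i" if "i \<in> {enat k | k. k \<ge> 1 \<and> topgen A H k}" for i
      using that r(3) by force
  qed
  ultimately show ?thesis by (simp add: top_rank_def)
qed

text \<open>With \<open>a b = e\<close> and \<open>b a = f\<close>, the maps taking x to
  \<open>a x b\<close> and to \<open>b x a\<close> are mutually inverse isomorphisms between the two
  groups. They act by multiplication, hence coordinatewise, and so preserve topological
  generation.\<close>

lemma (in pv) topgen_transfer:
  assumes A: "A \<noteq> {}" and e: "e \<in> idempotents (free_pro V A)" and f: "f \<in> idempotents (free_pro V A)"
    and J: "green_J (free_pro V A) e f" and gen: "topgen A (units_at (free_pro V A) f) k"
  shows "topgen A (units_at (free_pro V A) e) k"
proof -
  let ?F = "free_pro V A" and ?m = "sg_mult (free_pro V A)"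
  note S = free_pro_sgroup[OF A]
  note c = free_pro_closed and as = sgroup_assoc[OF S]
  obtain a b where ab: "a \<in> carrier ?F" "b \<in> carrier ?F" "?m a b = e" "?m b a = f"
    "?m e a = a" "?m a f = a" "?m f b = b" "?m b e = b"
    using free_pro_J_idempotents[OF A e f J] by metis
  have ee: "e \<in> carrier ?F" "?m e e = e" and ff: "f \<in> carrier ?F" "?m f f = f"
    using e f by (auto simp: idempotents_def)
  define \<phi> where "\<phi> = (\<lambda>x. ?m (?m a x) b)"
  define \<psi> where "\<psi> = (\<lambda>x. ?m (?m b x) a)"
  have car: "\<phi> x \<in> carrier ?F" "\<psi> x \<in> carrier ?F" if "x \<in> carrier ?F" for x
    unfolding \<phi>_def \<psi>_def by (intro c that ab(1,2))+
  have uc: "units_at ?F g \<subseteq> carrier ?F" for g by (auto simp: units_at_def)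
  have hom: "\<phi> (?m x y) = ?m (\<phi> x) (\<phi> y)"
    if "x \<in> carrier ?F" "y \<in> carrier ?F" "?m x f = x" for x y
  proof -
    have "?m (\<phi> x) (\<phi> y) = ?m (?m a (?m x (?m (?m b a) y))) b"
      unfolding \<phi>_def using that(1,2) ab(1,2) by (simp only: as c)
    also have "\<dots> = ?m (?m a (?m (?m x f) y)) b"
      unfolding ab(4) as[OF that(1) ff(1) that(2)] ..
    finally show ?thesis by (simp only: \<phi>_def that(3))
  qed
  have \<phi>u: "\<phi> x \<in> units_at ?F e" if x: "x \<in> units_at ?F f" for x
  proof -
    obtain y where y: "x \<in> carrier ?F" "?m f x = x" "?m x f = x" "y \<in> carrier ?F" "?m f y = y" "?m y f = y"
       "?m x y = f" "?m y x = f"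
      using x unfolding units_at_def by blast
    have "\<phi> f = e" using ab by (simp add: \<phi>_def)
    then have "?m (\<phi> x) (\<phi> y) = e" "?m (\<phi> y) (\<phi> x) = e" using hom y by metis+
    moreover have "?m e (\<phi> z) = \<phi> z" "?m (\<phi> z) e = \<phi> z" if "z \<in> carrier ?F" for z
    proof -
      have "?m e (\<phi> z) = ?m (?m (?m e a) z) b" unfolding \<phi>_def using that ab(1,2) ee(1) by (simp only: as c)
      then show "?m e (\<phi> z) = \<phi> z" using ab by (simp add: \<phi>_def)
      have "?m (\<phi> z) e = ?m (?m a z) (?m b e)" unfolding \<phi>_def using that ab(1,2) ee(1) by (simp only: as c)
      then show "?m (\<phi> z) e = \<phi> z" using ab by (simp add: \<phi>_def)
    qed
    ultimately show ?thesis unfolding units_at_def using car y by blast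
  qed
  have \<phi>\<psi>: "\<phi> (\<psi> x) = x" "\<psi> x \<in> units_at ?F f" if x: "x \<in> units_at ?F e" for x
  proof -
    obtain y where y: "x \<in> carrier ?F" "?m e x = x" "?m x e = x" "y \<in> carrier ?F" "?m e y = y" "?m y e = y"
       "?m x y = e" "?m y x = e"
      using x unfolding units_at_def by blast
    have "\<phi> (\<psi> x) = ?m (?m (?m a b) x) (?m a b)" unfolding \<phi>_def \<psi>_def using y(1) ab(1,2) by (simp only: as c)
    then show "\<phi> (\<psi> x) = x" using ab y by simp
    have "?m (\<psi> z) (\<psi> z') = \<psi> (?m z z')" if "z \<in> carrier ?F" "z' \<in> carrier ?F" "?m z e = z" for z z'
    proof -
      have "?m (\<psi> z) (\<psi> z') = ?m (?m b (?m z (?m (?m a b) z'))) a"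
        unfolding \<psi>_def using that(1,2) ab(1,2) by (simp only: as c)
      also have "\<dots> = ?m (?m b (?m (?m z e) z')) a"
        unfolding ab(3) as[OF that(1) ee(1) that(2)] ..
      finally show ?thesis by (simp only: \<psi>_def that(3))
    qed
    moreover have "\<psi> e = f" using ab by (simp add: \<psi>_def)
    ultimately have "?m (\<psi> x) (\<psi> y) = f" "?m (\<psi> y) (\<psi> x) = f" using y by simp_all
    moreover have "?m f (\<psi> z) = \<psi> z" "?m (\<psi> z) f = \<psi> z" if "z \<in> carrier ?F" for z
    proof -
      have "?m f (\<psi> z) = ?m (?m (?m f b) z) a" unfolding \<psi>_def using that ab(1,2) ff(1) by (simp only: as c)
      then show "?m f (\<psi> z) = \<psi> z" using ab by (simp add: \<psi>_def)
      have "?m (\<psi> z) f = ?m (?m b z) (?m a f)" unfolding \<psi>_def using that ab(1,2) ff(1) by (simp only: as c)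
      then show "?m (\<psi> z) f = \<psi> z" using ab by (simp add: \<psi>_def)
    qed
    ultimately show "\<psi> x \<in> units_at ?F f" unfolding units_at_def using car y by blast
  qed
  obtain G where G: "G \<subseteq> units_at ?F f" "finite G" "card G \<le> k"
    "\<And>x S h. x \<in> units_at ?F f \<Longrightarrow> (S, h) \<in> gen_maps V A \<Longrightarrow> \<exists>y\<in>sg_generated ?F G. x (S, h) = y (S, h)"
    using gen unfolding topgen_def by blast
  have sub: "sg_generated ?F G \<subseteq> {y \<in> units_at ?F f. \<phi> y \<in> sg_generated ?F (\<phi> ` G)}"
  proof (rule sg_generated_least)
    show "G \<subseteq> {y \<in> units_at ?F f. \<phi> y \<in> sg_generated ?F (\<phi> ` G)}"
      using G(1) sg_generated_incl[of "\<phi> ` G" ?F] by blast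
    show "{y \<in> units_at ?F f. \<phi> y \<in> sg_generated ?F (\<phi> ` G)} \<subseteq> carrier ?F" using uc by blast
    fix x y assume "x \<in> {y \<in> units_at ?F f. \<phi> y \<in> sg_generated ?F (\<phi> ` G)}"
      "y \<in> {y \<in> units_at ?F f. \<phi> y \<in> sg_generated ?F (\<phi> ` G)}"
    moreover from this have "\<phi> (?m x y) = ?m (\<phi> x) (\<phi> y)" by (intro hom) (auto simp: units_at_def)
    ultimately show "?m x y \<in> {y \<in> units_at ?F f. \<phi> y \<in> sg_generated ?F (\<phi> ` G)}"
      by (simp add: sg_generated_closed units_at_closed[OF S])
  qed
  show ?thesis
    unfolding topgen_def
  proof (intro exI[of _ "\<phi> ` G"] conjI ballI allI impI)
    show "\<phi> ` G \<subseteq> units_at ?F e" using \<phi>u G(1) by blast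
    show "finite (\<phi> ` G)" using G by simp
    show "card (\<phi> ` G) \<le> k" using card_image_le[OF G(2), of \<phi>] G(3) by simp
    fix x S h assume x: "x \<in> units_at ?F e" and Sh: "(S, h) \<in> gen_maps V A"
    obtain y where y: "y \<in> sg_generated ?F G" "\<psi> x (S, h) = y (S, h)" using G(4)[OF \<phi>\<psi>(2)[OF x] Sh] by blast
    have "x (S, h) = \<phi> (\<psi> x) (S, h)" using \<phi>\<psi>(1)[OF x] by simp
    also have "\<dots> = \<phi> y (S, h)" using y(2) by (simp add: \<phi>_def free_pro_mult[OF Sh])
    finally show "\<exists>y\<in>sg_generated ?F (\<phi> ` G). x (S, h) = y (S, h)" using sub y(1) by blast
  qed
qed

subsection \<open>Maximal subgroups given by limits of words\<close>

text \<open>The sets \<open>W N\<close> consist of words that approximate the elements of one maximal subgroup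
  in the closure of the language \<open>L\<close>, the better the larger \<open>N\<close> is. The assumption \<open>recog\<close>
  expresses that this group is not smaller than the maximal subgroup containing it.\<close>

locale limit_words = pv V for V :: "nat sgrp set" +
  fixes A :: "nat set" and L :: "nat list set" and W :: "nat \<Rightarrow> nat list set"
  assumes LSl_V: "LSl \<subseteq> V" and fin_A: "finite A" and ne_A: "A \<noteq> {}"
    and L_words: "L \<subseteq> words A" and L_factor: "\<And>u w. w \<in> L \<Longrightarrow> sublist u w \<Longrightarrow> u \<noteq> [] \<Longrightarrow> u \<in> L"
    and W_words: "\<And>N. W N \<subseteq> words A" and W_dec: "\<And>N M. N \<le> M \<Longrightarrow> W M \<subseteq> W N"
    and W_long: "\<And>N w. w \<in> W N \<Longrightarrow> length w > N"
    and W_group: "\<And>S f. (S, f) \<in> gen_maps V A \<Longrightarrow> subgroup_of (\<Inter>N. word_value S f ` W N) S"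
    and recog: "\<And>N. \<exists>m\<ge>1. \<forall>u\<in>W N. \<forall>w\<in>words A. u @ w @ u \<in> tested L m \<longrightarrow> u @ w @ u \<in> W N"
    and L_rec: "\<And>N. \<exists>m. \<forall>w\<in>L. m \<le> length w \<longrightarrow> (\<exists>x\<in>words A. \<exists>u\<in>W N. \<exists>y\<in>words A. w = x @ u @ y)"
    and L_div: "\<And>S f w. (S, f) \<in> gen_maps V A \<Longrightarrow> w \<in> L \<Longrightarrow>
       \<exists>x\<in>words A. \<exists>y\<in>words A. word_value S f (x @ w @ y) \<in> (\<Inter>N. word_value S f ` W N)"
    and L_lim: "\<exists>z\<in>carrier (free_pro V A). \<forall>S f. (S, f) \<in> gen_maps V A \<longrightarrow>
       z (S, f) \<in> (\<Inter>N. word_value S f ` W N) \<and> z (S, f) \<in> word_value S f ` L"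
begin

definition lims :: "nat sgrp \<Rightarrow> (nat \<Rightarrow> nat) \<Rightarrow> nat set" where
  "lims S f = (\<Inter>N. word_value S f ` W N)"

text \<open>A decreasing sequence of finite sets is constant from a member of least cardinality
  on.\<close>

lemma lims_stable:
  assumes Sf: "(S, f) \<in> gen_maps V A"
  obtains N where "\<And>M. M \<ge> N \<Longrightarrow> word_value S f ` W M = lims S f"
proof -
  let ?X = "\<lambda>N. word_value S f ` W N"
  note d = gen_mapsD[OF Sf]
  have fin: "finite (?X N)" for N
  proof (rule finite_subset[OF _ d(5)])
    show "?X N \<subseteq> carrier S" using word_value_closed[OF d(4,2)] W_words[of N] by auto
  qed
  obtain N where N: "\<And>M. card (?X N) \<le> card (?X M)"
    using ex_has_least_nat[of "\<lambda>_. True" 0 "\<lambda>N. card (?X N)"] by auto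
  have eq: "?X M = ?X N" if "M \<ge> N" for M
    by (rule card_seteq[OF fin _ N]) (use W_dec[OF that] in \<open>rule image_mono\<close>)
  have "lims S f = ?X N"
  proof
    show "lims S f \<subseteq> ?X N" unfolding lims_def by (rule INT_lower) simp
    show "?X N \<subseteq> lims S f"
      unfolding lims_def
    proof (rule INT_greatest)
      fix K
      have "?X N = ?X (max N K)" by (rule eq[symmetric]) simp
      also have "\<dots> \<subseteq> ?X K" by (rule image_mono[OF W_dec]) simp
      finally show "?X N \<subseteq> ?X K" .
    qed
  qed
  then show ?thesis using that eq by metis
qed

lemma lims_image:
  assumes "(S, f) \<in> gen_maps V A"
  obtains N where "word_value S f ` W N = lims S f"
  using lims_stable[OF assms] order_refl by metis

lemma limsD: "s \<in> lims S f \<Longrightarrow> \<exists>w\<in>W N. s = word_value S f w"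
  unfolding lims_def by (drule INT_D[of _ _ _ N]) auto

lemma lims_hom:
  assumes Sf: "(S, f) \<in> gen_maps V A" and h: "h \<in> sg_hom S T" "\<And>a. a \<in> A \<Longrightarrow> h (f a) = g a"
    and s: "s \<in> lims S f"
  shows "h s \<in> lims T g"
  unfolding lims_def
proof (rule INT_I)
  fix N
  obtain w where w: "w \<in> W N" "s = word_value S f w" using limsD[OF s] by blast
  have "h s = word_value T g w"
    unfolding w(2) using word_value_hom[OF h(1) gen_mapsD(4,2)[OF Sf] _ h(2)] W_words w(1) by blast
  then show "h s \<in> word_value T g ` W N" using w(1) by (rule image_eqI)
qed

lemma lims_group:
  assumes "(S, f) \<in> gen_maps V A"
  obtains e where "e \<in> idempotents S" "e \<in> lims S f" "lims S f \<subseteq> units_at S e"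
    "\<And>x y. x \<in> lims S f \<Longrightarrow> y \<in> lims S f \<Longrightarrow> sg_mult S x y \<in> lims S f"
    "\<And>x. x \<in> lims S f \<Longrightarrow> \<exists>y\<in>lims S f. sg_mult S x y = e \<and> sg_mult S y x = e"
  by (rule subgroup_ofE[OF W_group[OF assms, folded lims_def]]) (rule that)

lemma lims_carrier: "(S, f) \<in> gen_maps V A \<Longrightarrow> lims S f \<subseteq> carrier S"
  using W_group[of S f] by (simp add: subgroup_of_def lims_def)

lemma lims_closed:
  assumes "(S, f) \<in> gen_maps V A" "x \<in> lims S f" "y \<in> lims S f"
  shows "sg_mult S x y \<in> lims S f"
  by (rule lims_group[OF assms(1)]) (use assms(2,3) in blast)

text \<open>The identity of the coordinate group is singled out as its only idempotent, so
  homomorphisms between coordinates automatically preserve it and the identities form a compatible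
  family.\<close>

definition lone :: "nat sgrp \<Rightarrow> (nat \<Rightarrow> nat) \<Rightarrow> nat" where
  "lone S f = (THE e. e \<in> lims S f \<and> sg_mult S e e = e)"

lemma lone:
  assumes Sf: "(S, f) \<in> gen_maps V A"
  shows lone_mem: "lone S f \<in> lims S f"
    and lone_idem: "sg_mult S (lone S f) (lone S f) = lone S f"
    and lone_unique: "\<And>g. g \<in> lims S f \<Longrightarrow> sg_mult S g g = g \<Longrightarrow> g = lone S f"
    and lone_left: "\<And>x. x \<in> lims S f \<Longrightarrow> sg_mult S (lone S f) x = x"
    and lone_right: "\<And>x. x \<in> lims S f \<Longrightarrow> sg_mult S x (lone S f) = x"
    and lone_inv: "\<And>x. x \<in> lims S f \<Longrightarrow> \<exists>y\<in>lims S f. sg_mult S x y = lone S f \<and> sg_mult S y x = lone S f"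
proof -
  obtain e where e: "e \<in> idempotents S" "e \<in> lims S f" "lims S f \<subseteq> units_at S e"
    "\<And>x. x \<in> lims S f \<Longrightarrow> \<exists>y\<in>lims S f. sg_mult S x y = e \<and> sg_mult S y x = e"
    by (rule lims_group[OF Sf]) (rule that)
  have ee: "sg_mult S e e = e" using e(1) by (simp add: idempotents_def)
  have un: "g = e" if "g \<in> lims S f" "sg_mult S g g = g" for g
    using idempotent_in_units_at[OF gen_mapsD(4)[OF Sf] subsetD[OF e(3) that(1)] that(2)] .
  have "lone S f = e"
    unfolding lone_def
  proof (rule the_equality)
    show "e \<in> lims S f \<and> sg_mult S e e = e" using e(2) ee by blast
    show "g = e" if "g \<in> lims S f \<and> sg_mult S g g = g" for g by (rule un) (use that in blast)+
  qed
  then show "lone S f \<in> lims S f" "sg_mult S (lone S f) (lone S f) = lone S f"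
    "\<And>x. x \<in> lims S f \<Longrightarrow> \<exists>y\<in>lims S f. sg_mult S x y = lone S f \<and> sg_mult S y x = lone S f"
    using e(2,4) ee by simp_all
  show "\<And>g. g \<in> lims S f \<Longrightarrow> sg_mult S g g = g \<Longrightarrow> g = lone S f"
    unfolding \<open>lone S f = e\<close> by (rule un)
  show "\<And>x. x \<in> lims S f \<Longrightarrow> sg_mult S (lone S f) x = x"
    "\<And>x. x \<in> lims S f \<Longrightarrow> sg_mult S x (lone S f) = x"
    unfolding \<open>lone S f = e\<close> using subsetD[OF e(3)] by (simp_all add: units_at_def)
qed

section \<open>The inverse limit of the coordinate groups\<close>

definition limgrp :: "nat prof set" where
  "limgrp = {x \<in> carrier (free_pro V A). \<forall>S f. (S, f) \<in> gen_maps V A \<longrightarrow> x (S, f) \<in> lims S f}"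

definition limone :: "nat prof" where
  "limone = (\<lambda>(S, f)\<in>gen_maps V A. lone S f)"

lemma limgrpD:
  assumes "x \<in> limgrp"
  shows "x \<in> carrier (free_pro V A)" "\<And>S f. (S, f) \<in> gen_maps V A \<Longrightarrow> x (S, f) \<in> lims S f"
  using assms by (auto simp: limgrp_def)

lemma limgrpI:
  "x \<in> carrier (free_pro V A) \<Longrightarrow> (\<And>S f. (S, f) \<in> gen_maps V A \<Longrightarrow> x (S, f) \<in> lims S f) \<Longrightarrow> x \<in> limgrp"
  by (simp add: limgrp_def)

lemma limone_apply: "(S, f) \<in> gen_maps V A \<Longrightarrow> limone (S, f) = lone S f"
  by (simp add: limone_def)

lemma limone_limgrp: "limone \<in> limgrp"
proof (rule limgrpI)
  show "limone \<in> carrier (free_pro V A)"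
    unfolding free_pro_carrier
  proof (intro conjI allI impI)
    fix S f T g h
    assume *: "(S, f) \<in> gen_maps V A" "(T, g) \<in> gen_maps V A" "h \<in> sg_hom S T" "\<forall>a\<in>A. h (f a) = g a"
    have "h (lone S f) \<in> lims T g"
      by (rule lims_hom[OF *(1,3) _ lone_mem[OF *(1)]]) (use *(4) in blast)
    moreover have "lone S f \<in> carrier S" using lone_mem[OF *(1)] lims_carrier[OF *(1)] by (rule rev_subsetD)
    then have "sg_mult T (h (lone S f)) (h (lone S f)) = h (lone S f)"
      using *(3) lone_idem[OF *(1)] unfolding sg_hom_def by force
    ultimately show "h (limone (S, f)) = limone (T, g)"
      using lone_unique[OF *(2)] limone_apply * by simp
  next
    fix S f assume "(S, f) \<in> gen_maps V A"
    then show "limone (S, f) \<in> carrier S"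
      using lone_mem lims_carrier limone_apply by (metis subsetD)
  qed (simp add: limone_def)
qed (simp add: limone_apply lone_mem)

lemma limone_idempotent: "limone \<in> idempotents (free_pro V A)"
proof -
  have c: "limone \<in> carrier (free_pro V A)" using limgrpD(1)[OF limone_limgrp] .
  have "sg_mult (free_pro V A) limone limone = limone"
    by (rule free_pro_eqI[OF free_pro_closed[OF c c] c]) (simp add: free_pro_mult limone_apply lone_idem)
  then show ?thesis using c by (simp add: idempotents_def)
qed

lemma limone_mult:
  assumes x: "x \<in> limgrp"
  shows "sg_mult (free_pro V A) limone x = x" "sg_mult (free_pro V A) x limone = x"
  by (rule free_pro_eqI[OF free_pro_closed limgrpD(1)[OF x]], (rule limgrpD(1) x limone_limgrp)+,
      simp add: free_pro_mult limone_apply lone_left lone_right limgrpD(2)[OF x])+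

lemma limgrp_mult:
  assumes x: "x \<in> limgrp" and y: "y \<in> limgrp"
  shows "sg_mult (free_pro V A) x y \<in> limgrp"
proof (rule limgrpI[OF free_pro_closed[OF limgrpD(1)[OF x] limgrpD(1)[OF y]]])
  fix S f assume Sf: "(S, f) \<in> gen_maps V A"
  show "sg_mult (free_pro V A) x y (S, f) \<in> lims S f"
    unfolding free_pro_mult[OF Sf] by (rule lims_closed[OF Sf limgrpD(2)[OF x Sf] limgrpD(2)[OF y Sf]])
qed

text \<open>Inverses are unique in each coordinate group and are respected by the connecting
  homomorphisms, so the coordinatewise inverses are compatible.\<close>

lemma limgrp_inverse:
  assumes x: "x \<in> limgrp"
  obtains y where "y \<in> limgrp" "sg_mult (free_pro V A) x y = limone" "sg_mult (free_pro V A) y x = limone"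
proof -
  define P where "P = (\<lambda>S f y. y \<in> lims S f \<and> sg_mult S (x (S, f)) y = lone S f \<and> sg_mult S y (x (S, f)) = lone S f)"
  define y where "y = (\<lambda>(S, f)\<in>gen_maps V A. THE y. P S f y)"
  have un: "u = v" if Sf: "(S, f) \<in> gen_maps V A" and uv: "P S f u" "P S f v" for S f u v
  proof -
    have c: "u \<in> carrier S" "v \<in> carrier S" "x (S, f) \<in> carrier S"
      using uv lims_carrier[OF Sf] limgrpD(2)[OF x Sf] by (auto simp: P_def)
    have "u = sg_mult S u (sg_mult S (x (S, f)) v)" using uv lone_right[OF Sf] by (simp add: P_def)
    also have "\<dots> = sg_mult S (sg_mult S u (x (S, f))) v" using sgroup_assoc[OF gen_mapsD(4)[OF Sf] c(1,3,2)] by simp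
    also have "\<dots> = v" using uv lone_left[OF Sf] by (simp add: P_def)
    finally show ?thesis .
  qed
  have y: "P S f (y (S, f))" if Sf: "(S, f) \<in> gen_maps V A" for S f
  proof -
    obtain u where "P S f u" using lone_inv[OF Sf limgrpD(2)[OF x Sf]] by (auto simp: P_def)
    then have "P S f (THE y. P S f y)" by (rule theI) (rule un[OF Sf _ \<open>P S f u\<close>])
    then show ?thesis using Sf by (simp add: y_def)
  qed
  have "y \<in> limgrp"
  proof (rule limgrpI)
    show "y \<in> carrier (free_pro V A)"
      unfolding free_pro_carrier
    proof (intro conjI allI impI)
      fix S f T g h
      assume *: "(S, f) \<in> gen_maps V A" "(T, g) \<in> gen_maps V A" "h \<in> sg_hom S T" "\<forall>a\<in>A. h (f a) = g a"
      note Py = y[OF *(1), unfolded P_def]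
      have c: "y (S, f) \<in> carrier S" "x (S, f) \<in> carrier S"
        using Py lims_carrier[OF *(1)] limgrpD(2)[OF x *(1)] by auto
      have hx: "h (x (S, f)) = x (T, g)" and h1: "h (lone S f) = lone T g"
        using free_pro_compat[OF limgrpD(1)[OF x] *(1-3)]
          free_pro_compat[OF limgrpD(1)[OF limone_limgrp] *(1-3)] *(4)
        by (simp_all add: limone_apply[OF *(1)] limone_apply[OF *(2)])
      have hm: "h (sg_mult S a b) = sg_mult T (h a) (h b)" if "a \<in> carrier S" "b \<in> carrier S" for a b
        using *(3) that by (simp add: sg_hom_def)
      have "h (y (S, f)) \<in> lims T g"
        by (rule lims_hom[OF *(1,3)]) (use *(4) Py in auto)
      moreover have "sg_mult T (x (T, g)) (h (y (S, f))) = lone T g" "sg_mult T (h (y (S, f))) (x (T, g)) = lone T g"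
        using hm[OF c(2,1)] hm[OF c(1,2)] Py unfolding hx[symmetric] h1[symmetric] by simp_all
      ultimately have "P T g (h (y (S, f)))" by (simp add: P_def)
      then show "h (y (S, f)) = y (T, g)" by (rule un[OF *(2) _ y[OF *(2)]])
    next
      fix S f assume Sf: "(S, f) \<in> gen_maps V A"
      show "y (S, f) \<in> carrier S" using y[OF Sf] lims_carrier[OF Sf] by (auto simp: P_def)
    qed (simp add: y_def)
  qed (use y in \<open>simp add: P_def\<close>)
  moreover have "sg_mult (free_pro V A) x y = limone" "sg_mult (free_pro V A) y x = limone"
    by (rule free_pro_eqI[OF free_pro_closed limgrpD(1)[OF limone_limgrp]],
        (rule limgrpD(1) x \<open>y \<in> limgrp\<close>)+, use y in \<open>simp add: free_pro_mult limone_apply P_def\<close>)+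
  ultimately show ?thesis using that by blast
qed

lemma test_coord: "m \<ge> 1 \<Longrightarrow> (test_sgrp A L m, test_map A L m) \<in> gen_maps V A"
  using test_gen_maps[OF fin_A ne_A _ LSl_V] .

lemma L_tested: "w \<in> L \<Longrightarrow> w \<in> tested L m"
  using L_factor by (simp add: tested_def)

lemma L_limE:
  obtains z where "z \<in> limgrp" "\<And>S f. (S, f) \<in> gen_maps V A \<Longrightarrow> z (S, f) \<in> word_value S f ` L"
proof -
  obtain z where z: "z \<in> carrier (free_pro V A)" "\<forall>S f. (S, f) \<in> gen_maps V A \<longrightarrow>
       z (S, f) \<in> (\<Inter>N. word_value S f ` W N) \<and> z (S, f) \<in> word_value S f ` L"
    using L_lim by (rule bexE)
  show ?thesis
  proof (rule that)
    show "z \<in> limgrp" by (rule limgrpI[OF z(1)]) (use z(2) in \<open>simp add: lims_def\<close>)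
  qed (use z(2) in simp)
qed

text \<open>The inverse limit is the whole H-class. A unit \<open>x\<close> equals
  \<open>limone x limone\<close> and hence is represented by a word u w u with u in
  \<open>W N\<close>. It is also a left factor of a limit of words of \<open>L\<close>, so its test
  value is not the zero, and \<open>recog\<close> applies.\<close>

lemma units_at_limone: "units_at (free_pro V A) limone = limgrp"
proof
  let ?m = "sg_mult (free_pro V A)"
  note S = free_pro_sgroup[OF ne_A]
  show "limgrp \<subseteq> units_at (free_pro V A) limone"
  proof
    fix x assume x: "x \<in> limgrp"
    obtain y where "y \<in> limgrp" "?m x y = limone" "?m y x = limone" using limgrp_inverse[OF x] .
    then show "x \<in> units_at (free_pro V A) limone"
      unfolding units_at_def
      using limone_mult[OF x] limone_mult[OF \<open>y \<in> limgrp\<close>] limgrpD(1)[OF x] limgrpD(1)[OF \<open>y \<in> limgrp\<close>]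
      by (intro CollectI conjI bexI[of _ y])
  qed
  show "units_at (free_pro V A) limone \<subseteq> limgrp"
  proof
    fix x assume "x \<in> units_at (free_pro V A) limone"
    then obtain y where x: "x \<in> carrier (free_pro V A)" "?m limone x = x" "?m x limone = x"
      and y: "y \<in> carrier (free_pro V A)" "?m x y = limone" by (auto simp: units_at_def)
    obtain z where zl: "z \<in> limgrp"
      and zL: "\<And>S f. (S, f) \<in> gen_maps V A \<Longrightarrow> z (S, f) \<in> word_value S f ` L"
      using L_limE by metis
    note z = limgrpD[OF zl] zL
    have one: "limone \<in> carrier (free_pro V A)" using limgrpD(1)[OF limone_limgrp] .
    show "x \<in> limgrp"
    proof (rule limgrpI[OF x(1)])
      fix S f assume Sf: "(S, f) \<in> gen_maps V A"
      show "x (S, f) \<in> lims S f"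
        unfolding lims_def
      proof (rule INT_I)
        fix N
        obtain m where m: "m \<ge> 1" "\<forall>u\<in>W N. \<forall>w\<in>words A. u @ w @ u \<in> tested L m \<longrightarrow> u @ w @ u \<in> W N"
          using recog by blast
        let ?T = "test_sgrp A L m" and ?t = "test_map A L m"
        note Tt = test_coord[OF m(1)]
        have F: "finite {(S, f), (?T, ?t)}" "{(S, f), (?T, ?t)} \<subseteq> gen_maps V A" using Sf Tt by simp_all
        \<comment> \<open>At a coordinate above both, one word u w u represents \<open>x\<close> in
          the given coordinate and in the test semigroup.\<close>
        obtain R g where R: "(R, g) \<in> gen_maps V A"
          "\<And>S' f'. (S', f') \<in> {(S, f), (?T, ?t)} \<Longrightarrow> \<exists>h\<in>sg_hom R S'. \<forall>a\<in>A. h (g a) = f' a"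
          using joint_maps[OF F] by metis
        obtain u where u: "u \<in> W N" "limone (R, g) = word_value R g u"
          using limsD[OF limgrpD(2)[OF limone_limgrp R(1)]] by blast
        obtain w where w: "w \<in> words A" "x (R, g) = word_value R g w"
          using free_pro_coord_word[OF x(1) R(1) ne_A] by blast
        note Rd = gen_mapsD(4,2)[OF R(1)]
        have uw: "u \<in> words A" "w @ u \<in> words A" "u @ w @ u \<in> words A"
          using u(1) w(1) W_words[of N] by auto
        have "x (R, g) = ?m limone (?m x limone) (R, g)" using x by simp
        also have "\<dots> = word_value R g (u @ w @ u)"
          using u(2) w(2) word_value_append[OF Rd uw(1,2)] word_value_append[OF Rd w(1) uw(1)]
          by (simp add: free_pro_mult[OF R(1)])
        finally have xR: "x (R, g) = word_value R g (u @ w @ u)" .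
        have xS: "x (S', f') = word_value S' f' (u @ w @ u)" if S'f': "(S', f') \<in> {(S, f), (?T, ?t)}" for S' f'
        proof -
          obtain h where h: "h \<in> sg_hom R S'" "\<forall>a\<in>A. h (g a) = f' a" using R(2)[OF S'f'] ..
          have g': "(S', f') \<in> gen_maps V A" using subsetD[OF F(2) S'f'] .
          have "h (x (R, g)) = x (S', f')" 
            by (rule free_pro_compat[OF x(1) R(1) g' h(1)]) (use h(2) in simp)
          moreover have "h (word_value R g (u @ w @ u)) = word_value S' f' (u @ w @ u)"
            by (rule word_value_hom[OF h(1) Rd uw(3)]) (use h(2) in simp)
          ultimately show ?thesis using xR by simp
        qed
        obtain w1 where w1: "w1 \<in> words A" "x (?T, ?t) = word_value ?T ?t w1"
          using free_pro_coord_word[OF x(1) Tt ne_A] by blast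
        obtain w2 where w2: "w2 \<in> words A" "y (?T, ?t) = word_value ?T ?t w2"
          using free_pro_coord_word[OF y(1) Tt ne_A] by blast
        obtain w3 where w3: "w3 \<in> L" "z (?T, ?t) = word_value ?T ?t w3" using z(3)[OF Tt] by (rule imageE) simp
        note Td = gen_mapsD(4,2)[OF Tt]
        have w3': "w3 \<in> words A" using w3(1) L_words by blast
        have w23: "w2 @ w3 \<in> words A" "w1 @ w2 @ w3 \<in> words A" using w1 w2 w3' by auto
        \<comment> \<open>The element \<open>z\<close> of the group is a limit of words of
          \<open>L\<close>, and \<open>x\<close> has an inverse \<open>y\<close>; thus
          \<open>x\<close> occurs as the first factor of \<open>z\<close>.\<close>
        have "z = ?m x (?m y z)"
          using limone_mult(1)[OF zl] y(2) sgroup_assoc[OF S x(1) y(1) z(1)] by simp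
        then have "z (?T, ?t) = ?m x (?m y z) (?T, ?t)" by simp
        also have "\<dots> = word_value ?T ?t (w1 @ w2 @ w3)"
          using w1(2) w2(2) w3(2) word_value_append[OF Td w1(1) w23(1)] word_value_append[OF Td w2(1) w3']
          by (simp add: free_pro_mult[OF Tt])
        finally have "test L m (w1 @ w2 @ w3) = test L m w3"
          using w3(2) word_value_test[OF w23(2)] word_value_test[OF w3'] by simp
        then have "w1 @ w2 @ w3 \<in> tested L m"
          using L_tested[OF w3(1)] by (simp add: test_def split: if_splits)
        then have "w1 \<in> tested L m" by (rule tested_sublist) simp
        moreover have "test L m (u @ w @ u) = test L m w1"
          using xS[of ?T ?t] w1(2) word_value_test[OF w1(1)] word_value_test[OF uw(3)] by simp
        ultimately have "u @ w @ u \<in> tested L m" by (simp add: test_def split: if_splits)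
        then have "u @ w @ u \<in> W N" using m(2) u(1) w(1) by blast
        then show "x (S, f) \<in> word_value S f ` W N" using xS[of S f] by (intro image_eqI) simp_all
      qed
    qed
  qed
qed

section \<open>The J-class of the closure of the language\<close>

lemma limgrp_J:
  assumes x: "x \<in> limgrp" and y: "y \<in> limgrp"
  shows "green_J (free_pro V A) x y"
proof -
  let ?m = "sg_mult (free_pro V A)"
  have "x \<in> principal_ideal (free_pro V A) y" if x: "x \<in> limgrp" and y: "y \<in> limgrp" for x y
  proof -
    obtain v where v: "v \<in> limgrp" "?m y v = limone" using limgrp_inverse[OF y] .
    have "x = ?m (?m limone y) (?m v x)"
      using limone_mult x y v limgrpD(1) sgroup_assoc[OF free_pro_sgroup[OF ne_A], of y v x]
      by simp
    then show ?thesis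
      using principal_ideal_sandwich[of limone "free_pro V A" "?m v x" y] limgrpD(1)
        limone_limgrp limgrp_mult v(1) x by simp
  qed
  then show ?thesis
    unfolding green_J_iff[OF free_pro_sgroup[OF ne_A]] using x y limgrpD(1) by blast
qed

text \<open>The test semigroup with parameter \<open>m\<close> distinguishes a word shorter than
  \<open>m\<close> from every other word of \<open>L\<close>. If such a word represented
  \<open>z\<close> there, the same word would represent \<open>z\<close> at every coordinate and
  \<open>z\<close> would be a word.\<close>

lemma closure_long_word:
  assumes z: "z \<in> carrier (free_pro V A)" "z \<notin> word_embed V A ` L"
    and zL: "\<And>S f. (S, f) \<in> gen_maps V A \<Longrightarrow> \<exists>w\<in>L. z (S, f) = word_value S f w"
    and Sf: "(S, f) \<in> gen_maps V A"
  shows "\<exists>w\<in>L. m \<le> length w \<and> z (S, f) = word_value S f w"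
proof (cases "m = 0")
  case False
  then have m: "m \<ge> 1" by simp
  let ?T = "test_sgrp A L m" and ?t = "test_map A L m"
  note Tt = test_coord[OF m]
  have both: "\<exists>w\<in>L. z (R, g) = word_value R g w \<and> z (?T, ?t) = to_nat (test L m w)"
    if "(R, g) \<in> gen_maps V A" for R g
  proof -
    have F: "finite {(R, g), (?T, ?t)}" "{(R, g), (?T, ?t)} \<subseteq> gen_maps V A" using that Tt by simp_all
    obtain w where w: "w \<in> L" "\<forall>(S, f)\<in>{(R, g), (?T, ?t)}. z (S, f) = word_value S f w"
      using joint_word[OF z(1) F L_words zL] by (rule bexE)
    have "w \<in> words A" using w(1) L_words by (rule rev_subsetD)
    then show ?thesis using w word_value_test[of w A L m] by (intro bexI[of _ w]) simp_all
  qed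
  obtain w where w: "w \<in> L" "z (S, f) = word_value S f w" "z (?T, ?t) = to_nat (test L m w)"
    using both[OF Sf] by blast
  have "m \<le> length w"
  proof (rule ccontr)
    assume short: "\<not> m \<le> length w"
    have "z = word_embed V A w"
    proof (rule free_pro_eqI[OF z(1)])
      show "word_embed V A w \<in> carrier (free_pro V A)"
        by (rule word_embed_carrier) (rule subsetD[OF L_words w(1)])
      fix R g assume Rg: "(R, g) \<in> gen_maps V A"
      obtain v where v: "v \<in> L" "z (R, g) = word_value R g v" "z (?T, ?t) = to_nat (test L m v)"
        using both[OF Rg] by blast
      have "test L m v = test L m w" using v(3) w(3) by simp
      then have "take m v = take m w" using L_tested[OF v(1)] L_tested[OF w(1)] by (simp add: test_def)
      then have tv: "take m v = w" using short by simp
      then have "length (take m v) < m" using short by simp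
      then have "v = w" using tv by (cases "length v \<le> m") auto
      then show "z (R, g) = word_embed V A w (R, g)" using v(2) Rg by simp
    qed
    then show False using z(2) imageI[OF w(1), of "word_embed V A"] by simp
  qed
  then show ?thesis using w by blast
next
  case True
  then show ?thesis using zL[OF Sf] by simp
qed

text \<open>Both divisions are found in each coordinate. A long word of \<open>L\<close> has a
  factor from \<open>W N\<close>, whose value absorbs the identity of the group. Conversely, a word
  of \<open>L\<close> extends to a word with value in the group, where it is inverted.\<close>

lemma closure_J:
  assumes z: "z \<in> carrier (free_pro V A)" "z \<notin> word_embed V A ` L"
    and zL: "\<And>S f. (S, f) \<in> gen_maps V A \<Longrightarrow> \<exists>w\<in>L. z (S, f) = word_value S f w"
  shows "green_J (free_pro V A) z limone"
proof -
  have one: "limone \<in> carrier (free_pro V A)" using limgrpD(1)[OF limone_limgrp] .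
  have "\<exists>p\<in>carrier (free_pro V A). \<exists>q\<in>carrier (free_pro V A).
    z = sg_mult (free_pro V A) (sg_mult (free_pro V A) p limone) q"
  proof (rule free_pro_divide[OF ne_A z(1) one])
    fix S f assume Sf: "(S, f) \<in> gen_maps V A"
    note d = gen_mapsD(4,2)[OF Sf]
    obtain N where N: "word_value S f ` W N = lims S f" by (rule lims_image[OF Sf])
    obtain m where m: "\<forall>w\<in>L. m \<le> length w \<longrightarrow> (\<exists>x\<in>words A. \<exists>u\<in>W N. \<exists>y\<in>words A. w = x @ u @ y)"
      using L_rec by blast
    obtain w where w: "w \<in> L" "m \<le> length w" "z (S, f) = word_value S f w"
      using closure_long_word[OF z zL Sf] by blast
    then obtain x u y where xuy: "x \<in> words A" "u \<in> W N" "y \<in> words A" "w = x @ u @ y" using m by blast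
    have u: "u \<in> words A" "word_value S f u \<in> lims S f" using xuy(2) W_words N by blast+
    have uy: "u @ y \<in> words A" using u(1) xuy(3) by auto
    have lc: "lone S f \<in> carrier S" using lone_mem[OF Sf] lims_carrier[OF Sf] by blast
    note vc = word_value_closed[OF d]
    have "z (S, f) = sg_mult S (word_value S f x) (sg_mult S (word_value S f u) (word_value S f y))"
      unfolding w(3) xuy(4) word_value_append[OF d xuy(1) uy] word_value_append[OF d u(1) xuy(3)] ..
    also have "word_value S f u = sg_mult S (lone S f) (word_value S f u)"
      using lone_left[OF Sf u(2)] by simp
    also have "sg_mult S (word_value S f x) (sg_mult S (sg_mult S (lone S f) (word_value S f u)) (word_value S f y)) =
      sg_mult S (sg_mult S (word_value S f x) (lone S f)) (sg_mult S (word_value S f u) (word_value S f y))"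
      using vc[OF xuy(1)] vc[OF u(1)] vc[OF xuy(3)] lc by (simp only: sgroup_assoc[OF d(1)] sgroup_closed[OF d(1)])
    also have "\<dots> = sg_mult S (sg_mult S (word_value S f x) (limone (S, f))) (word_value S f (u @ y))"
      unfolding limone_apply[OF Sf] word_value_append[OF d u(1) xuy(3)] ..
    finally show "\<exists>p\<in>words A. \<exists>q\<in>words A.
       z (S, f) = sg_mult S (sg_mult S (word_value S f p) (limone (S, f))) (word_value S f q)"
      using xuy(1) uy by blast
  qed
  then have 1: "z \<in> principal_ideal (free_pro V A) limone" using principal_ideal_sandwich by metis
  have "\<exists>p\<in>carrier (free_pro V A). \<exists>q\<in>carrier (free_pro V A).
    limone = sg_mult (free_pro V A) (sg_mult (free_pro V A) p z) q"
  proof (rule free_pro_divide[OF ne_A one z(1)])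
    fix S f assume Sf: "(S, f) \<in> gen_maps V A"
    note d = gen_mapsD(4,2)[OF Sf]
    obtain w where w: "w \<in> L" "z (S, f) = word_value S f w" using zL[OF Sf] by blast
    have wA: "w \<in> words A" using w(1) L_words by blast
    obtain x y where xy: "x \<in> words A" "y \<in> words A" "word_value S f (x @ w @ y) \<in> lims S f"
      using L_div[OF Sf w(1)] unfolding lims_def by blast
    obtain s where s: "s \<in> lims S f" "sg_mult S (word_value S f (x @ w @ y)) s = lone S f"
      using lone_inv[OF Sf xy(3)] by blast
    obtain v where "v \<in> W 0" "s = word_value S f v" using limsD[OF s(1)] by blast
    then have v: "v \<in> words A" "s = word_value S f v" using W_words by blast+
    have c: "w @ y \<in> words A" "x @ w @ y \<in> words A" "y @ v \<in> words A" using xy wA v by auto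
    note vc = word_value_closed[OF d]
    have "lone S f = sg_mult S (sg_mult S (word_value S f x) (sg_mult S (word_value S f w) (word_value S f y))) (word_value S f v)"
      using s(2) v(2) word_value_append[OF d xy(1) c(1)] word_value_append[OF d wA xy(2)] by simp
    also have "\<dots> = sg_mult S (sg_mult S (word_value S f x) (word_value S f w)) (sg_mult S (word_value S f y) (word_value S f v))"
      using vc[OF xy(1)] vc[OF wA] vc[OF xy(2)] vc[OF v(1)]
      by (simp only: sgroup_assoc[OF d(1)] sgroup_closed[OF d(1)])
    also have "\<dots> = sg_mult S (sg_mult S (word_value S f x) (z (S, f))) (word_value S f (y @ v))"
      unfolding w(2) word_value_append[OF d xy(2) v(1)] ..
    finally show "\<exists>p\<in>words A. \<exists>q\<in>words A.
       limone (S, f) = sg_mult S (sg_mult S (word_value S f p) (z (S, f))) (word_value S f q)"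
      unfolding limone_apply[OF Sf] using xy(1) c(3) by blast
  qed
  then have 2: "limone \<in> principal_ideal (free_pro V A) z" using principal_ideal_sandwich by metis
  show ?thesis
    unfolding green_J_iff[OF free_pro_sgroup[OF ne_A]] using z(1) one 1 2 by blast
qed

text \<open>A test parameter one above the length of the word tells it from the longer words of
  \<open>W\<close>.\<close>

lemma limgrp_not_word:
  assumes x: "x \<in> limgrp"
  shows "x \<notin> word_embed V A ` L"
proof
  assume "x \<in> word_embed V A ` L"
  then obtain w where w: "w \<in> L" "x = word_embed V A w" by blast
  define m where "m = Suc (length w)"
  let ?T = "test_sgrp A L m" and ?t = "test_map A L m"
  have Tt: "(?T, ?t) \<in> gen_maps V A" using test_coord[of m] by (simp add: m_def)
  obtain u where u: "u \<in> W m" "x (?T, ?t) = word_value ?T ?t u"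
    using limsD[OF limgrpD(2)[OF x Tt]] by blast
  have uA: "u \<in> words A" and wA: "w \<in> words A" using u(1) w(1) W_words L_words by blast+
  have "test L m u = test L m w"
    using u(2) w(2) Tt word_value_test[OF uA] word_value_test[OF wA] by simp
  then have "take m u = take m w"
    using L_tested[OF w(1)] by (auto simp: test_def split: if_splits)
  then have "length (take m u) = length (take m w)" by (rule arg_cong)
  then show False using W_long[OF u(1)] by (simp add: m_def)
qed

section \<open>Comparison with the groups of a directive sequence\<close>

context
  fixes As :: "nat \<Rightarrow> nat set" and \<sigma> :: "nat \<Rightarrow> nat list \<Rightarrow> nat list"
  assumes A0: "As 0 = A" and L_lang: "lang As \<sigma> = L"
begin

lemma J_class_iff:
  "y \<in> J_class V As \<sigma> \<longleftrightarrow> (\<exists>x\<in>carrier (free_pro V A). x \<notin> word_embed V A ` L \<and>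
     (\<forall>S f. (S, f) \<in> gen_maps V A \<longrightarrow> (\<exists>w\<in>L. x (S, f) = word_value S f w)) \<and> green_J (free_pro V A) x y)"
proof -
  have L: "word_embed V A ` L \<subseteq> carrier (free_pro V A)" using word_embed_carrier L_words by blast
  have "(\<exists>y\<in>word_embed V A ` L. x (S, f) = y (S, f)) \<longleftrightarrow> (\<exists>w\<in>L. x (S, f) = word_value S f w)"
    if "(S, f) \<in> gen_maps V A" for x S f
    using that by simp
  then have "x \<in> free_pro_top V A closure_of (word_embed V A ` L) \<longleftrightarrow> x \<in> carrier (free_pro V A) \<and>
    (\<forall>S f. (S, f) \<in> gen_maps V A \<longrightarrow> (\<exists>w\<in>L. x (S, f) = word_value S f w))" for x
    unfolding closure_free_pro_iff[OF L] by simp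
  then show ?thesis unfolding J_class_def Let_def A0 L_lang by auto
qed

lemma limgrp_schutz: "limgrp \<in> schutz_groups V As \<sigma>"
proof -
  have "maximal_subgroup limgrp (free_pro V A)"
    using maximal_subgroup_iff[OF free_pro_sgroup[OF ne_A]] units_at_limone limone_idempotent by blast
  moreover obtain z where zl: "z \<in> limgrp"
    and zL: "\<And>S f. (S, f) \<in> gen_maps V A \<Longrightarrow> z (S, f) \<in> word_value S f ` L"
    using L_limE by metis
  note z = limgrpD[OF zl] zL
  have "x \<in> J_class V As \<sigma>" if "x \<in> limgrp" for x
    unfolding J_class_iff using z(1,3) limgrp_not_word[OF zl] limgrp_J[OF zl that]
    by (intro bexI[of _ z] conjI) (auto simp: image_iff)
  ultimately show ?thesis unfolding schutz_groups_def A0 by blast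
qed

lemma schutz_groups_J:
  assumes "G \<in> schutz_groups V As \<sigma>"
  obtains e where "e \<in> idempotents (free_pro V A)" "G = units_at (free_pro V A) e"
    "green_J (free_pro V A) e limone"
proof -
  note S = free_pro_sgroup[OF ne_A]
  obtain e where e: "e \<in> idempotents (free_pro V A)" "G = units_at (free_pro V A) e"
    using assms maximal_subgroup_iff[OF S] unfolding schutz_groups_def A0 by blast
  have "e \<in> J_class V As \<sigma>"
    using assms idempotent_units_at[OF e(1)] e(2) unfolding schutz_groups_def by blast
  then obtain x where "x \<in> carrier (free_pro V A)" "x \<notin> word_embed V A ` L"
     "\<And>S f. (S, f) \<in> gen_maps V A \<Longrightarrow> \<exists>w\<in>L. x (S, f) = word_value S f w" "green_J (free_pro V A) x e"
    unfolding J_class_iff by blast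
  moreover from this have "green_J (free_pro V A) x limone" by (intro closure_J)
  ultimately have "green_J (free_pro V A) e limone" unfolding green_J_def by simp
  then show ?thesis using that e by blast
qed

text \<open>Every maximal subgroup in the J-class has an identity J-equivalent to
  \<open>limone\<close>; transferring generating sets in both directions gives all of them the same
  rank.\<close>

lemma schutz_rank_isI:
  assumes "r \<ge> 1" "topgen A limgrp r" "\<And>k. topgen A limgrp k \<Longrightarrow> r \<le> k"
  shows "schutz_rank_is V As \<sigma> r"
proof -
  have "top_rank (free_pro_top V A) (free_pro V A) G = enat r" if G: "G \<in> schutz_groups V As \<sigma>" for G
  proof -
    obtain e where e: "e \<in> idempotents (free_pro V A)" "G = units_at (free_pro V A) e"
      "green_J (free_pro V A) e limone" using schutz_groups_J[OF G] .
    have J': "green_J (free_pro V A) limone e" using e(3) unfolding green_J_def by simp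
    show ?thesis
      unfolding e(2)
    proof (rule top_rank_eqI[OF _ _ assms(1)])
      show "units_at (free_pro V A) e \<subseteq> carrier (free_pro V A)" unfolding units_at_def by blast
      show "sg_mult (free_pro V A) x y \<in> units_at (free_pro V A) e"
        if "x \<in> units_at (free_pro V A) e" "y \<in> units_at (free_pro V A) e" for x y
        by (rule units_at_closed[OF free_pro_sgroup[OF ne_A] that])
      show "topgen A (units_at (free_pro V A) e) r"
        using topgen_transfer[OF ne_A e(1) limone_idempotent e(3)] assms(2) units_at_limone by simp
      show "r \<le> k" if "topgen A (units_at (free_pro V A) e) k" for k
        using topgen_transfer[OF ne_A limone_idempotent e(1) J' that] assms(3) units_at_limone by simp
    qed
  qed
  then show ?thesis
    unfolding schutz_rank_is_def A0 using limgrp_schutz by (intro conjI ballI) auto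
qed

end

end

subsection \<open>Substitutions with a marker\<close>

text \<open>The block \<open>0\<^sup>N 1\<close> occurs in a concatenation of words \<open>\<tau> c\<close> only at the
  position where it is displayed, since \<open>\<tau> c\<close> is too short to contain it elsewhere. Cutting
  points can therefore be read off locally.\<close>

locale marked_subst =
  fixes n :: nat and first :: "nat \<Rightarrow> nat" and N :: nat and rest :: "nat \<Rightarrow> nat list" and g :: nat
  assumes n2: "n \<ge> 2" and first_less: "\<And>c. c < n \<Longrightarrow> first c < n"
    and rest_set: "\<And>c. c < n \<Longrightarrow> set (rest c) \<subseteq> {..<n}"
    and rest_length: "\<And>c. c < n \<Longrightarrow> length (rest c) = g" and g_less: "g < N"
    and first_rest_inj: "\<And>c d. c < n \<Longrightarrow> d < n \<Longrightarrow> first c = first d \<Longrightarrow> rest c = rest d \<Longrightarrow> c = d"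
    and first0: "first 0 = 0" and rest0: "rest 0 \<noteq> []" "last (rest 0) = 0"
    and pairs: "\<And>a b c. a < n \<Longrightarrow> b < n \<Longrightarrow> c < n \<Longrightarrow>
      \<exists>u v. u \<noteq> [] \<and> v \<noteq> [] \<and> first c # replicate N 0 @ [1] @ rest c = u @ [a, b] @ v"
begin

definition \<tau> :: "nat \<Rightarrow> nat list" where
  "\<tau> c = first c # replicate N 0 @ [1] @ rest c"

definition \<l> :: nat where "\<l> = N + 2 + g"

definition h :: "nat list \<Rightarrow> nat list" where "h w = concat (map \<tau> w)"

abbreviation A :: "nat set" where "A \<equiv> {..<n}"

lemma length_\<tau>: "c < n \<Longrightarrow> length (\<tau> c) = \<l>"
  by (simp add: \<tau>_def \<l>_def rest_length)

lemma \<l>_ge: "\<l> \<ge> 2" "\<l> > 0"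
  by (simp_all add: \<l>_def)

lemma set_\<tau>: "c < n \<Longrightarrow> set (\<tau> c) \<subseteq> A"
  using first_less rest_set n2 by (auto simp: \<tau>_def)

lemma \<tau>_inj: "c < n \<Longrightarrow> d < n \<Longrightarrow> \<tau> c = \<tau> d \<Longrightarrow> c = d"
  using first_rest_inj by (simp add: \<tau>_def)

lemma \<tau>_pairs: "a < n \<Longrightarrow> b < n \<Longrightarrow> c < n \<Longrightarrow> \<exists>u v. u \<noteq> [] \<and> v \<noteq> [] \<and> \<tau> c = u @ [a, b] @ v"
  using pairs by (simp add: \<tau>_def)

lemma h_simps [simp]: "h [] = []" "h (c # w) = \<tau> c @ h w" "h (u @ v) = h u @ h v"
  by (simp_all add: h_def)

lemma length_h: "set w \<subseteq> A \<Longrightarrow> length (h w) = \<l> * length w"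
  by (induction w) (simp_all add: length_\<tau>)

lemma set_h: "set w \<subseteq> A \<Longrightarrow> set (h w) \<subseteq> A"
  by (induction w) (simp_all add: set_\<tau>)

lemma h_words: "w \<in> words A \<Longrightarrow> h w \<in> words A"
  using set_h[of w] by (cases w) (auto simp: words_def \<tau>_def)

lemma nth_h: "set t \<subseteq> A \<Longrightarrow> i < length t \<Longrightarrow> j < \<l> \<Longrightarrow> h t ! (\<l> * i + j) = \<tau> (t ! i) ! j"
proof (induction t arbitrary: i)
  case (Cons c t)
  then show ?case
    by (cases i) (simp_all add: nth_append length_\<tau>)
qed simp

lemma \<tau>_nth_0: "1 \<le> j \<Longrightarrow> j \<le> N \<Longrightarrow> \<tau> c ! j = 0"
  by (cases j) (simp_all add: \<tau>_def nth_append)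

lemma \<tau>_nth_1: "\<tau> c ! (N + 1) = 1"
  by (simp add: \<tau>_def nth_append)

text \<open>In a misaligned occurrence some marker letter 1 would coincide with a 0 of a run of
  \<open>N\<close> zeros. The inequality \<open>g < N\<close> ensures that one of the two possible
  collisions takes place for every shift \<open>r\<close>.\<close>

lemma h_occurrence:
  assumes t: "set t \<subseteq> A" and c: "c < n" and eq: "h t = p @ \<tau> c @ s"
  shows "\<exists>t1 t2. t = t1 @ c # t2 \<and> p = h t1 \<and> s = h t2"
proof -
  define P where "P = length p"
  define r where "r = P mod \<l>"
  define a where "a = P div \<l>"
  have len: "P + \<l> \<le> \<l> * length t"
    using arg_cong[OF eq, of length] length_h[OF t] length_\<tau>[OF c] by (simp add: P_def)
  have P: "P = \<l> * a + r" by (simp add: a_def r_def)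
  have r: "r < \<l>" using \<l>_ge by (simp add: r_def)
  have nth: "h t ! (P + j) = \<tau> c ! j" if "j < \<l>" for j
    unfolding eq P_def using that length_\<tau>[OF c] by (simp add: nth_append)
  have at: "h t ! k = \<tau> (t ! i) ! j" if "k = \<l> * i + j" "j < \<l>" "k < P + \<l>" for k i j
  proof -
    have "\<l> * i < \<l> * length t" using that len by linarith
    then have "i < length t" by simp
    then show ?thesis using nth_h[OF t _ that(2)] that(1) by simp
  qed
  have "r = 0"
  proof (rule ccontr)
    assume "r \<noteq> 0"
    show False
    proof (cases "r + N + 1 \<ge> \<l> + 1")
      \<comment> \<open>The shift is so large that the marker of the occurrence falls into the run
        of zeros of the next block.\<close>
      case True
      let ?j = "r + N + 1 - \<l>"
      have x1: "h t ! (P + (N + 1)) = 1" using nth[of "N + 1"] \<tau>_nth_1 by (simp add: \<l>_def)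
      have x2: "h t ! (P + (N + 1)) = \<tau> (t ! (a + 1)) ! ?j"
        by (rule at) (use True r P in \<open>simp_all add: \<l>_def\<close>)
      have x3: "\<tau> (t ! (a + 1)) ! ?j = 0"
        by (rule \<tau>_nth_0) (use True r in linarith)+
      have "(1::nat) = 0" by (rule trans[OF trans[OF x1[symmetric] x2] x3])
      then show False by simp
    next
      \<comment> \<open>Now \<open>r\<close> is at most \<open>g + 1\<close>, hence at most
        \<open>N\<close>, so the marker of block \<open>a\<close> falls into the run of zeros of the
        occurrence.\<close>
      case False
      let ?j = "N + 1 - r"
      have j: "1 \<le> ?j" "?j \<le> N" using False \<open>r \<noteq> 0\<close> g_less by (simp_all add: \<l>_def)
      have "h t ! (P + ?j) = 0" using nth[of ?j] \<tau>_nth_0[OF j] j by (simp add: \<l>_def)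
      moreover have "h t ! (P + ?j) = \<tau> (t ! a) ! (N + 1)"
        by (rule at) (use j P in \<open>simp_all add: \<l>_def\<close>)
      ultimately show False using \<tau>_nth_1 by simp
    qed
  qed
  then have P': "P = \<l> * a" using P by simp
  have "\<l> * a < \<l> * length t" using len P' \<l>_ge by linarith
  then have a: "a < length t" by simp
  have tt: "t = take a t @ t ! a # drop (Suc a) t" by (rule id_take_nth_drop[OF a])
  have ta: "set (take a t) \<subseteq> A" "t ! a < n" using t a by (auto dest: in_set_takeD simp: subset_iff)
  have "h (take a t) @ \<tau> (t ! a) @ h (drop (Suc a) t) = p @ \<tau> c @ s"
    using eq by (subst (asm) tt) simp
  moreover have "length (h (take a t)) = length p"
    using length_h[OF ta(1)] a P' by (simp add: P_def)
  ultimately have "h (take a t) = p" "\<tau> (t ! a) @ h (drop (Suc a) t) = \<tau> c @ s" by simp_all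
  moreover from this(2) have "\<tau> (t ! a) = \<tau> c" "h (drop (Suc a) t) = s"
    using length_\<tau>[OF ta(2)] length_\<tau>[OF c] by simp_all
  moreover from this(1) have "t ! a = c" using \<tau>_inj ta(2) c by blast
  ultimately show ?thesis using tt by metis
qed

lemma h_prefix:
  "set t \<subseteq> A \<Longrightarrow> set a \<subseteq> A \<Longrightarrow> h t = h a @ s \<Longrightarrow> \<exists>t'. t = a @ t' \<and> s = h t'"
proof (induction a arbitrary: t)
  case (Cons c a)
  obtain t1 t2 where t: "t = t1 @ c # t2" "[] = h t1" "h a @ s = h t2"
    using h_occurrence[of t c "[]" "h a @ s"] Cons.prems by auto
  have "t1 = []" using t(2) by (cases t1) (auto simp: \<tau>_def)
  then show ?case using Cons.IH[of t2] Cons.prems t by auto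
qed auto

lemma h_inj:
  assumes "set t \<subseteq> A" "set a \<subseteq> A" "h t = h a"
  shows "t = a"
proof -
  have "h t = h a @ []" using assms(3) by simp
  from h_prefix[OF assms(1,2) this] obtain t' where "t = a @ t'" "[] = h t'" by blast
  then show ?thesis by (cases t') (simp_all add: \<tau>_def)
qed

lemma h_suffix:
  assumes "set t \<subseteq> A" "set b \<subseteq> A" "h t = x @ h b"
  shows "\<exists>t'. t = t' @ b \<and> x = h t'"
proof (cases b)
  case (Cons c b')
  then obtain t1 t2 where t: "t = t1 @ c # t2" "x = h t1" "h b' = h t2"
    using h_occurrence[of t c x "h b'"] assms by auto
  then have "b' = t2" using h_inj[of b' t2] assms Cons by auto
  then show ?thesis using t Cons by auto
qed (use assms in auto)

subsection \<open>The language\<close>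

lemma hk_append: "(h ^^ k) (u @ v) = (h ^^ k) u @ (h ^^ k) v"
  by (induction k) simp_all

lemma hk_Nil [simp]: "(h ^^ k) [] = []"
  by (induction k) simp_all

lemma hk_set: "set w \<subseteq> A \<Longrightarrow> set ((h ^^ k) w) \<subseteq> A"
  by (induction k) (simp_all add: set_h)

lemma hk_length: "set w \<subseteq> A \<Longrightarrow> length ((h ^^ k) w) = \<l> ^ k * length w"
  by (induction k) (simp_all add: length_h hk_set)

lemma hk_words: "w \<in> words A \<Longrightarrow> (h ^^ k) w \<in> words A"
  by (induction k) (simp_all add: h_words)

lemma hk_add: "(h ^^ (k + j)) w = (h ^^ k) ((h ^^ j) w)"
  by (simp add: funpow_add)

lemma hk_sublist: "sublist u w \<Longrightarrow> sublist ((h ^^ k) u) ((h ^^ k) w)"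
proof -
  assume "sublist u w"
  then obtain p s where "w = p @ u @ s" by (auto simp: sublist_def)
  then show ?thesis by (simp add: hk_append)
qed

definition Lang :: "nat list set" where
  "Lang = {u. u \<noteq> [] \<and> (\<exists>k. \<exists>a<n. sublist u ((h ^^ k) [a]))}"

lemma LangI: "u \<noteq> [] \<Longrightarrow> a < n \<Longrightarrow> sublist u ((h ^^ k) [a]) \<Longrightarrow> u \<in> Lang"
  by (auto simp: Lang_def)

lemma LangE:
  assumes "u \<in> Lang"
  obtains k a where "u \<noteq> []" "a < n" "sublist u ((h ^^ k) [a])"
  using assms by (auto simp: Lang_def)

lemma Lang_factor: "w \<in> Lang \<Longrightarrow> sublist u w \<Longrightarrow> u \<noteq> [] \<Longrightarrow> u \<in> Lang"
  by (meson LangE LangI sublist_order.order.trans)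

lemma Lang_words: "Lang \<subseteq> words A"
proof
  fix u assume "u \<in> Lang"
  then obtain k a where "u \<noteq> []" "a < n" "sublist u ((h ^^ k) [a])" by (rule LangE)
  moreover from this have "set u \<subseteq> A" using hk_set[of "[a]" k] set_mono_sublist by fastforce
  ultimately show "u \<in> words A" by (simp add: words_def)
qed

lemma letter_in_h: "a < n \<Longrightarrow> c < n \<Longrightarrow> sublist [a] (\<tau> c)"
proof -
  assume "a < n" "c < n"
  then obtain u v where "\<tau> c = u @ [a] @ (a # v)" using \<tau>_pairs[of a a c] by auto
  then show ?thesis unfolding sublist_def by blast
qed

lemma Lang_in_h: "u \<in> Lang \<Longrightarrow> \<exists>t. set t \<subseteq> A \<and> sublist u (h t)"
proof -
  assume "u \<in> Lang"
  then obtain k a where u: "u \<noteq> []" "a < n" "sublist u ((h ^^ k) [a])" by (rule LangE)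
  show ?thesis
  proof (cases k)
    case 0
    then have "sublist [a] (h [0])" using letter_in_h[of a 0] u n2 by simp
    then have "sublist u (h [0])" using u(3) 0 sublist_order.order.trans by fastforce
    then show ?thesis using n2 by (intro exI[of _ "[0]"]) simp
  next
    case (Suc j)
    then show ?thesis using u hk_set[of "[a]" j] by (intro exI[of _ "(h ^^ j) [a]"]) simp
  qed
qed

text \<open>The occurrence of \<open>h u\<close> is too long to lie in a single letter, so it lies
  in an image under \<open>h\<close>; its blocks are aligned there and can be read back.\<close>

lemma Lang_desubst:
  assumes u: "u \<noteq> []" "set u \<subseteq> A" "h u \<in> Lang"
  shows "u \<in> Lang"
proof -
  obtain k a where a: "a < n" "sublist (h u) ((h ^^ k) [a])" using u(3) by (rule LangE)
  obtain c u' where cu: "u = c # u'" using u(1) by (cases u) auto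
  have "length (h u) \<ge> \<l>" using length_h[OF u(2)] u(1) by (cases u) auto
  then have "length ((h ^^ k) [a]) \<ge> 2" using sublist_length_le[OF a(2)] \<l>_ge by linarith
  then obtain j where j: "k = Suc j" by (cases k) auto
  let ?t = "(h ^^ j) [a]"
  have t: "set ?t \<subseteq> A" using hk_set[of "[a]" j] a by simp
  obtain p s where "h ?t = p @ h u @ s" using a(2) j by (auto simp: sublist_def)
  then obtain t1 t2 where t12: "?t = t1 @ c # t2" "p = h t1" "h u' @ s = h t2"
    using h_occurrence[OF t, of c p "h u' @ s"] u(2) cu by auto
  then obtain t3 where "t2 = u' @ t3" using h_prefix[of t2 u' s] t u(2) cu by auto
  then have "?t = t1 @ u @ t3" using t12 cu by simp
  then show ?thesis using LangI[OF u(1) a(1), of j] by simp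
qed

section \<open>Words from 0 to 0 and recognizability\<close>

definition Z :: "nat list set" where
  "Z = {w \<in> words A. hd w = 0 \<and> last w = 0}"

definition W :: "nat \<Rightarrow> nat list set" where "W k = (h ^^ k) ` Z"

lemma Z_words: "z \<in> Z \<Longrightarrow> z \<in> words A"
  by (simp add: Z_def)

lemma Z_append: "u \<in> Z \<Longrightarrow> v \<in> Z \<Longrightarrow> u @ v \<in> Z"
  by (auto simp: Z_def words_def)

lemma Z_0: "[0] \<in> Z"
  using n2 by (simp add: Z_def)

lemma h_Z: "z \<in> Z \<Longrightarrow> h z \<in> Z"
proof -
  assume z: "z \<in> Z"
  then have "z \<noteq> []" "hd z = 0" "last z = 0" by (auto simp: Z_def words_def)
  then obtain y x where y: "z = 0 # y" and x: "z = x @ [0]"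
    by (metis append_butlast_last_id list.collapse)
  have "hd (h z) = 0" using y first0 by (simp add: \<tau>_def)
  moreover have "last (h z) = 0" using x rest0 by (simp add: \<tau>_def)
  ultimately show ?thesis using h_words z by (simp add: Z_def)
qed

lemma hk_Z: "z \<in> Z \<Longrightarrow> (h ^^ k) z \<in> Z"
  by (induction k) (simp_all add: h_Z)

text \<open>Decoding proceeds from the left. A window of two blocks that starts with a known block
  is a factor of some \<open>h t\<close>; that block is aligned there, so the second half of the
  window is a block too. Less than one block remains.\<close>

lemma decode:
  assumes "a < n" "\<And>u. u \<noteq> [] \<Longrightarrow> sublist u (\<tau> a @ w) \<Longrightarrow> length u \<le> 2 * \<l> \<Longrightarrow> \<exists>t. set t \<subseteq> A \<and> sublist u (h t)"
  shows "\<exists>v p. set v \<subseteq> A \<and> \<tau> a @ w = h (a # v) @ p \<and> length p < \<l>"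
  using assms
proof (induction "length w" arbitrary: a w rule: less_induct)
  case less
  show ?case
  proof (cases "length w < \<l>")
    case True
    then have "set [] \<subseteq> A \<and> \<tau> a @ w = h (a # []) @ w \<and> length w < \<l>" by simp
    then show ?thesis by blast
  next
    case False
    then obtain b w' where b: "length b = \<l>" "w = b @ w'"
      by (metis append_take_drop_id length_take linorder_not_less min_absorb2)
    have ab: "sublist (\<tau> a @ b) (\<tau> a @ w)" 
      using b(2) sublist_appendI[of "\<tau> a @ b" "[]" w'] by simp
    have "\<tau> a @ b \<noteq> []" "length (\<tau> a @ b) \<le> 2 * \<l>"
      using b(1) length_\<tau>[OF less.prems(1)] by (auto simp: \<tau>_def)
    then obtain t where t: "set t \<subseteq> A" "sublist (\<tau> a @ b) (h t)" using less.prems(2)[OF _ ab] by blast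
    then obtain p s where "h t = p @ \<tau> a @ (b @ s)" by (auto simp: sublist_def)
    then obtain t1 t2 where t12: "t = t1 @ a # t2" "b @ s = h t2" using h_occurrence[OF t(1) less.prems(1)] by blast
    have "t2 \<noteq> []" using t12(2) b(1) \<l>_ge by auto
    then obtain d t3 where d: "t2 = d # t3" by (cases t2) auto
    have dn: "d < n" using t(1) t12(1) d by auto
    have bd: "b = \<tau> d" using t12(2) d b(1) length_\<tau>[OF dn] by simp
    have "\<exists>v p. set v \<subseteq> A \<and> \<tau> d @ w' = h (d # v) @ p \<and> length p < \<l>"
    proof (rule less.hyps[OF _ dn])
      show "length w' < length w" using b \<l>_ge by simp
      fix u assume u: "u \<noteq> []" "sublist u (\<tau> d @ w')" "length u \<le> 2 * \<l>"
      have "sublist u (\<tau> a @ w)"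
        by (rule sublist_order.order.trans[OF u(2)])
          (use b(2) bd sublist_append_leftI[of "\<tau> d @ w'" "\<tau> a"] in simp)
      then show "\<exists>t. set t \<subseteq> A \<and> sublist u (h t)" by (rule less.prems(2)[OF u(1) _ u(3)])
    qed
    then obtain v p where "set v \<subseteq> A" "\<tau> d @ w' = h (d # v) @ p" "length p < \<l>" by blast
    then have "set (d # v) \<subseteq> A \<and> \<tau> a @ w = h (a # d # v) @ p \<and> length p < \<l>" using b(2) bd dn by simp
    then show ?thesis by blast
  qed
qed

text \<open>The last decoded block with the remainder \<open>p\<close> is a window shorter than two
  blocks, hence a factor of some \<open>h t\<close>. It starts with an aligned block and ends with
  the aligned block \<open>\<tau> b\<close>; their distance, the length of \<open>p\<close>, is a
  multiple of \<open>\<l>\<close> and smaller than \<open>\<l>\<close>, so it is 0.\<close>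

lemma decode_full:
  assumes a: "a < n" and b: "b < n" and w: "w = \<tau> a @ x" "w = y @ \<tau> b"
    and fac: "\<And>u. u \<noteq> [] \<Longrightarrow> sublist u w \<Longrightarrow> length u \<le> 2 * \<l> \<Longrightarrow> \<exists>t. set t \<subseteq> A \<and> sublist u (h t)"
  shows "\<exists>v. set v \<subseteq> A \<and> w = h v"
proof -
  obtain v p where v: "set v \<subseteq> A" "w = h (a # v) @ p" "length p < \<l>"
    using decode[OF a, of x] fac w(1) by auto
  obtain v' d where v'd: "a # v = v' @ [d]" by (metis list.distinct(1) rev_exhaust)
  have "set (a # v) \<subseteq> A" using v(1) a by simp
  then have d: "d < n" "set v' \<subseteq> A" unfolding v'd by simp_all
  have wd: "w = h v' @ \<tau> d @ p" using v(2) unfolding v'd by simp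
  have len: "length (\<tau> d @ p) = length p + \<l>" using length_\<tau>[OF d(1)] by simp
  obtain q r where sp: "\<tau> d @ p = q @ r" and lq: "length q = length p"
    by (metis append_take_drop_id len length_take le_add1 min_absorb2)
  have "length r = length (\<tau> b)" using len length_\<tau>[OF b] lq sp by simp
  moreover have "(h v' @ q) @ r = y @ \<tau> b" using wd w(2) sp by simp
  ultimately have "r = \<tau> b" by (metis append_eq_append_conv)
  then have dq: "\<tau> d @ p = q @ \<tau> b" using sp by simp
  have "sublist (\<tau> d @ p) w" unfolding wd by (rule sublist_append_leftI)
  moreover have "\<tau> d @ p \<noteq> []" "length (\<tau> d @ p) \<le> 2 * \<l>" using len v(3) by (auto simp: \<tau>_def)
  ultimately obtain t where t: "set t \<subseteq> A" "sublist (\<tau> d @ p) (h t)" using fac by blast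
  then obtain p0 s where ps: "h t = p0 @ \<tau> d @ (p @ s)" by (auto simp: sublist_def)
  then have ps': "h t = (p0 @ q) @ \<tau> b @ s" using dq by simp
  obtain t1 t2 where t12: "t = t1 @ d # t2" "p0 = h t1" using h_occurrence[OF t(1) d(1) ps] by blast
  obtain t3 t4 where t34: "t = t3 @ b # t4" "p0 @ q = h t3" using h_occurrence[OF t(1) b ps'] by blast
  have s1: "set t1 \<subseteq> A" using t(1) unfolding t12(1) by simp
  have s3: "set t3 \<subseteq> A" using t(1) unfolding t34(1) by simp
  have "length p0 = \<l> * length t1" "length p0 + length q = \<l> * length t3"
    using length_h[OF s1] length_h[OF s3] t12(2) arg_cong[OF t34(2), of length] by simp_all
  then have "\<l> dvd length q" by (metis dvd_add_right_iff dvd_triv_left)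
  then have "p = []" using v(3) lq by (cases p) (auto dest: dvd_imp_le)
  then show ?thesis using v(1,2) a by (intro exI[of _ "a # v"]) simp
qed

text \<open>One application of \<open>h\<close> is removed at a time. Short factors belong to the
  language, so the word can be decoded into blocks; a factor of the decoded word has an image
  \<open>\<l>\<close> times as long in the language, so the bound on tested lengths shrinks by
  \<open>\<l>\<close> as well.\<close>

lemma recognizable:
  assumes "w \<in> words A" "w \<in> tested Lang (2 * \<l> ^ k)" "w = (h ^^ k) u @ x @ (h ^^ k) v" "u \<in> Z" "v \<in> Z"
  shows "w \<in> W k"
  using assms(1-3)
proof (induction k arbitrary: w x)
  case 0
  have "hd w = 0" "last w = 0" using 0 assms(4,5) by (auto simp: Z_def words_def)
  then show ?case using 0 by (simp add: W_def Z_def)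
next
  case (Suc k)
  let ?u = "(h ^^ k) u" and ?v = "(h ^^ k) v"
  have uv: "?u \<in> Z" "?v \<in> Z" using hk_Z assms(4,5) by blast+
  then have uvA: "set ?u \<subseteq> A" "set ?v \<subseteq> A" by (auto simp: Z_def words_def)
  have w: "w = h ?u @ x @ h ?v" using Suc.prems(3) by simp
  obtain u' where u': "?u = 0 # u'" using uv(1) by (cases ?u) (auto simp: Z_def words_def)
  obtain v' where v': "?v = v' @ [0]" using uv(2) by (cases ?v rule: rev_exhaust) (auto simp: Z_def words_def)
  have "\<exists>y. set y \<subseteq> A \<and> w = h y"
  proof (rule decode_full)
    show "w = \<tau> 0 @ (h u' @ x @ h ?v)" using w u' by simp
    show "w = (h ?u @ x @ h v') @ \<tau> 0" using w v' by simp
    fix z assume z: "z \<noteq> []" "sublist z w" "length z \<le> 2 * \<l>"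
    have "\<l> * 1 \<le> \<l> * \<l> ^ k" using \<l>_ge by (intro mult_le_mono2) simp
    then have "length z \<le> 2 * \<l> ^ Suc k" using z(3) unfolding power_Suc by linarith
    then have "z \<in> Lang" using Suc.prems(2) z by (simp add: tested_def)
    then show "\<exists>t. set t \<subseteq> A \<and> sublist z (h t)" by (rule Lang_in_h)
  qed (use n2 in simp_all)
  then obtain y where y: "set y \<subseteq> A" "w = h y" by blast
  obtain y1 where y1: "y = ?u @ y1" "x @ h ?v = h y1"
    using h_prefix[OF y(1) uvA(1), of "x @ h ?v"] w y(2) by auto
  have "set y1 \<subseteq> A" using y(1) y1(1) by simp
  then obtain y2 where y2: "y1 = y2 @ ?v" using h_suffix[OF _ uvA(2), of y1 x] y1(2) by auto
  have "y \<in> W k"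
  proof (rule Suc.IH)
    show "y \<in> words A" using y Suc.prems(1) by (auto simp: words_def)
    show "y = ?u @ y2 @ ?v" using y1 y2 by simp
    show "y \<in> tested Lang (2 * \<l> ^ k)"
      unfolding tested_def
    proof (intro CollectI allI impI)
      fix z assume z: "sublist z y" "z \<noteq> []" "length z \<le> 2 * \<l> ^ k"
      have zA: "set z \<subseteq> A" using set_mono_sublist[OF z(1)] y(1) by blast
      have "sublist (h z) w" using hk_sublist[OF z(1), of 1] y(2) by simp
      moreover have "length (h z) \<le> 2 * \<l> ^ Suc k" using length_h[OF zA] z(3) by simp
      moreover have "h z \<noteq> []" using z(2) by (cases z) (auto simp: \<tau>_def)
      ultimately have "h z \<in> Lang" using Suc.prems(2) by (simp add: tested_def)
      then show "z \<in> Lang" using Lang_desubst z(2) zA by blast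
    qed
  qed
  then show ?case using y(2) by (auto simp: W_def)
qed

section \<open>Uniform recurrence of the language\<close>

lemma block_in_factor:
  assumes "\<And>d. d \<in> set t \<Longrightarrow> length (\<beta> d) = B" "B > 0" "sublist w (concat (map \<beta> t))" "length w \<ge> 2 * B"
  shows "\<exists>d\<in>set t. sublist (\<beta> d) w"
  using assms
proof (induction t)
  case (Cons c t)
  consider "sublist w (\<beta> c)" | "sublist w (concat (map \<beta> t))"
    | w1 w2 where "w = w1 @ w2" "suffix w1 (\<beta> c)" "prefix w2 (concat (map \<beta> t))"
    using Cons.prems(3) unfolding list.map concat.simps sublist_append by blast
  then show ?case
  proof cases
    case 1
    then have "length w \<le> B" using sublist_length_le[OF 1] Cons.prems(1)[of c] by simp
    then show ?thesis using Cons.prems(2,4) by simp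
  next
    case 2
    have "\<exists>d\<in>set t. sublist (\<beta> d) w"
      by (rule Cons.IH[OF _ Cons.prems(2) 2 Cons.prems(4)]) (rule Cons.prems(1), simp)
    then show ?thesis by auto
  next
    case 3
    have "length w1 \<le> B" using suffix_length_le[OF 3(2)] Cons.prems(1)[of c] by (simp only: list.set_intros)
    then have w2: "length w2 \<ge> B" using Cons.prems(4) 3(1) by simp
    then have "t \<noteq> []" using 3(3) Cons.prems(2) by auto
    then obtain d t' where t: "t = d # t'" by (cases t) auto
    have "prefix (\<beta> d) (concat (map \<beta> t))" using t by simp
    then have "prefix (\<beta> d) w2"
      using prefix_length_prefix[OF _ 3(3)] w2 Cons.prems(1)[of d] t by simp
    then obtain s where "w = w1 @ \<beta> d @ s" using 3(1) by (auto simp: prefix_def)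
    then have "sublist (\<beta> d) w" by simp
    then show ?thesis unfolding t by simp
  qed
qed simp

lemma hk_concat: "(h ^^ k) w = concat (map (\<lambda>d. (h ^^ k) [d]) w)"
proof (induction w)
  case (Cons a w)
  then show ?case using hk_append[of k "[a]" w] by simp
qed simp

text \<open>So long a factor contains a full block of level k + 1. Its letter pattern
  \<open>\<tau> d\<close> contains 00 in its interior, and the first of these zeros gives an element
  of \<open>W k\<close> with letters on either side.\<close>

lemma Lang_recurrent:
  assumes w: "w \<in> Lang" "length w \<ge> 2 * \<l> ^ (k + 1)"
  shows "\<exists>x\<in>words A. \<exists>u\<in>W k. \<exists>y\<in>words A. w = x @ u @ y"
proof -
  obtain j c where jc: "c < n" "sublist w ((h ^^ j) [c])" using w(1) by (rule LangE)
  have "length w \<le> \<l> ^ j" using sublist_length_le[OF jc(2)] hk_length[of "[c]" j] jc(1) by simp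
  moreover have "\<l> ^ j \<le> \<l> ^ k" if "j \<le> k" using that \<l>_ge by (intro power_increasing) auto
  moreover have "\<l> ^ k < 2 * \<l> ^ (k + 1)" using \<l>_ge by (simp add: less_le_trans[of _ "\<l> ^ k * 2"])
  ultimately have "\<not> j \<le> k" using w(2) by linarith
  then have j: "j = (k + 1) + (j - (k + 1))" by simp
  define t where "t = (h ^^ (j - (k + 1))) [c]"
  have t: "set t \<subseteq> A" using hk_set[of "[c]"] jc(1) by (simp add: t_def)
  have "(h ^^ j) [c] = (h ^^ (k + 1)) t" unfolding t_def hk_add[symmetric] using j by simp
  also have "\<dots> = concat (map (\<lambda>d. (h ^^ (k + 1)) [d]) t)" by (rule hk_concat)
  finally have "\<exists>d\<in>set t. sublist ((h ^^ (k + 1)) [d]) w"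
    using block_in_factor[of t "\<lambda>d. (h ^^ (k + 1)) [d]" "\<l> ^ (k + 1)" w] jc(2) w(2) t \<l>_ge
      hk_length[of "[_]" "k + 1"] by auto
  then obtain d where d: "d < n" "sublist ((h ^^ (k + 1)) [d]) w" using t by auto
  obtain u v where uv: "u \<noteq> []" "v \<noteq> []" "\<tau> d = u @ [0, 0] @ v" using \<tau>_pairs[of 0 0 d] d(1) n2 by auto
  have uvA: "u \<in> words A" "0 # v \<in> words A" using set_\<tau>[OF d(1)] uv by (auto simp: words_def)
  have "(h ^^ (k + 1)) [d] = (h ^^ k) (u @ [0] @ (0 # v))"
    using uv(3) by (simp add: funpow_swap1)
  also have "\<dots> = (h ^^ k) u @ (h ^^ k) [0] @ (h ^^ k) (0 # v)" by (simp only: hk_append)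
  finally obtain p s where "w = p @ ((h ^^ k) u @ (h ^^ k) [0] @ (h ^^ k) (0 # v)) @ s"
    using d(2) by (auto simp: sublist_def)
  then have weq: "w = (p @ (h ^^ k) u) @ (h ^^ k) [0] @ ((h ^^ k) (0 # v) @ s)" by simp
  have "set w \<subseteq> A" using Lang_words w(1) by (auto simp: words_def)
  then have ps: "set p \<subseteq> A" "set s \<subseteq> A" using weq by auto
  show ?thesis
    using weq words_append2[OF hk_words[OF uvA(1)] ps(1)] words_append[OF hk_words[OF uvA(2)] ps(2)]
      Z_0 unfolding W_def by blast
qed

lemma hk_in_next: "c < n \<Longrightarrow> d < n \<Longrightarrow> sublist ((h ^^ k) [c]) ((h ^^ (k + 1)) [d])"
  using hk_sublist[OF letter_in_h, of c d k] by (simp add: funpow_swap1)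

lemma Lang_in_large:
  assumes "w \<in> Lang"
  shows "\<exists>j. \<forall>i\<ge>j. \<forall>d<n. sublist w ((h ^^ i) [d])"
proof -
  obtain j c where jc: "c < n" "sublist w ((h ^^ j) [c])" using assms by (rule LangE)
  have "\<forall>d<n. sublist w ((h ^^ (j + 1 + i)) [d])" for i
  proof (induction i)
    case 0
    show ?case using hk_in_next[OF jc(1), of _ j] jc(2) sublist_order.order.trans by fastforce
  next
    case (Suc i)
    show ?case
    proof (intro allI impI)
      fix d assume d: "d < n"
      have "sublist w ((h ^^ (j + 1 + i)) [0])" using Suc n2 by simp
      moreover have "sublist ((h ^^ (j + 1 + i)) [0]) ((h ^^ (j + 1 + i + 1)) [d])"
        by (rule hk_in_next[OF _ d]) (use n2 in simp)
      ultimately show "sublist w ((h ^^ (j + 1 + Suc i)) [d])"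
        using sublist_order.order.trans by fastforce
    qed
  qed
  then have "\<forall>i\<ge>j + 1. \<forall>d<n. sublist w ((h ^^ i) [d])" by (metis le_add_diff_inverse)
  then show ?thesis by blast
qed

end

subsection \<open>The limit group of a marked substitution\<close>

text \<open>Solvability of both linear equations is the form in which the group property arises
  below, where words are undone on either side.\<close>

lemma subgroup_of_solvable:
  assumes S: "sgroup_axioms S" and H: "H \<subseteq> carrier S" "H \<noteq> {}"
    and closed: "\<And>a b. a \<in> H \<Longrightarrow> b \<in> H \<Longrightarrow> sg_mult S a b \<in> H"
    and right: "\<And>a b. a \<in> H \<Longrightarrow> b \<in> H \<Longrightarrow> \<exists>x\<in>H. sg_mult S a x = b"
    and left: "\<And>a b. a \<in> H \<Longrightarrow> b \<in> H \<Longrightarrow> \<exists>y\<in>H. sg_mult S y a = b"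
  shows "subgroup_of H S"
proof -
  obtain a where a: "a \<in> H" using H(2) by blast
  obtain e where e: "e \<in> H" "sg_mult S e a = a" using left[OF a a] by blast
  have as: "sg_mult S (sg_mult S x y) z = sg_mult S x (sg_mult S y z)" if "x \<in> H" "y \<in> H" "z \<in> H" for x y z
    using sgroup_assoc[OF S] that H(1) by blast
  have eb: "sg_mult S e b = b" if b: "b \<in> H" for b
  proof -
    obtain x where x: "x \<in> H" "sg_mult S a x = b" using right[OF a b] by blast
    then show ?thesis using as[OF e(1) a x(1)] e(2) by simp
  qed
  let ?G = "\<lparr>carrier = H, monoid.mult = sg_mult S, one = e\<rparr>"
  have "group ?G"
  proof (rule groupI)
    show "\<exists>y\<in>carrier ?G. y \<otimes>\<^bsub>?G\<^esub> x = \<one>\<^bsub>?G\<^esub>" if "x \<in> carrier ?G" for x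
      using left[OF _ e(1), of x] that by simp
  qed (use closed as eb e(1) in simp_all)
  then show ?thesis unfolding subgroup_of_def is_group_def using H(1) by auto
qed

text \<open>Stability of finite semigroups. Nesting the equation gives \<open>a\<close> between
  equal powers of \<open>s\<close> and \<open>t\<close>; if the power of \<open>t\<close>, or of
  \<open>s\<close>, is idempotent, it can be repeated and is therefore absorbed by
  \<open>a\<close>.\<close>

lemma sandwich_absorb:
  assumes S: "sgroup_axioms S" "finite (carrier S)" and c: "a \<in> carrier S" "s \<in> carrier S" "t \<in> carrier S"
    and a: "a = sg_mult S (sg_mult S s a) t"
  shows "\<exists>k\<ge>1. sg_mult S a (spow S t k) = a" "\<exists>k\<ge>1. sg_mult S (spow S s k) a = a"
proof -
  note cl = sgroup_closed[OF S(1)] and as = sgroup_assoc[OF S(1)] and sc = spow_closed[OF S(1)]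
  have pow: "sg_mult S (sg_mult S (spow S s k) a) (spow S t k) = a" for k
  proof (induction k)
    case (Suc k)
    have "sg_mult S (sg_mult S (spow S s (Suc k)) a) (spow S t (Suc k)) =
       sg_mult S (sg_mult S (sg_mult S (spow S s k) s) a) (sg_mult S t (spow S t k))"
      using spow_mult[OF S(1) c(2), of k 0] by (simp add: spow_Suc[of S t])
    also have "\<dots> = sg_mult S (sg_mult S (spow S s k) (sg_mult S (sg_mult S s a) t)) (spow S t k)"
      using c sc[OF c(2)] sc[OF c(3)] by (simp only: as cl)
    also have "\<dots> = a" unfolding a[symmetric] by (rule Suc)
    finally show ?case .
  next
    case 0
    show ?case unfolding spow_0 by (rule a[symmetric])
  qed
  obtain k where k: "k \<ge> 1" "sg_mult S (spow S t k) (spow S t k) = spow S t k"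
    using spow_idempotent[OF S c(3)] by metis
  have "sg_mult S a (spow S t k) = sg_mult S (sg_mult S (sg_mult S (spow S s k) a) (spow S t k)) (spow S t k)"
    unfolding pow ..
  also have "\<dots> = sg_mult S (sg_mult S (spow S s k) a) (sg_mult S (spow S t k) (spow S t k))"
    by (rule as[OF cl[OF sc[OF c(2)] c(1)] sc[OF c(3)] sc[OF c(3)]])
  finally have "sg_mult S a (spow S t k) = a" unfolding k(2) pow .
  then show "\<exists>k\<ge>1. sg_mult S a (spow S t k) = a" using k(1) by blast
  obtain k where k: "k \<ge> 1" "sg_mult S (spow S s k) (spow S s k) = spow S s k"
    using spow_idempotent[OF S c(2)] by metis
  have eq: "sg_mult S (spow S s k) (sg_mult S a (spow S t k)) = a"
    using pow[of k] as[OF sc[OF c(2)] c(1) sc[OF c(3)], of k k] by simp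
  have "sg_mult S (spow S s k) a = sg_mult S (spow S s k) (sg_mult S (spow S s k) (sg_mult S a (spow S t k)))"
    unfolding eq ..
  also have "\<dots> = sg_mult S (sg_mult S (spow S s k) (spow S s k)) (sg_mult S a (spow S t k))"
    by (rule as[OF sc[OF c(2)] sc[OF c(2)] cl[OF c(1) sc[OF c(3)]], symmetric])
  finally have "sg_mult S (spow S s k) a = a" unfolding k(2) eq .
  then show "\<exists>k\<ge>1. sg_mult S (spow S s k) a = a" using k(1) by blast
qed

text \<open>Exhibiting the power as a word that begins and ends with \<open>v\<close> allows a
  letter to be split off at either end later.\<close>

lemma spow_word:
  assumes "sgroup_axioms S" "f \<in> A \<rightarrow> carrier S" "v \<in> words A"
  shows "\<exists>w. set w \<subseteq> A \<and> spow S (word_value S f v) (Suc k) = word_value S f (v @ w @ v)"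
proof (induction k)
  case 0
  show ?case
    by (rule exI[of _ "[]"]) (simp add: spow_Suc word_value_append[OF assms(1,2,3,3)])
next
  case (Suc k)
  then obtain w where w: "set w \<subseteq> A" "spow S (word_value S f v) (Suc k) = word_value S f (v @ w @ v)" by blast
  have "v @ w @ v \<in> words A" using words_append[OF assms(3), of "w @ v"] w(1) assms(3) by (simp add: words_def)
  then have "spow S (word_value S f v) (Suc (Suc k)) = word_value S f (v @ (v @ w @ v))"
    unfolding spow_Suc[of S _ "Suc k"] w(2) by (rule word_value_append[OF assms, symmetric])
  moreover have "set (v @ w) \<subseteq> A" using w(1) words_set[OF assms(3)] by simp
  ultimately show ?case by (intro exI[of _ "v @ w"]) simp
qed

lemma (in pv) limit_elt:
  fixes v :: "nat \<Rightarrow> 'a list"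
  assumes v: "\<And>j. v j \<in> words A"
    and ev: "\<And>S f. (S, f) \<in> gen_maps V A \<Longrightarrow> \<exists>N s. \<forall>j\<ge>N. word_value S f (v j) = s"
  obtains x where "x \<in> carrier (free_pro V A)"
    "\<And>S f. (S, f) \<in> gen_maps V A \<Longrightarrow> \<exists>N. \<forall>j\<ge>N. word_value S f (v j) = x (S, f)"
proof -
  define P where "P = (\<lambda>(S :: nat sgrp) f s. \<exists>N. \<forall>j\<ge>N. word_value S f (v j) = s)"
  define x where "x = (\<lambda>(S, f)\<in>gen_maps V A. SOME s. P S f s)"
  have x: "P S f (x (S, f))" if Sf: "(S, f) \<in> gen_maps V A" for S f
  proof -
    have "\<exists>s. P S f s" using ev[OF Sf] unfolding P_def by blast
    then have "P S f (SOME s. P S f s)" by (rule someI_ex)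
    then show ?thesis using Sf by (simp add: x_def)
  qed
  have un: "s = t" if Pst: "P S f s" "P S f t" for S f s t
  proof -
    obtain N where N: "\<forall>j\<ge>N. word_value S f (v j) = s" using Pst(1) unfolding P_def by (rule exE)
    obtain M where M: "\<forall>j\<ge>M. word_value S f (v j) = t" using Pst(2) unfolding P_def by (rule exE)
    have "s = word_value S f (v (max N M))" by (rule N[rule_format, OF max.cobounded1, symmetric])
    also have "\<dots> = t" by (rule M[rule_format, OF max.cobounded2])
    finally show ?thesis .
  qed
  have "x \<in> carrier (free_pro V A)"
    unfolding free_pro_carrier
  proof (intro conjI allI impI)
    show "x \<in> extensional (gen_maps V A)" by (simp add: x_def)
  next
    fix S f assume Sf: "(S, f) \<in> gen_maps V A"
    obtain N where "\<forall>j\<ge>N. word_value S f (v j) = x (S, f)" using x[OF Sf] unfolding P_def by blast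
    then show "x (S, f) \<in> carrier S" using word_value_closed[OF gen_mapsD(4,2)[OF Sf] v[of N]] by simp
  next
    fix S f T g k
    assume *: "(S, f) \<in> gen_maps V A" "(T, g) \<in> gen_maps V A" "k \<in> sg_hom S T" "\<forall>a\<in>A. k (f a) = g a"
    obtain N where N: "\<forall>j\<ge>N. word_value S f (v j) = x (S, f)" using x[OF *(1)] unfolding P_def by blast
    have hv: "k (word_value S f (v j)) = word_value T g (v j)" for j
      by (rule word_value_hom[OF *(3) gen_mapsD(4,2)[OF *(1)] v]) (use *(4) in blast)
    have "P T g (k (x (S, f)))" unfolding P_def
      by (rule exI[of _ N]) (simp add: N hv[symmetric])
    then show "k (x (S, f)) = x (T, g)" by (rule un[OF _ x[OF *(2)]])
  qed
  then show ?thesis using x unfolding P_def by (rule that)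
qed

locale marked_limit = pv V + marked_subst n first N rest g
  for V n first N rest g +
  assumes LSl_V: "LSl \<subseteq> V"
begin

lemma h_hom: "h \<in> sg_hom (free_sgrp A) (free_sgrp A)"
  by (simp add: sg_hom_def h_words)

lemma hk_hom: "h ^^ k \<in> sg_hom (free_sgrp A) (free_sgrp A)"
  by (simp add: sg_hom_def hk_words hk_append)

text \<open>The first equation describes the limit \<open>f'\<close> of the iterates. The second
  says that \<open>f'\<close> is fixed by the same iterates, so a word may be replaced by a long
  image without changing its value at \<open>f'\<close>.\<close>

definition stab :: "nat sgrp \<Rightarrow> (nat \<Rightarrow> nat) \<Rightarrow> (nat \<Rightarrow> nat) \<Rightarrow> bool" where
  "stab S f f' \<longleftrightarrow> (S, f') \<in> gen_maps V A \<and> (\<exists>J. \<forall>j\<ge>J. \<forall>w\<in>words A.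
     word_value S f ((h ^^ fact j) w) = word_value S f' w \<and> word_value S f' ((h ^^ fact j) w) = word_value S f' w)"

lemma stab_exists:
  assumes Sf: "(S, f) \<in> gen_maps V A"
  obtains f' where "stab S f f'"
proof -
  define T where "T = pull A h S"
  define X where "X = {f. (S, f) \<in> gen_maps V A}"
  have SV: "S \<in> V" using gen_mapsD(1)[OF Sf] .
  have "X = A \<rightarrow>\<^sub>E carrier S" using SV by (auto simp: X_def gen_maps_def)
  then have X: "finite X" using V_finite[OF SV] by (simp add: finite_PiE)
  have TX: "T y \<in> X" if "y \<in> X" for y
    using pull_gen_maps[OF h_hom] that by (simp add: X_def T_def)
  have fX: "f \<in> X" using Sf by (simp add: X_def)
  have TjX: "(T ^^ j) y \<in> X" if "y \<in> X" for j y by (induction j) (simp_all add: TX that)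
  have val: "word_value S ((T ^^ j) y) w = word_value S y ((h ^^ j) w)" if "w \<in> words A" "y \<in> X" for j w y
    using that(1)
  proof (induction j arbitrary: w)
    case (Suc j)
    have "word_value S ((T ^^ Suc j) y) w = word_value S ((T ^^ j) y) (h w)"
      using word_value_pull[OF h_hom _ Suc.prems] TjX[OF that(2), of j] by (simp add: T_def X_def)
    also have "\<dots> = word_value S y ((h ^^ Suc j) w)"
      using Suc.IH[OF h_words[OF Suc.prems]] by (simp add: funpow_swap1)
    finally show ?case .
  qed simp
  obtain i p where ip: "p \<ge> 1" "i \<ge> 1" "\<And>m k. m \<ge> i \<Longrightarrow> (T ^^ (m + p * k)) f = (T ^^ m) f"
    using funpow_periodic[where F = T, OF X fX TX] by metis
  \<comment> \<open>From \<open>J\<close> on, \<open>fact j\<close> is a multiple of the period and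
    at least the preperiod, so all these iterates of the pull-back agree on \<open>f\<close> and fix
    the result.\<close>
  define J where "J = max i p"
  have fact: "p dvd fact j" "fact j \<ge> i" if j: "j \<ge> J" for j
  proof -
    have "p \<le> j" "i \<le> j" using j by (simp_all add: J_def)
    then show "p dvd fact j" "fact j \<ge> i" using dvd_fact[OF ip(1)] fact_ge_self[of j] by simp_all
  qed
  define f' where "f' = (T ^^ fact J) f"
  have eq: "(T ^^ fact j) f = f'" if j: "j \<ge> J" for j
  proof -
    have le: "(fact J :: nat) \<le> fact j" using j by (rule fact_mono)
    have "p dvd fact j - fact J" using fact(1)[OF j] fact(1)[of J] by (simp add: dvd_diff_nat)
    then obtain k where "fact j - fact J = p * k" by (auto simp: dvd_def)
    then have "(fact j :: nat) = fact J + p * k" using le by linarith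
    then show ?thesis using ip(3)[OF fact(2)[of J], of k] by (simp add: f'_def)
  qed
  have eq2: "(T ^^ fact j) f' = f'" if j: "j \<ge> J" for j
  proof -
    obtain k where k: "fact j = p * k" using fact(1)[OF j] by (auto simp: dvd_def)
    have "(T ^^ fact j) f' = (T ^^ (fact j + fact J)) f" unfolding f'_def by (simp add: funpow_add)
    also have "fact j + fact J = fact J + p * k" using k by simp
    finally show ?thesis using ip(3)[OF fact(2)[of J], of k] by (simp add: f'_def)
  qed
  have "f' \<in> X" unfolding f'_def by (rule TjX[OF fX])
  then have "stab S f f'"
    unfolding stab_def
  proof (intro conjI exI[of _ J] allI impI ballI)
    show "(S, f') \<in> gen_maps V A" using \<open>f' \<in> X\<close> by (simp add: X_def)
    fix j w assume j: "J \<le> j" and w: "w \<in> words A"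
    show "word_value S f ((h ^^ fact j) w) = word_value S f' w"
      using val[OF w fX, of "fact j"] unfolding eq[OF j] by (rule sym)
    show "word_value S f' ((h ^^ fact j) w) = word_value S f' w"
      using val[OF w \<open>f' \<in> X\<close>, of "fact j"] unfolding eq2[OF j] by (rule sym)
  qed
  then show ?thesis by (rule that)
qed

lemma stab_gen_maps: "stab S f f' \<Longrightarrow> (S, f') \<in> gen_maps V A"
  by (simp add: stab_def)

lemma stabE:
  assumes "stab S f f'"
  obtains M where "M \<ge> M0" "M \<ge> 1"
    "\<And>w. w \<in> words A \<Longrightarrow> word_value S f ((h ^^ M) w) = word_value S f' w"
    "\<And>w. w \<in> words A \<Longrightarrow> word_value S f' ((h ^^ M) w) = word_value S f' w"
proof -
  obtain J where J: "\<forall>j\<ge>J. \<forall>w\<in>words A.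
     word_value S f ((h ^^ fact j) w) = word_value S f' w \<and> word_value S f' ((h ^^ fact j) w) = word_value S f' w"
    using assms unfolding stab_def by blast
  define j where "j = max J M0"
  have "(fact j :: nat) \<ge> j" by (rule fact_ge_self)
  then have "(fact j :: nat) \<ge> M0" "(fact j :: nat) \<ge> 1" "j \<ge> J" by (simp_all add: j_def)
  then show ?thesis using that[of "fact j"] J by simp
qed

section \<open>The coordinate group at a stabilised map\<close>

context
  fixes S f f'
  assumes st: "stab S f f'"
begin

lemma st_sg: "sgroup_axioms S" and st_fun: "f' \<in> A \<rightarrow> carrier S" and st_fin: "finite (carrier S)"
  using gen_mapsD[OF stab_gen_maps[OF st]] by simp_all

lemma st_closed: "w \<in> words A \<Longrightarrow> word_value S f' w \<in> carrier S"
  by (rule word_value_closed[OF st_sg st_fun])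

lemma st_append: "u \<in> words A \<Longrightarrow> v \<in> words A \<Longrightarrow>
    word_value S f' (u @ v) = sg_mult S (word_value S f' u) (word_value S f' v)"
  by (rule word_value_append[OF st_sg st_fun])

text \<open>The letter may be replaced by its image under an iterate of \<open>h\<close>, which
  consists of blocks, and every block contains every pair in its interior.\<close>

lemma st_pair:
  assumes "a < n" "b < n" "c < n"
  shows "\<exists>u\<in>words A. \<exists>v\<in>words A. word_value S f' [c] = word_value S f' (u @ [a, b] @ v)"
proof -
  obtain M where M: "M \<ge> 1" "word_value S f' ((h ^^ M) [c]) = word_value S f' [c]"
    by (rule stabE[OF st, of 1]) (use assms in simp)
  define t where "t = (h ^^ (M - 1)) [c]"
  have t: "t \<in> words A" unfolding t_def by (rule hk_words) (use assms in simp)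
  have "(h ^^ M) [c] = h t" unfolding t_def using M(1) by (cases M) simp_all
  moreover obtain d t' where d: "t = d # t'" using words_nonempty[OF t] by (cases t) auto
  have dn: "d < n" "set t' \<subseteq> A" using t d by (simp_all add: words_Cons)
  obtain u v where uv: "u \<noteq> []" "v \<noteq> []" "\<tau> d = u @ [a, b] @ v" using \<tau>_pairs[OF assms(1,2) dn(1)] by blast
  have "set (\<tau> d) \<subseteq> A" using set_\<tau>[OF dn(1)] .
  then have "u \<in> words A" "v @ h t' \<in> words A" using uv set_h[OF dn(2)] by (simp_all add: words_def)
  moreover have "h t = u @ [a, b] @ (v @ h t')" using d uv(3) by simp
  ultimately show ?thesis using M(2) by (intro bexI[of _ u] bexI[of _ "v @ h t'"]) simp_all
qed

text \<open>By \<open>st_pair\<close> the value of a is that of u a b v. Absorption makes a power of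
  b v a right identity for a, and the part of that power after the first b undoes this b. In Green's
  terms, appending letters does not leave the R-class.\<close>

lemma st_undo_right1:
  assumes "a < n" "b < n"
  shows "\<exists>r\<in>words A. word_value S f' ([a] @ [b] @ r) = word_value S f' [a]"
proof -
  obtain u v where uv: "u \<in> words A" "v \<in> words A" "word_value S f' [a] = word_value S f' (u @ [a, b] @ v)"
    using st_pair[OF assms assms(1)] by blast
  have a: "[a] \<in> words A" and bv: "b # v \<in> words A" using assms uv(2) by (simp_all add: words_Cons words_set)
  have abv: "[a] @ (b # v) \<in> words A" using words_appendI[OF a bv] .
  have eq: "word_value S f' [a] = sg_mult S (sg_mult S (word_value S f' u) (word_value S f' [a])) (word_value S f' (b # v))"
    using uv(3) st_append[OF uv(1) abv] st_append[OF a bv] sgroup_assoc[OF st_sg st_closed[OF uv(1)] st_closed[OF a] st_closed[OF bv]]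
    by simp
  obtain k where k: "k \<ge> 1" "sg_mult S (word_value S f' [a]) (spow S (word_value S f' (b # v)) k) = word_value S f' [a]"
    using sandwich_absorb(1)[OF st_sg st_fin st_closed[OF a] st_closed[OF uv(1)] st_closed[OF bv] eq] by blast
  obtain w where w: "set w \<subseteq> A" "spow S (word_value S f' (b # v)) k = word_value S f' ((b # v) @ w @ (b # v))"
    using spow_word[OF st_sg st_fun bv, of "k - 1"] k(1) by auto
  have r: "v @ w @ (b # v) \<in> words A" using uv(2) w(1) bv by (auto simp: words_def)
  have "(b # v) @ w @ (b # v) \<in> words A" using r bv by (auto simp: words_def)
  then have "word_value S f' ([a] @ ((b # v) @ w @ (b # v))) = word_value S f' [a]"
    using st_append[OF a] k(2) w(2) by simp
  then show ?thesis using r by (intro bexI[of _ "v @ w @ (b # v)"]) simp_all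
qed

lemma st_undo_left1:
  assumes "a < n" "b < n"
  shows "\<exists>l\<in>words A. word_value S f' (l @ [b] @ [a]) = word_value S f' [a]"
proof -
  obtain u v where uv: "u \<in> words A" "v \<in> words A" "word_value S f' [a] = word_value S f' (u @ [b, a] @ v)"
    using st_pair[OF assms(2,1) assms(1)] by blast
  have a: "[a] \<in> words A" and ub: "u @ [b] \<in> words A" using assms uv(1) by (auto simp: words_def)
  have av: "[a] @ v \<in> words A" using words_appendI[OF a uv(2)] .
  have "u @ [b, a] @ v = (u @ [b]) @ ([a] @ v)" by simp
  then have eq: "word_value S f' [a] = sg_mult S (sg_mult S (word_value S f' (u @ [b])) (word_value S f' [a])) (word_value S f' v)"
    using uv(3) st_append[OF ub av] st_append[OF a uv(2)] sgroup_assoc[OF st_sg st_closed[OF ub] st_closed[OF a] st_closed[OF uv(2)]]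
    by metis
  obtain k where k: "k \<ge> 1" "sg_mult S (spow S (word_value S f' (u @ [b])) k) (word_value S f' [a]) = word_value S f' [a]"
    using sandwich_absorb(2)[OF st_sg st_fin st_closed[OF a] st_closed[OF ub] st_closed[OF uv(2)] eq] by blast
  obtain w where w: "set w \<subseteq> A" "spow S (word_value S f' (u @ [b])) k = word_value S f' ((u @ [b]) @ w @ (u @ [b]))"
    using spow_word[OF st_sg st_fun ub, of "k - 1"] k(1) by auto
  have l: "(u @ [b]) @ w @ u \<in> words A" using ub w(1) uv(1) by (auto simp: words_def)
  have c: "(u @ [b]) @ w @ (u @ [b]) \<in> words A" using ub w(1) by (auto simp: words_def)
  have "word_value S f' (((u @ [b]) @ w @ (u @ [b])) @ [a]) = word_value S f' [a]"
    unfolding st_append[OF c a] w(2)[symmetric] by (rule k(2))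
  then show ?thesis using l by (intro bexI[of _ "(u @ [b]) @ w @ u"]) simp_all
qed

lemma st_undo_right:
  assumes w: "w \<in> words A" and v: "v \<in> words A"
  shows "\<exists>r\<in>words A. word_value S f' (w @ v @ r) = word_value S f' w"
proof -
  have one: "\<exists>r\<in>words A. word_value S f' (w @ [b] @ r) = word_value S f' w" if w: "w \<in> words A" and b: "b < n" for w b
  proof -
    obtain w' a where wa: "w = w' @ [a]" using words_nonempty[OF w] by (metis rev_exhaust)
    have a: "a < n" "set w' \<subseteq> A" using w wa by (auto simp: words_def)
    obtain r where r: "r \<in> words A" "word_value S f' ([a] @ [b] @ r) = word_value S f' [a]"
      using st_undo_right1[OF a(1) b] by blast
    show ?thesis
    proof (cases "w' = []")
      case True
      then show ?thesis using r wa by auto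
    next
      case False
      then have w': "w' \<in> words A" using a(2) by (simp add: words_def)
      have abr: "[a] @ [b] @ r \<in> words A" using a(1) b r(1) by (auto simp: words_def)
      have "word_value S f' (w' @ ([a] @ [b] @ r)) = word_value S f' (w' @ [a])"
        using st_append[OF w' abr] st_append[OF w', of "[a]"] r(2) a(1) by simp
      then show ?thesis using r(1) wa by (intro bexI[of _ r]) simp_all
    qed
  qed
  show ?thesis using v
  proof (induction v rule: rev_induct)
    case (snoc b v)
    have b: "b < n" "set v \<subseteq> A" using snoc.prems by (auto simp: words_def)
    have wv: "w @ v \<in> words A" using words_append[OF w b(2)] .
    obtain r1 where r1: "r1 \<in> words A" "word_value S f' ((w @ v) @ [b] @ r1) = word_value S f' (w @ v)"
      using one[OF wv b(1)] by blast
    show ?case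
    proof (cases "v = []")
      case True
      then show ?thesis using r1 by auto
    next
      case False
      then obtain r2 where r2: "r2 \<in> words A" "word_value S f' (w @ v @ r2) = word_value S f' w"
        using snoc.IH b(2) by (auto simp: words_def)
      have c: "(w @ v) @ [b] @ r1 \<in> words A" using wv b(1) r1(1) by (auto simp: words_def)
      have "word_value S f' (((w @ v) @ [b] @ r1) @ r2) = word_value S f' ((w @ v) @ r2)"
        using st_append[OF c r2(1)] st_append[OF wv r2(1)] r1(2) by simp
      then have "word_value S f' (w @ (v @ [b]) @ (r1 @ r2)) = word_value S f' w" using r2(2) by simp
      then show ?thesis using words_appendI[OF r1(1) r2(1)] by blast
    qed
  qed (simp add: words_def)
qed

lemma st_undo_left:
  assumes w: "w \<in> words A" and v: "v \<in> words A"
  shows "\<exists>l\<in>words A. word_value S f' (l @ v @ w) = word_value S f' w"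
proof -
  have one: "\<exists>l\<in>words A. word_value S f' (l @ [b] @ w) = word_value S f' w" if w: "w \<in> words A" and b: "b < n" for w b
  proof -
    obtain w' a where wa: "w = [a] @ w'" using words_nonempty[OF w] by (cases w) auto
    have a: "a < n" "set w' \<subseteq> A" using w wa by (auto simp: words_def)
    obtain l where l: "l \<in> words A" "word_value S f' (l @ [b] @ [a]) = word_value S f' [a]"
      using st_undo_left1[OF a(1) b] by blast
    show ?thesis
    proof (cases "w' = []")
      case True
      then show ?thesis using l wa by auto
    next
      case False
      then have w': "w' \<in> words A" using a(2) by (simp add: words_def)
      have lba: "l @ [b] @ [a] \<in> words A" using a(1) b l(1) by (auto simp: words_def)
      have "word_value S f' ((l @ [b] @ [a]) @ w') = word_value S f' ([a] @ w')"
        using st_append[OF lba w'] st_append[OF _ w', of "[a]"] l(2) a(1) by simp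
      then show ?thesis using l(1) wa by (intro bexI[of _ l]) simp_all
    qed
  qed
  show ?thesis using v
  proof (induction v)
    case (Cons b v)
    have b: "b < n" "set v \<subseteq> A" using Cons.prems by (auto simp: words_def)
    have vw: "v @ w \<in> words A" using words_append2[OF w b(2)] .
    obtain l1 where l1: "l1 \<in> words A" "word_value S f' (l1 @ [b] @ (v @ w)) = word_value S f' (v @ w)"
      using one[OF vw b(1)] by blast
    show ?case
    proof (cases "v = []")
      case True
      then show ?thesis using l1 by auto
    next
      case False
      then obtain l2 where l2: "l2 \<in> words A" "word_value S f' (l2 @ v @ w) = word_value S f' w"
        using Cons.IH b(2) by (auto simp: words_def)
      have c: "l1 @ [b] @ (v @ w) \<in> words A" using vw b(1) l1(1) by (auto simp: words_def)
      have "word_value S f' (l2 @ (l1 @ [b] @ (v @ w))) = word_value S f' (l2 @ (v @ w))"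
        using st_append[OF l2(1) c] st_append[OF l2(1) vw] l1(2) by simp
      then have "word_value S f' ((l2 @ l1) @ (b # v) @ w) = word_value S f' w" using l2(2) by simp
      then show ?thesis using words_appendI[OF l2(1) l1(1)] by blast
    qed
  qed (simp add: words_def)
qed

text \<open>Passing to a long image makes room to split off an outer 0 and leave a nonempty word,
  also for \<open>z = [0]\<close>.\<close>

lemma st_Z_long:
  assumes z: "z \<in> Z"
  shows "\<exists>y\<in>words A. word_value S f' z = word_value S f' ([0] @ y) \<and> last y = 0"
    "\<exists>y\<in>words A. word_value S f' z = word_value S f' (y @ [0]) \<and> hd y = 0"
proof -
  obtain M where M: "M \<ge> 1" "word_value S f' ((h ^^ M) z) = word_value S f' z"
    by (rule stabE[OF st, of 1]) (use Z_words[OF z] in simp)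
  let ?y = "(h ^^ M) z"
  have y: "?y \<in> Z" by (rule hk_Z[OF z])
  have zl: "length z \<ge> 1" "set z \<subseteq> A" using Z_words[OF z] by (cases z; simp add: words_def)+
  have "\<l> ^ 1 \<le> \<l> ^ M" using M(1) \<l>_ge by (intro power_increasing) auto
  then have "2 \<le> \<l> ^ M * length z" using zl(1) \<l>_ge mult_le_mono[of 2 "\<l> ^ M" 1 "length z"] by simp
  then have len: "length ?y \<ge> 2" using hk_length[OF zl(2), of M] by simp
  have y0: "hd ?y = 0" "last ?y = 0" "set ?y \<subseteq> A" using y by (auto simp: Z_def words_def)
  have 1: "?y = [0] @ tl ?y" "tl ?y \<noteq> []" using len y0(1) by (cases ?y; force)+
  have "last (tl ?y) = 0" using 1 y0(2) by (metis last_appendR)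
  moreover have "set (tl ?y) \<subseteq> set ?y" by (cases ?y) auto
  then have "tl ?y \<in> words A" using 1(2) y0(3) by (simp add: words_def)
  ultimately show "\<exists>y\<in>words A. word_value S f' z = word_value S f' ([0] @ y) \<and> last y = 0"
    using M(2) 1(1) by (intro bexI[of _ "tl ?y"]) simp_all
  have "?y \<noteq> []" using len by auto
  then have 2: "?y = butlast ?y @ [0]" using y0(2) append_butlast_last_id by metis
  have 3: "butlast ?y \<noteq> []" using len 2 by (metis One_nat_def Suc_1 append_Nil length_Cons list.size(3) not_less_eq_eq order_refl)
  have "hd (butlast ?y) = 0" using 2 3 y0(1) by (metis hd_append2)
  moreover have "butlast ?y \<in> words A" using 3 y0(3) by (auto simp: words_def dest: in_set_butlastD)
  ultimately show "\<exists>y\<in>words A. word_value S f' z = word_value S f' (y @ [0]) \<and> hd y = 0"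
    using M(2) 2 by (intro bexI[of _ "butlast ?y"]) simp_all
qed

lemma st_subgroup: "subgroup_of (word_value S f' ` Z) S"
proof (rule subgroup_of_solvable[OF st_sg])
  show "word_value S f' ` Z \<subseteq> carrier S" using st_closed Z_words by blast
  show "word_value S f' ` Z \<noteq> {}" using Z_0 by blast
  fix a b assume "a \<in> word_value S f' ` Z" "b \<in> word_value S f' ` Z"
  then obtain x y where x: "x \<in> Z" "a = word_value S f' x" and y: "y \<in> Z" "b = word_value S f' y" by blast
  note xA = Z_words[OF x(1)] and yA = Z_words[OF y(1)]
  show "sg_mult S a b \<in> word_value S f' ` Z"
    using st_append[OF xA yA] Z_append[OF x(1) y(1)] x(2) y(2) by (metis imageI)
  have zA: "[0] \<in> words A" using n2 by simp
  have x0: "hd x = 0" "last x = 0" "x \<noteq> []" "set x \<subseteq> A" using x(1) by (auto simp: Z_def words_def)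
  obtain y1 where y1: "y1 \<in> words A" "b = word_value S f' ([0] @ y1)" "last y1 = 0"
    using st_Z_long(1)[OF y(1)] y(2) by blast
  obtain x1 where x1: "x = [0] @ x1" using x0 by (cases x) auto
  have "x1 @ [0] \<in> words A" using x1 x0(4) n2 by (simp add: words_def)
  then obtain r where r: "r \<in> words A" "word_value S f' ([0] @ (x1 @ [0]) @ r) = word_value S f' [0]"
    using st_undo_right[OF zA] by blast
  \<comment> \<open>Multiplied by the value of x = 0 x1, the block 0 x1 0 r collapses to 0 by the
    choice of \<open>r\<close>, and 0 y1 has the value \<open>b\<close>.\<close>
  let ?u = "[0] @ r @ y1"
  have uA: "?u \<in> words A" using r(1) y1(1) n2 by (auto simp: words_def)
  have u: "?u \<in> Z" using uA y1(3) words_nonempty[OF y1(1)] by (simp add: Z_def)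
  have cA: "[0] @ (x1 @ [0]) @ r \<in> words A" using r(1) x1 x0(4) by (auto simp: words_def)
  have "sg_mult S a (word_value S f' ?u) = word_value S f' (([0] @ (x1 @ [0]) @ r) @ y1)"
    unfolding x(2) st_append[OF xA uA, symmetric] using x1 by simp
  also have "\<dots> = b" using st_append[OF cA y1(1)] st_append[OF zA y1(1)] r(2) y1(2) by simp
  finally show "\<exists>x\<in>word_value S f' ` Z. sg_mult S a x = b" using u by blast
  obtain y2 where y2: "y2 \<in> words A" "b = word_value S f' (y2 @ [0])" "hd y2 = 0"
    using st_Z_long(2)[OF y(1)] y(2) by blast
  obtain x2 where x2: "x = x2 @ [0]" using x0 by (metis append_butlast_last_id)
  have "[0] @ x2 \<in> words A" using x2 x0(4) n2 by (simp add: words_def)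
  then obtain l where l: "l \<in> words A" "word_value S f' (l @ ([0] @ x2) @ [0]) = word_value S f' [0]"
    using st_undo_left[OF zA] by blast
  \<comment> \<open>The mirror image: l 0 x2 0 collapses to 0, and y2 0 has the value
    \<open>b\<close>.\<close>
  let ?v = "y2 @ l @ [0]"
  have vA: "?v \<in> words A" using l(1) y2(1) n2 by (auto simp: words_def)
  have v: "?v \<in> Z" using vA y2(3) words_nonempty[OF y2(1)] by (simp add: Z_def)
  have dA: "l @ ([0] @ x2) @ [0] \<in> words A" using l(1) x2 x0(4) by (auto simp: words_def)
  have "sg_mult S (word_value S f' ?v) a = word_value S f' (y2 @ (l @ ([0] @ x2) @ [0]))"
    unfolding x(2) st_append[OF vA xA, symmetric] using x2 by simp
  also have "\<dots> = b" using st_append[OF y2(1) dA] st_append[OF y2(1) zA] l(2) y2(2) by simp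
  finally show "\<exists>y\<in>word_value S f' ` Z. sg_mult S y a = b" using v by blast
qed

lemma st_INT_W: "(\<Inter>N. word_value S f ` W N) = word_value S f' ` Z"
proof
  obtain M where M: "\<And>w. w \<in> words A \<Longrightarrow> word_value S f ((h ^^ M) w) = word_value S f' w"
    by (rule stabE[OF st, of 1]) (rule that)
  have "word_value S f ` W M \<subseteq> word_value S f' ` Z"
    unfolding W_def image_image by (rule image_subsetI) (simp only: M[OF Z_words] imageI)
  then show "(\<Inter>N. word_value S f ` W N) \<subseteq> word_value S f' ` Z" by (rule INF_lower2[OF UNIV_I])
  show "word_value S f' ` Z \<subseteq> (\<Inter>N. word_value S f ` W N)"
  proof (intro INT_greatest subsetI)
    fix N s assume "s \<in> word_value S f' ` Z"
    then obtain z where z: "z \<in> Z" "s = word_value S f' z" by blast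
    obtain M where M: "M \<ge> N" "\<And>w. w \<in> words A \<Longrightarrow> word_value S f ((h ^^ M) w) = word_value S f' w"
      by (rule stabE[OF st, of N]) (rule that)
    have "(h ^^ M) z = (h ^^ N) ((h ^^ (M - N)) z)" using hk_add[of N "M - N" z] M(1) by simp
    then have MN: "(h ^^ M) z \<in> W N" unfolding W_def using hk_Z[OF z(1)] by simp
    have "s = word_value S f ((h ^^ M) z)" using M(2)[OF Z_words[OF z(1)]] z(2) by simp
    then show "s \<in> word_value S f ` W N" using MN by (rule image_eqI)
  qed
qed

end

text \<open>The image of the word under the profinite idempotent power of \<open>h\<close>.\<close>

definition hlim :: "nat list \<Rightarrow> nat prof" where
  "hlim w = (SOME x. x \<in> carrier (free_pro V A) \<and> (\<forall>S f. (S, f) \<in> gen_maps V A \<longrightarrow>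
     (\<exists>J. \<forall>j\<ge>J. word_value S f ((h ^^ fact j) w) = x (S, f))))"

lemma hlim_ex:
  assumes w: "w \<in> words A"
  shows "hlim w \<in> carrier (free_pro V A)"
    "\<And>S f. (S, f) \<in> gen_maps V A \<Longrightarrow> \<exists>J. \<forall>j\<ge>J. word_value S f ((h ^^ fact j) w) = hlim w (S, f)"
proof -
  have ev: "\<exists>J s. \<forall>j\<ge>J. word_value S f ((h ^^ fact j) w) = s" if Sf: "(S, f) \<in> gen_maps V A" for S f
  proof -
    obtain f' where "stab S f f'" using stab_exists[OF Sf] .
    then show ?thesis unfolding stab_def using w by blast
  qed
  obtain x where "x \<in> carrier (free_pro V A)"
    "\<And>S f. (S, f) \<in> gen_maps V A \<Longrightarrow> \<exists>J. \<forall>j\<ge>J. word_value S f ((h ^^ fact j) w) = x (S, f)"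
    using limit_elt[of "\<lambda>j. (h ^^ fact j) w" A] hk_words[OF w] ev by metis
  then have "\<exists>x. x \<in> carrier (free_pro V A) \<and> (\<forall>S f. (S, f) \<in> gen_maps V A \<longrightarrow>
     (\<exists>J. \<forall>j\<ge>J. word_value S f ((h ^^ fact j) w) = x (S, f)))" by blast
  from someI_ex[OF this] show "hlim w \<in> carrier (free_pro V A)"
    "\<And>S f. (S, f) \<in> gen_maps V A \<Longrightarrow> \<exists>J. \<forall>j\<ge>J. word_value S f ((h ^^ fact j) w) = hlim w (S, f)"
    unfolding hlim_def by blast+
qed

lemma hlim_stab:
  assumes w: "w \<in> words A" and Sf: "(S, f) \<in> gen_maps V A" and st: "stab S f f'"
  shows "hlim w (S, f) = word_value S f' w"
proof -
  obtain J where J: "\<forall>j\<ge>J. word_value S f ((h ^^ fact j) w) = hlim w (S, f)" using hlim_ex(2)[OF w Sf] by blast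
  obtain K where K: "\<forall>j\<ge>K. \<forall>w\<in>words A. word_value S f ((h ^^ fact j) w) = word_value S f' w"
    using st unfolding stab_def by blast
  have "word_value S f ((h ^^ fact (max J K)) w) = hlim w (S, f)" using J by simp
  moreover have "word_value S f ((h ^^ fact (max J K)) w) = word_value S f' w" using K w by simp
  ultimately show ?thesis by simp
qed

sublocale limit_words V A Lang W
proof
  show "LSl \<subseteq> V" by (rule LSl_V)
  show "finite A" "A \<noteq> {}" using n2 lessThan_empty_iff[of n] by simp_all
  show "Lang \<subseteq> words A" by (rule Lang_words)
  show "u \<in> Lang" if "w \<in> Lang" "sublist u w" "u \<noteq> []" for u w by (rule Lang_factor[OF that])
  show "W N \<subseteq> words A" for N unfolding W_def using hk_words Z_words by blast
  show "W M \<subseteq> W N" if NM: "N \<le> M" for N M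
  proof
    fix w assume "w \<in> W M"
    then obtain z where z: "z \<in> Z" "w = (h ^^ M) z" unfolding W_def by blast
    have "w = (h ^^ N) ((h ^^ (M - N)) z)" using hk_add[of N "M - N" z] NM z(2) by simp
    then show "w \<in> W N" unfolding W_def using hk_Z[OF z(1)] by blast
  qed
  show "length w > N" if "w \<in> W N" for N w
  proof -
    obtain z where z: "z \<in> Z" "w = (h ^^ N) z" using \<open>w \<in> W N\<close> unfolding W_def by blast
    have zl: "length z \<ge> 1" "set z \<subseteq> A" using Z_words[OF z(1)] by (cases z; simp add: words_def)+
    have "N < 2 ^ N" by (rule less_exp)
    also have "(2 :: nat) ^ N \<le> \<l> ^ N" using \<l>_ge by (intro power_mono) simp_all
    also have "\<dots> \<le> \<l> ^ N * length z" using zl(1) by simp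
    finally show ?thesis using hk_length[OF zl(2), of N] z(2) by simp
  qed
  show "subgroup_of (\<Inter>N. word_value S f ` W N) S" if Sf: "(S, f) \<in> gen_maps V A" for S f
  proof -
    obtain f' where st: "stab S f f'" using stab_exists[OF Sf] .
    show ?thesis unfolding st_INT_W[OF st] by (rule st_subgroup[OF st])
  qed
  show "\<exists>m\<ge>1. \<forall>u\<in>W N. \<forall>w\<in>words A. u @ w @ u \<in> tested Lang m \<longrightarrow> u @ w @ u \<in> W N" for N
  proof (intro exI[of _ "2 * \<l> ^ N"] conjI ballI impI)
    have "\<l> ^ N \<ge> 1" using \<l>_ge by simp
    then show "1 \<le> 2 * \<l> ^ N" by simp
    fix u w assume u: "u \<in> W N" and w: "w \<in> words A" and t: "u @ w @ u \<in> tested Lang (2 * \<l> ^ N)"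
    obtain z where z: "z \<in> Z" "u = (h ^^ N) z" using u unfolding W_def by blast
    have "u \<in> words A" unfolding z(2) by (rule hk_words[OF Z_words[OF z(1)]])
    then have "u @ w @ u \<in> words A" using w by auto
    then show "u @ w @ u \<in> W N" by (rule recognizable[OF _ t _ z(1) z(1), of w]) (simp add: z(2))
  qed
  show "\<exists>m. \<forall>w\<in>Lang. m \<le> length w \<longrightarrow> (\<exists>x\<in>words A. \<exists>u\<in>W N. \<exists>y\<in>words A. w = x @ u @ y)" for N
    by (intro exI[of _ "2 * \<l> ^ (N + 1)"] ballI impI) (rule Lang_recurrent)
  show "\<exists>x\<in>words A. \<exists>y\<in>words A. word_value S f (x @ w @ y) \<in> (\<Inter>N. word_value S f ` W N)"
    if Sf: "(S, f) \<in> gen_maps V A" and w: "w \<in> Lang" for S f w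
  proof -
    obtain f' where st: "stab S f f'" using stab_exists[OF Sf] .
    obtain j where j: "\<forall>i\<ge>j. \<forall>d<n. sublist w ((h ^^ i) [d])" using Lang_in_large[OF w] by blast
    obtain M where M: "M \<ge> j" "\<And>w. w \<in> words A \<Longrightarrow> word_value S f ((h ^^ M) w) = word_value S f' w"
      by (rule stabE[OF st, of j]) (rule that)
    have zA: "[0] \<in> words A" using n2 by simp
    let ?z = "(h ^^ M) [0]"
    have zM: "?z \<in> words A" by (rule hk_words[OF zA])
    have "sublist w ?z" using j M(1) n2 by simp
    then obtain p s where ps: "?z = p @ w @ s" by (auto simp: sublist_def)
    have "set p \<subseteq> A" "set s \<subseteq> A" using zM ps by (auto simp: words_def)
    then have c: "?z @ p \<in> words A" "s @ ?z \<in> words A" using words_append[OF zM] words_append2[OF zM] by blast+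
    \<comment> \<open>The image of the middle 0 contains \<open>w\<close>; the images of the outer
      zeros keep the words on both sides of \<open>w\<close> nonempty.\<close>
    have "[0, 0, 0] \<in> Z" using n2 by (simp add: Z_def words_def)
    moreover from this have "word_value S f' [0, 0, 0] = word_value S f ((h ^^ M) [0, 0, 0])"
      using M(2) Z_words by simp
    moreover have "(h ^^ M) [0, 0, 0] = ?z @ ?z @ ?z" using hk_append[of M "[0]" "[0, 0]"] hk_append[of M "[0]" "[0]"] by simp
    then have "(h ^^ M) [0, 0, 0] = (?z @ p) @ w @ (s @ ?z)" using ps by simp
    ultimately have "word_value S f ((?z @ p) @ w @ (s @ ?z)) \<in> word_value S f' ` Z" by (metis imageI)
    then show ?thesis unfolding st_INT_W[OF st] using c by blast
  qed
  show "\<exists>z\<in>carrier (free_pro V A). \<forall>S f. (S, f) \<in> gen_maps V A \<longrightarrow>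
       z (S, f) \<in> (\<Inter>N. word_value S f ` W N) \<and> z (S, f) \<in> word_value S f ` Lang"
  proof (intro bexI[of _ "hlim [0]"] allI impI conjI)
    have zA: "[0] \<in> words A" using n2 by simp
    show "hlim [0] \<in> carrier (free_pro V A)" by (rule hlim_ex(1)[OF zA])
    fix S f assume Sf: "(S, f) \<in> gen_maps V A"
    obtain f' where st: "stab S f f'" using stab_exists[OF Sf] .
    show "hlim [0] (S, f) \<in> (\<Inter>N. word_value S f ` W N)"
      unfolding st_INT_W[OF st] hlim_stab[OF zA Sf st] using Z_0 by blast
    obtain J where "\<forall>j\<ge>J. word_value S f ((h ^^ fact j) [0]) = hlim [0] (S, f)" using hlim_ex(2)[OF zA Sf] by blast
    then have "hlim [0] (S, f) = word_value S f ((h ^^ fact J) [0])" by simp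
    moreover have "(h ^^ fact J) [0] \<in> Lang"
      using LangI[of _ 0 "fact J"] words_nonempty[OF hk_words[OF zA]] n2 by simp
    ultimately show "hlim [0] (S, f) \<in> word_value S f ` Lang" by blast
  qed
qed

lemma lims_stab: "stab S f f' \<Longrightarrow> lims S f = word_value S f' ` Z"
  unfolding lims_def by (rule st_INT_W)

text \<open>Only the image of \<open>w\<close> has to start and end with 0. This admits single
  letters as generators when every \<open>\<tau> c\<close> starts and ends with 0.\<close>

lemma hlim_limgrp:
  assumes w: "w \<in> words A" "h w \<in> Z"
  shows "hlim w \<in> limgrp"
proof (rule limgrpI[OF hlim_ex(1)[OF w(1)]])
  fix S f assume Sf: "(S, f) \<in> gen_maps V A"
  obtain f' where st: "stab S f f'" using stab_exists[OF Sf] .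
  obtain M where M: "M \<ge> 1" "word_value S f' ((h ^^ M) w) = word_value S f' w"
    by (rule stabE[OF st, of 1]) (use w in simp)
  have "(h ^^ M) w = (h ^^ (M - 1)) (h w)" using M(1) by (cases M) (simp_all add: funpow_swap1)
  then have "(h ^^ M) w \<in> Z" using hk_Z[OF w(2)] by simp
  then show "hlim w (S, f) \<in> lims S f"
    unfolding lims_stab[OF st] hlim_stab[OF w(1) Sf st] using M(2) by (metis imageI)
qed

subsection \<open>The directive sequence\<close>

lemma dcomp_const: "dcomp (\<lambda>_. h) k j = h ^^ j"
  by (induction j) (simp_all add: funpow_Suc_right del: funpow.simps(2))

lemma dseq_const: "dseq (\<lambda>_. h) k m = h ^^ (m - k)"
  by (simp add: dseq_def dcomp_const)

lemma lang_const: "lang (\<lambda>_. A) (\<lambda>_. h) = Lang"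
  by (auto simp: lang_def Lang_def factors_def dseq_const)

lemma h_directive: "directive_sequence (\<lambda>_. A) (\<lambda>_. h)"
  using fin_A ne_A h_hom by (simp add: directive_sequence_def)

lemma h_primitive: "primitive (\<lambda>_. A) (\<lambda>_. h)"
  unfolding primitive_def
proof
  fix k
  have "positive_hom A A (dseq (\<lambda>_. h) k (Suc k))"
    unfolding positive_hom_def dseq_const
  proof (intro ballI conjI subsetI)
    fix a b assume a: "a \<in> A" and b: "b \<in> A"
    have "sublist [b] (\<tau> a)" using letter_in_h a b by simp
    then show "b \<in> set ((h ^^ (Suc k - k)) [a])" using set_mono_sublist by fastforce
  qed (use length_\<tau> \<l>_ge in simp)
  then show "\<exists>m>k. positive_hom A A (dseq (\<lambda>_. h) k m)" by blast
qed

text \<open>Each coordinate of an element of the group is the value of a word in \<open>W k\<close>,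
  which is an image under the k-th iterate; closedness of the image does the rest.\<close>

lemma h_saturating: "saturating V (\<lambda>_. A) (\<lambda>_. h)"
  unfolding saturating_def
proof (rule bexI[of _ limgrp])
  show "limgrp \<in> schutz_groups V (\<lambda>_. A) (\<lambda>_. h)" by (rule limgrp_schutz) (simp_all add: lang_const)
  show "limgrp \<subseteq> Im_dseq V (\<lambda>_. A) (\<lambda>_. h)"
    unfolding Im_dseq_def dseq_const
  proof (intro subsetI INT_I)
    fix x k assume x: "x \<in> limgrp"
    show "x \<in> pro_ext V A A (h ^^ (k - 0)) ` carrier (free_pro V A)"
    proof (rule pro_ext_imageI[OF hk_hom ne_A limgrpD(1)[OF x]])
      fix S f assume Sf: "(S, f) \<in> gen_maps V A"
      obtain w where w: "w \<in> W k" "x (S, f) = word_value S f w" using limsD[OF limgrpD(2)[OF x Sf]] by blast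
      then obtain z where "z \<in> Z" "w = (h ^^ k) z" unfolding W_def by blast
      then show "\<exists>v\<in>words A. x (S, f) = word_value S f ((h ^^ (k - 0)) v)" using w(2) Z_words by auto
    qed
  qed
qed

lemma rank_optimalI:
  assumes "r \<ge> 1" "topgen A limgrp r" "\<And>k. topgen A limgrp k \<Longrightarrow> r \<le> k"
  shows "rank_bound_optimal V n r"
  unfolding rank_bound_optimal_def
proof (intro exI conjI impI)
  show "directive_sequence (\<lambda>_. A) (\<lambda>_. h)" by (rule h_directive)
  show "primitive (\<lambda>_. A) (\<lambda>_. h)" by (rule h_primitive)
  show "alphabet_rank (\<lambda>_. A) = enat n" by (simp add: alphabet_rank_def Liminf_const)
  show "saturating V (\<lambda>_. A) (\<lambda>_. h)" by (rule h_saturating)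
  show "schutz_rank_is V (\<lambda>_. A) (\<lambda>_. h) r"
    by (rule schutz_rank_isI[OF _ _ assms]) (simp_all add: lang_const)
qed

end

subsection \<open>Upper bounds for the rank\<close>

context marked_limit
begin

lemma limgrp_stab:
  assumes "x \<in> limgrp" "(S, f) \<in> gen_maps V A"
  obtains f' z where "stab S f f'" "z \<in> Z" "x (S, f) = word_value S f' z"
proof -
  obtain f' where st: "stab S f f'" using stab_exists[OF assms(2)] .
  have "x (S, f) \<in> word_value S f' ` Z" using limgrpD(2)[OF assms] lims_stab[OF st] by simp
  then obtain z where "x (S, f) = word_value S f' z" "z \<in> Z" by (rule imageE)
  then show ?thesis using that[OF st] by simp
qed

text \<open>The limits of the letters lie in the group, and a coordinate of the group is the value
  at \<open>f'\<close> of a word, that is, a product of letter values.\<close>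

lemma topgen_letters:
  assumes f0: "\<And>c. c < n \<Longrightarrow> first c = 0" and r0: "\<And>c. c < n \<Longrightarrow> rest c \<noteq> [] \<and> last (rest c) = 0"
  shows "topgen A limgrp n"
proof -
  define G where "G = (\<lambda>c. hlim [c]) ` A"
  have "h [c] \<in> Z" if "c < n" for c
    using f0[OF that] r0[OF that] h_words[of "[c]"] that by (simp add: Z_def \<tau>_def)
  then have G: "G \<subseteq> limgrp" unfolding G_def using hlim_limgrp by force
  have gen: "\<exists>y\<in>sg_generated (free_pro V A) G. word_value S f' w = y (S, f)"
    if Sf: "(S, f) \<in> gen_maps V A" and st: "stab S f f'" and "w \<in> words A" for S f f' w
    using \<open>w \<in> words A\<close>
  proof (induction w)
    case (Cons c w)
    have c: "c < n" using Cons.prems by (simp add: words_Cons)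
    have hc: "hlim [c] \<in> sg_generated (free_pro V A) G" "hlim [c] (S, f) = word_value S f' [c]"
      using sg_generated_incl[of G] c hlim_stab[OF _ Sf st, of "[c]"] by (auto simp: G_def)
    show ?case
    proof (cases "w = []")
      case True
      then show ?thesis using hc by (intro bexI[of _ "hlim [c]"]) simp_all
    next
      case False
      then have w: "w \<in> words A" using Cons.prems by (simp add: words_Cons words_def)
      obtain y where y: "y \<in> sg_generated (free_pro V A) G" "word_value S f' w = y (S, f)" using Cons.IH[OF w] by blast
      have "word_value S f' (c # w) = sg_mult (free_pro V A) (hlim [c]) y (S, f)"
        using word_value_Cons[OF False, of S f' c] hc(2) y(2) by (simp add: free_pro_mult[OF Sf])
      then show ?thesis using sg_generated_closed[OF hc(1) y(1)] by blast
    qed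
  qed (simp add: words_def)
  show ?thesis
    unfolding topgen_def
  proof (intro exI[of _ G] conjI ballI allI impI)
    show "G \<subseteq> limgrp" by (rule G)
    show "finite G" by (simp add: G_def)
    show "card G \<le> n" using card_image_le[OF fin_A, of "\<lambda>c. hlim [c]"] by (simp add: G_def)
    fix x S f assume x: "x \<in> limgrp" and Sf: "(S, f) \<in> gen_maps V A"
    obtain f' z where "stab S f f'" "z \<in> Z" "x (S, f) = word_value S f' z" using limgrp_stab[OF x Sf] .
    then show "\<exists>y\<in>sg_generated (free_pro V A) G. x (S, f) = y (S, f)" using gen[OF Sf] Z_words by simp
  qed
qed

text \<open>A finite group has inverses among positive powers. The idempotent power has index at
  least 1, so one factor can be split off.\<close>

lemma lims_subsemigroup_inverse:
  assumes Sf: "(S, f) \<in> gen_maps V A" and Q: "Q \<subseteq> lims S f" and q: "q \<in> Q"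
    and mul: "\<And>x y. x \<in> Q \<Longrightarrow> y \<in> Q \<Longrightarrow> sg_mult S x y \<in> Q"
  shows "\<exists>p\<in>Q. sg_mult S q p = lone S f \<and> sg_mult S p q = lone S f"
proof -
  note d = gen_mapsD(4,5)[OF Sf]
  have qc: "q \<in> carrier S" using q Q lims_carrier[OF Sf] by blast
  obtain k where k: "k \<ge> 1" "sg_mult S (spow S q k) (spow S q k) = spow S q k"
    using spow_idempotent[OF d qc] by metis
  have mem: "spow S q j \<in> Q" for j by (rule spow_mem[OF q mul])
  have one: "spow S q k = lone S f"
    by (rule lone_unique[OF Sf subsetD[OF Q mem] k(2)])
  have "spow S q k = sg_mult S q (spow S q (k - 1))" "spow S q k = sg_mult S (spow S q (k - 1)) q"
    using k(1) spow_Suc[of S q "k - 1"] spow_mult[OF d(1) qc, of "k - 1" 0] by simp_all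
  then show ?thesis using one mem[of "k - 1"] by (intro bexI[of _ "spow S q (k - 1)"]) simp_all
qed

text \<open>Words from \<open>0\<close> to \<open>0\<close> are closed walks in the complete directed graph with loops. The
  generators are the fundamental cycles of the spanning tree with edges \<open>b \<rightarrow> 0\<close>.\<close>

definition loops :: "nat list set" where
  "loops = insert [0] ((\<lambda>b. [0, b, 0]) ` {1..<n} \<union> (\<lambda>(a, b). [0, a, b, 0]) ` ({1..<n} \<times> {1..<n}))"

lemma loops_Z: "loops \<subseteq> Z"
  using n2 by (auto simp: loops_def Z_def words_def)

lemma card_loops: "finite loops" "card loops \<le> n\<^sup>2 - n + 1"
proof -
  let ?B = "(\<lambda>b. [0, b, 0 :: nat]) ` {1..<n}"
  let ?C = "(\<lambda>(a, b). [0, a, b, 0 :: nat]) ` ({1..<n} \<times> {1..<n})"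
  show "finite loops" by (simp add: loops_def)
  have "card ?B \<le> n - 1" "card ?C \<le> (n - 1) * (n - 1)"
    using card_image_le[of "{1..<n}" "\<lambda>b. [0, b, 0 :: nat]"]
      card_image_le[of "{1..<n} \<times> {1..<n}" "\<lambda>(a, b). [0, a, b, 0 :: nat]"] by simp_all
  then have "card (?B \<union> ?C) \<le> (n - 1) + (n - 1) * (n - 1)"
    using card_Un_le[of ?B ?C] by linarith
  moreover have "card loops \<le> Suc (card (?B \<union> ?C))"
    unfolding loops_def by (subst card_insert_if) simp_all
  moreover have "(n - 1) + (n - 1) * (n - 1) = n\<^sup>2 - n"
    using n2 by (cases n) (simp_all add: power2_eq_square)
  ultimately show "card loops \<le> n\<^sup>2 - n + 1" by linarith
qed

lemma topgen_loops: "topgen A limgrp (n\<^sup>2 - n + 1)"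
proof -
  define G where "G = hlim ` loops"
  let ?gen = "sg_generated (free_pro V A) G"
  have GZ: "hlim w \<in> limgrp" if "w \<in> loops" for w
    using hlim_limgrp[OF Z_words h_Z] loops_Z that by blast
  have G: "G \<subseteq> limgrp" unfolding G_def using GZ by blast
  have gen_sub: "?gen \<subseteq> limgrp"
    by (rule sg_generated_least[OF G _ limgrp_mult]) (use limgrpD(1) in blast)
  have main: "\<exists>y\<in>?gen. word_value S f' z = y (S, f)"
    if Sf: "(S, f) \<in> gen_maps V A" and st: "stab S f f'" and z: "z \<in> Z" for S f f' z
  proof -
    let ?m = "sg_mult S" and ?e = "lone S f"
    define \<phi> where "\<phi> = word_value S f'"
    define Q where "Q = (\<lambda>y. y (S, f)) ` ?gen"
    note as = sgroup_assoc[OF st_sg[OF st]] and cl = sgroup_closed[OF st_sg[OF st]]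
    have \<phi>c: "\<phi> w \<in> carrier S" if "w \<in> words A" for w unfolding \<phi>_def by (rule st_closed[OF st that])
    have \<phi>a: "\<phi> (u @ v) = ?m (\<phi> u) (\<phi> v)" if "u \<in> words A" "v \<in> words A" for u v
      unfolding \<phi>_def by (rule st_append[OF st that])
    have \<phi>Z: "\<phi> w \<in> lims S f" if "w \<in> Z" for w
      unfolding lims_stab[OF st] \<phi>_def using that by (rule imageI)
    have Ql: "Q \<subseteq> lims S f" unfolding Q_def using gen_sub limgrpD(2)[OF _ Sf] by blast
    have Qm: "?m x y \<in> Q" if xy: "x \<in> Q" "y \<in> Q" for x y
    proof -
      obtain x' y' where "x' \<in> ?gen" "y' \<in> ?gen" "x = x' (S, f)" "y = y' (S, f)" using xy by (auto simp: Q_def)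
      then show ?thesis
        unfolding Q_def using sg_generated_closed[of x' "free_pro V A" G y']
        by (intro image_eqI[of _ _ "sg_mult (free_pro V A) x' y'"]) (simp_all add: free_pro_mult[OF Sf])
    qed
    have Qi: "\<exists>p\<in>Q. ?m q p = ?e \<and> ?m p q = ?e" if "q \<in> Q" for q
      by (rule lims_subsemigroup_inverse[OF Sf Ql that Qm])
    have QL: "\<phi> w \<in> Q" if w: "w \<in> loops" for w
    proof -
      have "hlim w \<in> ?gen" using sg_generated_incl[of G] w by (auto simp: G_def)
      moreover have "hlim w (S, f) = \<phi> w"
        unfolding \<phi>_def by (rule hlim_stab[OF Z_words Sf st]) (use loops_Z w in blast)
      ultimately show ?thesis unfolding Q_def by (intro image_eqI[of _ _ "hlim w"]) simp_all
    qed
    \<comment> \<open>Induction along the walk. A prefix that ends at b other than 0 is closed by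
      the tree edge from b to 0, so that its value lies in the group.\<close>
    have claim: "(last (0 # v) = 0 \<longrightarrow> \<phi> (0 # v) \<in> Q) \<and> (last (0 # v) \<noteq> 0 \<longrightarrow> \<phi> ((0 # v) @ [0]) \<in> Q)"
      if "set v \<subseteq> A" for v
      using that
    proof (induction v rule: rev_induct)
      case Nil
      show ?case using QL[of "[0]"] by (simp add: loops_def)
    next
      case (snoc c v)
      define u where "u = 0 # v"
      have c: "c < n" and v: "set v \<subseteq> A" using snoc.prems by simp_all
      have n0: "0 < n" using n2 by simp
      have uA: "u \<in> words A" using v n0 by (simp add: u_def words_Cons)
      have IH: "last u = 0 \<Longrightarrow> \<phi> u \<in> Q" "last u \<noteq> 0 \<Longrightarrow> \<phi> (u @ [0]) \<in> Q"
        using snoc.IH[OF v] by (simp_all add: u_def)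
      have zA: "[0] \<in> words A" and cA: "[c] \<in> words A" and c0A: "[c, 0] \<in> words A"
        using c n0 by (simp_all add: words_Cons)
      have "(c = 0 \<longrightarrow> \<phi> (u @ [c]) \<in> Q) \<and> (c \<noteq> 0 \<longrightarrow> \<phi> (u @ [c, 0]) \<in> Q)"
      proof (cases "last u = 0")
        case True
        have uQ: "\<phi> u \<in> Q" by (rule IH(1)[OF True])
        show ?thesis
        proof (cases "c = 0")
          case True
          have "\<phi> (u @ [0]) = ?m (\<phi> u) (\<phi> [0])" by (rule \<phi>a[OF uA zA])
          then show ?thesis using Qm[OF uQ QL[of "[0]"]] True by (simp add: loops_def)
        next
          case False
          have L: "[0, c, 0] \<in> loops" using False c by (auto simp: loops_def)
          \<comment> \<open>The prefix already ends in 0. The inverse of the value of 0 cancels the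
            0 with which the loop 0 c 0 starts.\<close>
          obtain p where p: "p \<in> Q" "?m p (\<phi> [0]) = ?e" using Qi[OF QL[of "[0]"]] by (auto simp: loops_def)
          have pc: "p \<in> carrier S" using p(1) Ql lims_carrier[OF Sf] by blast
          have "\<phi> [0, c, 0] = ?m (\<phi> [0]) (\<phi> [c, 0])" using \<phi>a[OF zA c0A] by simp
          then have "?m (?m (\<phi> u) p) (\<phi> [0, c, 0]) = ?m (?m (\<phi> u) (?m p (\<phi> [0]))) (\<phi> [c, 0])"
            using \<phi>c[OF uA] pc \<phi>c[OF zA] \<phi>c[OF c0A] by (simp add: as cl)
          also have "\<dots> = \<phi> (u @ [c, 0])"
            unfolding p(2) lone_right[OF Sf subsetD[OF Ql uQ]] by (rule \<phi>a[OF uA c0A, symmetric])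
          finally show ?thesis using Qm[OF Qm[OF uQ p(1)] QL[OF L]] False by simp
        qed
      next
        case False
        define b where "b = last u"
        obtain u1 where u1: "u = u1 @ [b]" using uA words_nonempty b_def by (metis append_butlast_last_id)
        have "u1 \<noteq> []" using u1 False b_def by (auto simp: u_def)
        moreover have b: "b < n" "set u1 \<subseteq> A" using uA u1 by (auto simp: words_def)
        ultimately have u1A: "u1 \<in> words A" by (simp add: words_def)
        have b1: "b \<noteq> 0" using False by (simp add: b_def)
        have uQ: "\<phi> (u @ [0]) \<in> Q" by (rule IH(2)[OF False])
        show ?thesis
        proof (cases "c = 0")
          case True
          then show ?thesis using uQ by simp
        next
          case False
          have L1: "[0, b, 0] \<in> loops" and L2: "[0, b, c, 0] \<in> loops"
            using False b1 b(1) c by (auto simp: loops_def)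
          have bA: "[b] \<in> words A" and zbA: "[0, b] \<in> words A" and bzA: "[b, 0] \<in> words A"
            and zbzA: "[0, b, 0] \<in> words A" using b(1) n0 by (simp_all add: words_Cons)
          obtain p where p: "p \<in> Q" "?m (\<phi> [0, b, 0]) p = ?e" using Qi[OF QL[OF L1]] by blast
          have pc: "p \<in> carrier S" using p(1) Ql lims_carrier[OF Sf] by blast
          \<comment> \<open>The detour b 0, followed by the inverse of 0 b 0 and then 0 b, should
            reduce to b. The value of b need not lie in the group; rewriting it as that of l 0 b
            makes 0 b 0 appear, and the cancellation takes place there.\<close>
          obtain l where l: "l \<in> words A" "\<phi> (l @ [0] @ [b]) = \<phi> [b]"
            using st_undo_left[OF st bA zA] unfolding \<phi>_def by blast
          have lzb: "?m (\<phi> l) (\<phi> [0, b]) = \<phi> [b]" using \<phi>a[OF l(1) zbA] l(2) by simp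
          have "\<phi> [b, 0] = ?m (?m (\<phi> l) (\<phi> [0, b])) (\<phi> [0])" using \<phi>a[OF bA zA] lzb by simp
          also have "\<dots> = ?m (\<phi> l) (\<phi> [0, b, 0])"
            using \<phi>a[OF zbA zA] as[OF \<phi>c[OF l(1)] \<phi>c[OF zbA] \<phi>c[OF zA]] by simp
          finally have bz: "\<phi> [b, 0] = ?m (\<phi> l) (\<phi> [0, b, 0])" .
          have "?m ?e (\<phi> [0, b]) = ?m (?m ?e (\<phi> [0])) (\<phi> [b])"
          proof -
            have "\<phi> [0, b] = ?m (\<phi> [0]) (\<phi> [b])" using \<phi>a[OF zA bA] by simp
            then show ?thesis using as[OF _ \<phi>c[OF zA] \<phi>c[OF bA], of ?e] lone_mem[OF Sf] lims_carrier[OF Sf] by auto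
          qed
          also have "\<dots> = \<phi> [0, b]" using lone_left[OF Sf \<phi>Z[OF Z_0]] \<phi>a[OF zA bA] by simp
          finally have ezb: "?m ?e (\<phi> [0, b]) = \<phi> [0, b]" .
          have "?m (?m (\<phi> [b, 0]) p) (\<phi> [0, b]) = ?m (\<phi> l) (?m (?m (\<phi> [0, b, 0]) p) (\<phi> [0, b]))"
            unfolding bz using \<phi>c[OF l(1)] \<phi>c[OF zbzA] pc \<phi>c[OF zbA] by (simp only: as cl)
          also have "\<dots> = \<phi> [b]" unfolding p(2) ezb by (rule lzb)
          finally have key: "?m (?m (\<phi> [b, 0]) p) (\<phi> [0, b]) = \<phi> [b]" .
          have e1: "\<phi> (u @ [0]) = ?m (\<phi> u1) (\<phi> [b, 0])" using \<phi>a[OF u1A bzA] u1 by simp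
          have e2: "\<phi> [0, b, c, 0] = ?m (\<phi> [0, b]) (\<phi> [c, 0])" using \<phi>a[OF zbA c0A] by simp
          have e3: "\<phi> (u @ [c, 0]) = ?m (?m (\<phi> u1) (\<phi> [b])) (\<phi> [c, 0])" using \<phi>a[OF uA c0A] \<phi>a[OF u1A bA] u1 by simp
          have "?m (?m (\<phi> (u @ [0])) p) (\<phi> [0, b, c, 0]) =
             ?m (?m (\<phi> u1) (?m (?m (\<phi> [b, 0]) p) (\<phi> [0, b]))) (\<phi> [c, 0])"
            unfolding e1 e2 using \<phi>c[OF u1A] \<phi>c[OF bzA] pc \<phi>c[OF zbA] \<phi>c[OF c0A] by (simp only: as cl)
          also have "\<dots> = \<phi> (u @ [c, 0])" unfolding key e3 ..
          finally show ?thesis using Qm[OF Qm[OF uQ p(1)] QL[OF L2]] False by simp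
        qed
      qed
      then show ?case by (simp add: u_def)
    qed
    obtain v where v: "z = 0 # v" using z by (cases z) (auto simp: Z_def words_def)
    have "set v \<subseteq> A" "last (0 # v) = 0" using z v by (auto simp: Z_def words_def)
    then have "\<phi> z \<in> Q" using claim v by simp
    then show ?thesis unfolding Q_def \<phi>_def by blast
  qed
  show ?thesis
    unfolding topgen_def
  proof (intro exI[of _ G] conjI ballI allI impI)
    show "G \<subseteq> limgrp" by (rule G)
    show "finite G" using card_loops(1) by (simp add: G_def)
    show "card G \<le> n\<^sup>2 - n + 1" unfolding G_def using card_image_le[OF card_loops(1), of hlim] card_loops(2) by linarith
    fix x S f assume x: "x \<in> limgrp" and Sf: "(S, f) \<in> gen_maps V A"
    obtain f' z where "stab S f f'" "z \<in> Z" "x (S, f) = word_value S f' z" using limgrp_stab[OF x Sf] .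
    then show "\<exists>y\<in>?gen. x (S, f) = y (S, f)" using main[OF Sf] by simp
  qed
qed

subsection \<open>Lower bounds for the rank\<close>

lemma Z_combine:
  fixes cnt :: "'i \<Rightarrow> nat list \<Rightarrow> nat"
  assumes add: "\<And>i u v. i \<in> I \<Longrightarrow> u \<in> Z \<Longrightarrow> v \<in> Z \<Longrightarrow> cnt i (u @ v) = cnt i u + cnt i v"
    and "u \<in> Z" "z \<in> Z"
  shows "\<exists>w\<in>Z. \<forall>i\<in>I. cnt i w = cnt i u + m * cnt i z"
proof (induction m)
  case (Suc m)
  then obtain w where w: "w \<in> Z" "\<forall>i\<in>I. cnt i w = cnt i u + m * cnt i z" by blast
  show ?case using add[OF _ w(1) assms(3)] w(2) by (intro bexI[OF _ Z_append[OF w(1) assms(3)]]) simp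
qed (use assms(2) in auto)

text \<open>The counting functions \<open>cnt i\<close> modulo \<open>q\<close> induce a homomorphism from the limit group onto
  \<open>r\<close> copies of the cyclic group of order \<open>q\<close>, which is not generated by fewer than \<open>r\<close> elements.\<close>

lemma topgen_lower:
  fixes cnt :: "'i \<Rightarrow> nat list \<Rightarrow> nat" and q :: nat
  assumes q: "q \<ge> 2" and I: "finite I"
    and F: "\<And>i. i \<in> I \<Longrightarrow> (S i, \<phi> i) \<in> gen_maps V A"
    and add: "\<And>i u v. i \<in> I \<Longrightarrow> u \<in> Z \<Longrightarrow> v \<in> Z \<Longrightarrow> cnt i (u @ v) = cnt i u + cnt i v"
    and inv: "\<And>i u. i \<in> I \<Longrightarrow> u \<in> Z \<Longrightarrow> cnt i (h u) mod q = cnt i u mod q"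
    and sep: "\<And>i u v. i \<in> I \<Longrightarrow> u \<in> Z \<Longrightarrow> v \<in> Z \<Longrightarrow>
      word_value (S i) (\<phi> i) u = word_value (S i) (\<phi> i) v \<Longrightarrow> cnt i u mod q = cnt i v mod q"
    and real: "\<And>i. i \<in> I \<Longrightarrow> \<exists>u\<in>Z. \<forall>j\<in>I. cnt j u mod q = (if j = i then 1 else 0)"
    and gen: "topgen A limgrp k"
  shows "card I \<le> k"
proof -
  have rep: "\<exists>w\<in>Z. \<forall>i\<in>I. cnt i w = cnt i u + m * cnt i z" if "u \<in> Z" "z \<in> Z" for u z m
    by (rule Z_combine) (use add that in simp_all)
  \<comment> \<open>There is no empty word in \<open>Z\<close>; \<open>q\<close> copies of 0 take
    its place modulo \<open>q\<close>.\<close>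
  have base: "\<exists>w\<in>Z. \<forall>i\<in>I. cnt i w mod q = 0"
  proof -
    obtain w where w: "w \<in> Z" "\<forall>i\<in>I. cnt i w = cnt i [0] + (q - 1) * cnt i [0]" using rep[OF Z_0 Z_0] by blast
    have "cnt i [0] + (q - 1) * cnt i [0] = q * cnt i [0]" for i using q by (cases q) simp_all
    then have "\<forall>i\<in>I. cnt i w mod q = 0" using w(2) by simp
    then show ?thesis using w(1) by blast
  qed
  have real_all: "\<exists>w\<in>Z. \<forall>i\<in>I. cnt i w mod q = t i mod q" for t
  proof -
    have "\<exists>w\<in>Z. \<forall>i\<in>I. cnt i w mod q = (if i \<in> J then t i mod q else 0)" if "finite J" "J \<subseteq> I" for J
      using that
    proof (induction J rule: finite_induct)
      case empty
      then show ?case using base by simp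
    next
      case (insert j J)
      then obtain w where w: "w \<in> Z" "\<forall>i\<in>I. cnt i w mod q = (if i \<in> J then t i mod q else 0)" by auto
      obtain u where u: "u \<in> Z" "\<forall>i\<in>I. cnt i u mod q = (if i = j then 1 else 0)" using real[of j] insert by auto
      obtain x where x: "x \<in> Z" "\<forall>i\<in>I. cnt i x = cnt i w + t j * cnt i u" using rep[OF w(1) u(1)] by blast
      have "cnt i x mod q = (if i \<in> insert j J then t i mod q else 0)" if i: "i \<in> I" for i
      proof -
        have "cnt i x mod q = (cnt i w mod q + t j * (cnt i u mod q)) mod q"
          unfolding bspec[OF x(2) i] by (rule mod_add_cong) (simp_all add: mod_mult_right_eq)
        then show ?thesis using w(2) u(2) i insert.hyps(2) by auto
      qed
      then show ?case using x(1) by blast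
    qed
    from this[OF I order_refl] show ?thesis by simp
  qed
  have hk_inv: "cnt i ((h ^^ m) u) mod q = cnt i u mod q" if "i \<in> I" "u \<in> Z" for i u m
    by (induction m) (simp_all add: inv[OF that(1) hk_Z[OF that(2)]])
  obtain G where G: "G \<subseteq> limgrp" "finite G" "card G \<le> k"
    "\<And>x S f. x \<in> limgrp \<Longrightarrow> (S, f) \<in> gen_maps V A \<Longrightarrow> \<exists>y\<in>sg_generated (free_pro V A) G. x (S, f) = y (S, f)"
    using gen unfolding topgen_def by blast
  have FI: "finite ((\<lambda>i. (S i, \<phi> i)) ` I)" "(\<lambda>i. (S i, \<phi> i)) ` I \<subseteq> gen_maps V A"
    using I by simp (rule image_subsetI, rule F)
  \<comment> \<open>A single coordinate that dominates all the counting coordinates determines every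
    count modulo \<open>q\<close>.\<close>
  have "\<exists>T \<gamma>. (T, \<gamma>) \<in> gen_maps V A \<and> (\<forall>i\<in>I. \<exists>p\<in>sg_hom T (S i). \<forall>a\<in>A. p (\<gamma> a) = \<phi> i a)"
  proof (rule joint_maps[OF FI])
    fix T \<gamma>
    assume 1: "(T, \<gamma>) \<in> gen_maps V A"
      and 2: "\<And>R f. (R, f) \<in> (\<lambda>i. (S i, \<phi> i)) ` I \<Longrightarrow> \<exists>p\<in>sg_hom T R. \<forall>a\<in>A. p (\<gamma> a) = f a"
    show ?thesis
      by (rule exI[of _ T], rule exI[of _ \<gamma>], intro conjI ballI 1, rule 2, rule imageI)
  qed
  then obtain T \<gamma> where T: "(T, \<gamma>) \<in> gen_maps V A"
    "\<forall>i\<in>I. \<exists>p\<in>sg_hom T (S i). \<forall>a\<in>A. p (\<gamma> a) = \<phi> i a" by (elim exE conjE)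
  note Td = gen_mapsD(4,2)[OF T(1)]
  have sepT: "cnt i u mod q = cnt i v mod q"
    if i: "i \<in> I" and uv: "u \<in> Z" "v \<in> Z" and eq: "word_value T \<gamma> u = word_value T \<gamma> v" for i u v
  proof (rule sep[OF i uv])
    obtain p where p: "p \<in> sg_hom T (S i)" "\<forall>a\<in>A. p (\<gamma> a) = \<phi> i a" using bspec[OF T(2) i] by (rule bexE)
    have val: "p (word_value T \<gamma> w) = word_value (S i) (\<phi> i) w" if "w \<in> words A" for w
      by (rule word_value_hom[OF p(1) Td that]) (use p(2) in blast)
    show "word_value (S i) (\<phi> i) u = word_value (S i) (\<phi> i) v"
      unfolding val[OF Z_words[OF uv(1)], symmetric] val[OF Z_words[OF uv(2)], symmetric] eq ..
  qed
  have W0: "W 0 = Z" by (simp add: W_def)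
  have "\<exists>v\<in>Z. x (T, \<gamma>) = word_value T \<gamma> v" if "x \<in> limgrp" for x
    using limsD[OF limgrpD(2)[OF that T(1)], of 0] unfolding W0 .
  then have "\<forall>x\<in>limgrp. \<exists>v. v \<in> Z \<and> x (T, \<gamma>) = word_value T \<gamma> v" by blast
  from bchoice[OF this] obtain vv where "\<forall>x\<in>limgrp. vv x \<in> Z \<and> x (T, \<gamma>) = word_value T \<gamma> (vv x)" ..
  then have vv: "\<And>x. x \<in> limgrp \<Longrightarrow> vv x \<in> Z" "\<And>x. x \<in> limgrp \<Longrightarrow> x (T, \<gamma>) = word_value T \<gamma> (vv x)"
    by simp_all
  \<comment> \<open>Elements that have at this coordinate a representing word whose counts are one
    common nonnegative combination of the counts of the generators. They form a subsemigroup
    containing the generators.\<close>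
  define Y where "Y = {y \<in> limgrp. \<exists>v\<in>Z. y (T, \<gamma>) = word_value T \<gamma> v \<and>
     (\<exists>m. \<forall>i\<in>I. cnt i v = (\<Sum>x\<in>G. m x * cnt i (vv x)))}"
  have Y: "sg_generated (free_pro V A) G \<subseteq> Y"
  proof (rule sg_generated_least)
    show "G \<subseteq> Y"
    proof
      fix x assume x: "x \<in> G"
      have "\<forall>i\<in>I. cnt i (vv x) = (\<Sum>y\<in>G. (if y = x then 1 else 0) * cnt i (vv y))"
        using G(2) x by (simp add: if_distrib[of "\<lambda>c. c * _"] sum.delta cong: if_cong)
      then have "\<exists>m. \<forall>i\<in>I. cnt i (vv x) = (\<Sum>y\<in>G. m y * cnt i (vv y))"
        by (rule exI[of _ "\<lambda>y. if y = x then 1 else 0"])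
      then show "x \<in> Y" unfolding Y_def using vv[of x] G(1) x by blast
    qed
    show "Y \<subseteq> carrier (free_pro V A)" unfolding Y_def using limgrpD(1) by blast
    fix x y assume "x \<in> Y" "y \<in> Y"
    then obtain u v m m' where x: "x \<in> limgrp" "u \<in> Z" "x (T, \<gamma>) = word_value T \<gamma> u"
        "\<forall>i\<in>I. cnt i u = (\<Sum>x\<in>G. m x * cnt i (vv x))"
      and y: "y \<in> limgrp" "v \<in> Z" "y (T, \<gamma>) = word_value T \<gamma> v"
        "\<forall>i\<in>I. cnt i v = (\<Sum>x\<in>G. m' x * cnt i (vv x))"
      unfolding Y_def by blast
    have "sg_mult (free_pro V A) x y (T, \<gamma>) = word_value T \<gamma> (u @ v)"
      unfolding free_pro_mult[OF T(1)] x(3) y(3)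
      by (rule word_value_append[OF Td Z_words[OF x(2)] Z_words[OF y(2)], symmetric])
    moreover have "\<forall>i\<in>I. cnt i (u @ v) = (\<Sum>x\<in>G. (m x + m' x) * cnt i (vv x))"
      using add[OF _ x(2) y(2)] x(4) y(4) by (simp add: sum.distrib distrib_right)
    then have "\<exists>m. \<forall>i\<in>I. cnt i (u @ v) = (\<Sum>x\<in>G. m x * cnt i (vv x))"
      by (rule exI[of _ "\<lambda>x. m x + m' x"])
    ultimately show "sg_mult (free_pro V A) x y \<in> Y"
      unfolding Y_def using limgrp_mult[OF x(1) y(1)] Z_append[OF x(2) y(2)] by blast
  qed
  \<comment> \<open>Modulo \<open>q\<close>, coefficient vectors indexed by the generators map onto
    all vectors indexed by \<open>I\<close>; comparing cardinalities bounds the number of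
    generators.\<close>
  define M where "M = (\<lambda>m. \<lambda>i\<in>I. (\<Sum>x\<in>G. m x * cnt i (vv x)) mod q)"
  have "(I \<rightarrow>\<^sub>E {..<q}) \<subseteq> M ` (G \<rightarrow>\<^sub>E {..<q})"
  proof
    fix t assume t: "t \<in> I \<rightarrow>\<^sub>E {..<q}"
    obtain u where u: "u \<in> Z" "\<forall>i\<in>I. cnt i u mod q = t i mod q" using real_all by blast
    \<comment> \<open>The limit of iterates has the same counts modulo \<open>q\<close> as
      \<open>u\<close>, by invariance under \<open>h\<close>.\<close>
    have hu: "hlim u \<in> limgrp" by (rule hlim_limgrp[OF Z_words[OF u(1)] h_Z[OF u(1)]])
    obtain J where "\<forall>j\<ge>J. word_value T \<gamma> ((h ^^ fact j) u) = hlim u (T, \<gamma>)"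
      using hlim_ex(2)[OF Z_words[OF u(1)] T(1)] by blast
    then have hJ: "hlim u (T, \<gamma>) = word_value T \<gamma> ((h ^^ fact J) u)" by simp
    obtain y where y: "y \<in> sg_generated (free_pro V A) G" "hlim u (T, \<gamma>) = y (T, \<gamma>)"
      using G(4)[OF hu T(1)] by blast
    have yv: "word_value T \<gamma> ((h ^^ fact J) u) = y (T, \<gamma>)" using hJ y(2) by simp
    have "y \<in> Y" using Y y(1) by blast
    then have "\<exists>v\<in>Z. y (T, \<gamma>) = word_value T \<gamma> v \<and> (\<exists>m. \<forall>i\<in>I. cnt i v = (\<Sum>x\<in>G. m x * cnt i (vv x)))"
      unfolding Y_def by blast
    then obtain v m where v: "v \<in> Z" "word_value T \<gamma> ((h ^^ fact J) u) = word_value T \<gamma> v"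
        "\<forall>i\<in>I. cnt i v = (\<Sum>x\<in>G. m x * cnt i (vv x))"
      unfolding yv by blast
    define m' where "m' = (\<lambda>x\<in>G. m x mod q)"
    have "M m' = t"
    proof (rule extensionalityI[of _ I])
      show "M m' \<in> extensional I" by (simp add: M_def)
      show "t \<in> extensional I" using t by (simp add: PiE_def)
      fix i assume i: "i \<in> I"
      have "(\<Sum>x\<in>G. m' x * cnt i (vv x)) mod q = (\<Sum>x\<in>G. m x * cnt i (vv x)) mod q"
        by (subst (1 2) mod_sum_eq[symmetric], rule arg_cong[of _ _ "\<lambda>x. x mod q"], rule sum.cong)
          (simp_all add: m'_def mod_simps)
      also have "\<dots> = cnt i v mod q" using v(3) i by simp
      also have "\<dots> = cnt i u mod q"
        using sepT[OF i hk_Z[OF u(1)] v(1) v(2)] hk_inv[OF i u(1)] by simp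
      also have "\<dots> = t i" using u(2) i t by (auto simp: PiE_def Pi_def)
      finally show "M m' i = t i" using i by (simp add: M_def)
    qed
    moreover have "m' \<in> G \<rightarrow>\<^sub>E {..<q}" using q by (auto simp: m'_def)
    ultimately show "t \<in> M ` (G \<rightarrow>\<^sub>E {..<q})" by blast
  qed
  then have "card (I \<rightarrow>\<^sub>E {..<q}) \<le> card (G \<rightarrow>\<^sub>E {..<q})"
    by (rule surj_card_le[rotated]) (simp add: finite_PiE G(2))
  then have "q ^ card I \<le> q ^ card G" using I G(2) by (simp add: card_PiE)
  then have "card I \<le> card G" using q power_le_imp_le_exp[of q "card I" "card G"] by simp
  then show ?thesis using G(3) by simp
qed

end

subsection \<open>Cyclic orbits\<close>

lemma funpow_orbit:
  assumes "k \<ge> 1" "(F ^^ k) x = x"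
  obtains q :: nat where "q \<ge> 1" "(F ^^ q) x = x" "\<And>i j. (F ^^ i) x = (F ^^ j) x \<Longrightarrow> i mod q = j mod q"
proof -
  define q where "q = (LEAST q. q \<ge> 1 \<and> (F ^^ q) x = x)"
  have q: "q \<ge> 1" "(F ^^ q) x = x"
    using LeastI[of "\<lambda>q. q \<ge> 1 \<and> (F ^^ q) x = x" k] assms by (simp_all add: q_def)
  have least: "\<not> (F ^^ d) x = x" if "d \<ge> 1" "d < q" for d
    using not_less_Least[of d "\<lambda>q. q \<ge> 1 \<and> (F ^^ q) x = x"] that by (simp add: q_def)
  have less: False if ij: "i < j" "j < q" "(F ^^ i) x = (F ^^ j) x" for i j
  proof -
    have "(F ^^ (q - j + i)) x = (F ^^ (q - j)) ((F ^^ j) x)" by (simp add: funpow_add ij(3))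
    also have "\<dots> = (F ^^ (q - j + j)) x" by (simp add: funpow_add)
    also have "\<dots> = x" using ij q by simp
    finally have "(F ^^ (q - j + i)) x = x" .
    moreover have "q - j + i \<ge> 1" "q - j + i < q" using ij(1,2) by linarith+
    ultimately show False using least by blast
  qed
  have "i mod q = j mod q" if ij: "(F ^^ i) x = (F ^^ j) x" for i j
  proof -
    have "(F ^^ (i mod q)) x = (F ^^ (j mod q)) x" using ij funpow_mod_eq[OF q(2)] by metis
    moreover have "i mod q < q" "j mod q < q" using q(1) by simp_all
    ultimately show ?thesis using less[of "i mod q" "j mod q"] less[of "j mod q" "i mod q"] by force
  qed
  then show ?thesis using that q by blast
qed

lemma funpow_mult_spow:
  assumes "sgroup_axioms S" "x \<in> carrier S" "y \<in> carrier S"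
  shows "(sg_mult S x ^^ Suc k) y = sg_mult S (spow S x k) y"
proof (induction k)
  case (Suc k)
  have "(sg_mult S x ^^ Suc (Suc k)) y = sg_mult S x (sg_mult S (spow S x k) y)"
    using Suc by simp
  also have "\<dots> = sg_mult S (spow S x (Suc k)) y"
    using sgroup_assoc[OF assms(1,2) spow_closed[OF assms(1,2)] assms(3)] by (simp add: spow_Suc)
  finally show ?case .
qed simp

text \<open>The element efe lies in eSe, and by simplicity its idempotent power is \<open>e\<close>
  itself. Hence left multiplication by ef moves \<open>e\<close> along a cycle. The cycle is longer
  than 1, as \<open>ef e = e\<close> would make ef idempotent.\<close>

lemma simple_nonorthodox_orbit:
  assumes S: "sgroup_axioms S" "finite (carrier S)" and simple: "simple_sgrp S" and no: "\<not> orthodox S"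
  obtains e f q where "e \<in> carrier S" "sg_mult S e e = e" "f \<in> carrier S" "sg_mult S f f = f" "q \<ge> 2"
    "(sg_mult S (sg_mult S e f) ^^ q) e = e"
    "\<And>i j. (sg_mult S (sg_mult S e f) ^^ i) e = (sg_mult S (sg_mult S e f) ^^ j) e \<Longrightarrow> i mod q = j mod q"
proof -
  let ?m = "sg_mult S"
  note cl = sgroup_closed[OF S(1)] and as = sgroup_assoc[OF S(1)]
  obtain e f where ef: "e \<in> idempotents S" "f \<in> idempotents S" "?m e f \<notin> idempotents S"
    using no unfolding orthodox_def by blast
  have e: "e \<in> carrier S" "?m e e = e" and f: "f \<in> carrier S" "?m f f = f"
    using ef by (simp_all add: idempotents_def)
  define g where "g = ?m e f"
  have g: "g \<in> carrier S" using e f cl by (simp add: g_def)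
  define v where "v = ?m g e"
  have v: "v \<in> carrier S" using e g cl by (simp add: v_def)
  have ve: "?m v e = v" using as[OF g e(1) e(1)] e by (simp add: v_def)
  have eg: "?m e g = g" using as[OF e(1) e(1) f(1)] e by (simp add: g_def)
  have ev: "?m e v = v" using as[OF e(1) g e(1)] eg by (simp add: v_def)
  obtain k where k: "?m (spow S v k) (spow S v k) = spow S v k" using spow_idempotent[OF S v] by blast
  define i where "i = spow S v k"
  have i: "i \<in> carrier S" "?m i i = i" using spow_closed[OF S(1) v] k by (simp_all add: i_def)
  have ei: "?m e i = i"
    unfolding i_def using ev as[OF e(1) v spow_closed[OF S(1) v], symmetric] by (cases k) (simp_all add: spow_Suc)
  have ie: "?m i e = i"
  proof (cases k)
    case 0
    then show ?thesis using ve by (simp add: i_def)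
  next
    case (Suc j)
    then have "i = ?m (spow S v j) v" using spow_mult[OF S(1) v, of j 0] by (simp add: i_def)
    then show ?thesis using as[OF spow_closed[OF S(1) v] v e(1)] ve by simp
  qed
  have "green_J S e i" using simple e(1) i(1) by (simp add: simple_sgrp_def)
  then have "e \<in> principal_ideal S i" using green_J_iff[OF S(1)] by blast
  then obtain p r where pr: "p \<in> carrier S" "r \<in> carrier S" "e = ?m (?m p i) r"
    using principal_ideal_idempotentE[OF S(1) _ , of e i] i by (auto simp: idempotents_def)
  have "i = e"
  proof (rule finite_idempotent_cancel[OF S e i ie ei cl[OF pr(1) i(1)] _ pr(2)])
    show "?m (?m p i) e = ?m p i" using as[OF pr(1) i(1) e(1)] ie by simp
    show "e = ?m (?m (?m p i) i) r" unfolding as[OF pr(1) i(1) i(1)] i(2) by (rule pr(3))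
  qed
  have gv: "?m (spow S g j) e = spow S v j" for j
  proof (induction j)
    case (Suc j)
    have ej: "?m e (spow S v j) = spow S v j"
      using ev as[OF e(1) v spow_closed[OF S(1) v], symmetric] by (cases j) (simp_all add: spow_Suc)
    have "?m (spow S g (Suc j)) e = ?m g (?m (spow S g j) e)"
      unfolding spow_Suc by (rule as[OF g spow_closed[OF S(1) g] e(1)])
    also have "\<dots> = ?m g (?m e (spow S v j))" unfolding Suc ej ..
    also have "\<dots> = ?m v (spow S v j)"
      unfolding v_def by (rule as[OF g e(1) spow_closed[OF S(1) v[unfolded v_def]], symmetric])
    finally show ?case unfolding spow_Suc .
  qed (simp add: v_def)
  have per: "(?m g ^^ Suc k) e = e" and one: "Suc k \<ge> 1"
    using funpow_mult_spow[OF S(1) g e(1), of k] gv[of k] \<open>i = e\<close> by (simp_all add: i_def)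
  obtain q where q: "q \<ge> 1" "(?m g ^^ q) e = e" "\<And>i j. (?m g ^^ i) e = (?m g ^^ j) e \<Longrightarrow> i mod q = j mod q"
    using funpow_orbit[OF one per] by metis
  have "q \<noteq> 1"
  proof
    assume "q = 1"
    then have ge: "?m g e = e" using q(2) by simp
    have "?m g g = ?m (?m g e) f" using as[OF g e(1) f(1)] by (simp add: g_def)
    then have "?m g g = g" using ge by (simp add: g_def)
    then show False using ef(3) g by (simp add: g_def idempotents_def)
  qed
  then have "q \<ge> 2" using q(1) by simp
  then show ?thesis using that[OF e f _ q(2)[unfolded g_def] q(3)[unfolded g_def]] by simp
qed

text \<open>Any element other than the identity serves; the orbit of the identity under
  multiplication by it has length at least 2.\<close>

lemma group_orbit:
  assumes S: "sgroup_axioms S" "finite (carrier S)" and G: "is_group S" and c: "card (carrier S) > 1"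
  obtains e x q where "e \<in> carrier S" "x \<in> carrier S" "\<And>y. y \<in> carrier S \<Longrightarrow> sg_mult S e y = y"
    "sg_mult S x e = x" "q \<ge> 2" "\<And>i j. (sg_mult S x ^^ i) e = (sg_mult S x ^^ j) e \<Longrightarrow> i mod q = j mod q"
proof -
  have "subgroup_of (carrier S) S" using G by (simp add: subgroup_of_def)
  then obtain e where e: "e \<in> idempotents S" "carrier S \<subseteq> units_at S e" using subgroup_ofE by metis
  have ec: "e \<in> carrier S" using e(1) by (simp add: idempotents_def)
  have unit: "sg_mult S e y = y" "sg_mult S y e = y" if "y \<in> carrier S" for y
    using subsetD[OF e(2) that] by (simp_all add: units_at_def)
  have "carrier S \<noteq> {e}" using c by auto
  then obtain x where x: "x \<in> carrier S" "x \<noteq> e" using ec by blast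
  obtain k where k: "sg_mult S (spow S x k) (spow S x k) = spow S x k" using spow_idempotent[OF S x(1)] by blast
  have sc: "spow S x k \<in> carrier S" by (rule spow_closed[OF S(1) x(1)])
  have "spow S x k = e" by (rule idempotent_in_units_at[OF S(1) subsetD[OF e(2) sc] k])
  then have per: "(sg_mult S x ^^ Suc k) e = e" and one: "Suc k \<ge> 1"
    using funpow_mult_spow[OF S(1) x(1) ec, of k] unit(1)[OF ec] by simp_all
  obtain q where q: "q \<ge> 1" "(sg_mult S x ^^ q) e = e"
     "\<And>i j. (sg_mult S x ^^ i) e = (sg_mult S x ^^ j) e \<Longrightarrow> i mod q = j mod q"
    using funpow_orbit[OF one per] by metis
  have "q \<noteq> 1" using q(2) unit(2)[OF x(1)] x(2) by auto
  then have "q \<ge> 2" using q(1) by simp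
  then show ?thesis using that[OF ec x(1) unit(1) unit(2)[OF x(1)] _ q(3)] by blast
qed

subsection \<open>Counting letters and pairs of letters\<close>

fun pair_count :: "'a \<Rightarrow> 'a \<Rightarrow> 'a list \<Rightarrow> nat" where
  "pair_count a b (x # y # w) = (if x = a \<and> y = b then 1 else 0) + pair_count a b (y # w)"
| "pair_count a b _ = 0"

lemma pair_count_Cons:
  "w \<noteq> [] \<Longrightarrow> pair_count a b (x # w) = (if x = a \<and> hd w = b then 1 else 0) + pair_count a b w"
  by (cases w) simp_all

lemma pair_count_append:
  "u \<noteq> [] \<Longrightarrow> v \<noteq> [] \<Longrightarrow>
     pair_count a b (u @ v) = pair_count a b u + (if last u = a \<and> hd v = b then 1 else 0) + pair_count a b v"
proof (induction u)
  case (Cons x u)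
  show ?case
  proof (cases "u = []")
    case True
    then show ?thesis using Cons.prems by (simp add: pair_count_Cons)
  next
    case False
    then show ?thesis using Cons by (simp add: pair_count_Cons)
  qed
qed simp

lemma count_list_replicate: "count_list (replicate k a) b = (if a = b then k else 0)"
  by (induction k) auto

lemma count_list_power: "count_list (concat (replicate k u)) a = k * count_list u a"
  by (induction k) simp_all

context marked_limit
begin

lemma rank_letters:
  assumes q: "q \<ge> 2" and f0: "\<And>c. c < n \<Longrightarrow> first c = 0"
    and r0: "\<And>c. c < n \<Longrightarrow> rest c \<noteq> [] \<and> last (rest c) = 0"
    and cnt: "\<And>c d. c < n \<Longrightarrow> d < n \<Longrightarrow> count_list (\<tau> c) d mod q = (if d = c then 1 else 0)"
    and S: "S \<in> V" "e \<in> carrier S" "x \<in> carrier S" "\<And>y. y \<in> carrier S \<Longrightarrow> sg_mult S e y = y" "sg_mult S x e = x"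
    and orb: "\<And>i j. (sg_mult S x ^^ i) e = (sg_mult S x ^^ j) e \<Longrightarrow> i mod q = j mod q"
  shows "rank_bound_optimal V n n"
proof (rule rank_optimalI)
  show "n \<ge> 1" using n2 by simp
  show "topgen A limgrp n" by (rule topgen_letters[OF f0 r0])
  note Sg = V_sgroup[OF S(1)]
  fix k assume k: "topgen A limgrp k"
  define \<phi> where "\<phi> = (\<lambda>d. \<lambda>c\<in>A. if c = d then x else e)"
  have F: "(S, \<phi> d) \<in> gen_maps V A" for d
    by (rule gen_mapsI[OF S(1)]) (use S(2,3) in \<open>auto simp: \<phi>_def\<close>)
  have Mc: "(sg_mult S x ^^ j) e \<in> carrier S" for j
    by (induction j) (simp_all add: S(2,3) sgroup_closed[OF Sg])
  have val: "word_value S (\<phi> d) w = (sg_mult S x ^^ count_list w d) e" if "w \<in> words A" for w d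
    using that
  proof (induction w)
    case (Cons c w)
    then have c: "\<phi> d c = (if c = d then x else e)" by (simp add: \<phi>_def words_Cons)
    show ?case
    proof (cases "w = []")
      case True
      then show ?thesis using c S(5) by simp
    next
      case False
      then have "word_value S (\<phi> d) w = (sg_mult S x ^^ count_list w d) e"
        using Cons by (simp add: words_Cons words_def)
      then show ?thesis using False c S(4)[OF Mc] by (simp add: word_value_Cons)
    qed
  qed (simp add: words_def)
  have "card A \<le> k"
  proof (rule topgen_lower[where q = q and S = "\<lambda>_. S" and \<phi> = \<phi> and cnt = "\<lambda>d w. count_list w d", OF q fin_A F _ _ _ _ k])
    show "count_list (u @ v) d = count_list u d + count_list v d" for u v and d :: nat
      by simp
    show "count_list (h u) d mod q = count_list u d mod q" if d: "d \<in> A" and u: "u \<in> Z" for d u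
    proof -
      have "count_list (h w) d mod q = count_list w d mod q" if "set w \<subseteq> A" for w
        using that
      proof (induction w)
        case (Cons c w)
        have "count_list (h (c # w)) d mod q = (count_list (\<tau> c) d mod q + count_list (h w) d mod q) mod q"
          by (simp add: mod_add_eq)
        also have "\<dots> = ((if c = d then 1 else 0) + count_list w d mod q) mod q"
          using cnt[of c d] d Cons by simp
        also have "\<dots> = count_list (c # w) d mod q" by (simp add: mod_simps)
        finally show ?case .
      qed simp
      then show ?thesis using Z_words[OF u] by (simp add: words_def)
    qed
    show "count_list u d mod q = count_list v d mod q"
      if "u \<in> Z" "v \<in> Z" "word_value S (\<phi> d) u = word_value S (\<phi> d) v" for d u v
      by (rule orb) (use val Z_words that in metis)
    show "\<exists>u\<in>Z. \<forall>j\<in>A. count_list u j mod q = (if j = i then 1 else 0)" if i: "i \<in> A" for i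
    proof (cases "i = 0")
      case True
      then show ?thesis using q by (intro bexI[OF _ Z_0]) simp
    next
      case False
      \<comment> \<open>The zeros number 2 \<open>q\<close> and vanish modulo \<open>q\<close>; they
        let the word start and end with 0 while \<open>i\<close> is counted once.\<close>
      let ?u = "replicate q 0 @ [i] @ replicate q 0"
      have "?u \<in> Z" using i q n2 False by (cases q) (auto simp: Z_def words_def)
      moreover have "\<forall>j\<in>A. count_list ?u j mod q = (if j = i then 1 else 0)"
        using q False by (simp add: count_list_replicate)
      ultimately show ?thesis by blast
    qed
  qed
  then show "n \<le> k" by simp
qed

text \<open>The image of a letter has a left part that answers to its predecessor and a right part
  that prepares for its successor. Between neighbours they multiply to ef at the pair (a, b) and to
  an element that acts as the identity on the orbit at any other pair.\<close>

lemma rank_pairs: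
  assumes q: "q \<ge> 2" and ff: "\<And>c. c < n \<Longrightarrow> first c = c"
    and rr: "\<And>c. c < n \<Longrightarrow> rest c \<noteq> [] \<and> last (rest c) = c"
    and pc: "\<And>a b c. c < n \<Longrightarrow> pair_count a b (\<tau> c) mod q = 0"
    and S: "S \<in> V" "e \<in> carrier S" "sg_mult S e e = e" "f \<in> carrier S" "sg_mult S f f = f"
    and per: "(sg_mult S (sg_mult S e f) ^^ q) e = e"
    and orb: "\<And>i j. (sg_mult S (sg_mult S e f) ^^ i) e = (sg_mult S (sg_mult S e f) ^^ j) e \<Longrightarrow> i mod q = j mod q"
  shows "rank_bound_optimal V n (n\<^sup>2 - n + 1)"
proof (rule rank_optimalI)
  show "n\<^sup>2 - n + 1 \<ge> 1" by simp
  show "topgen A limgrp (n\<^sup>2 - n + 1)" by (rule topgen_loops)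
  note Sg = V_sgroup[OF S(1)]
  note as = sgroup_assoc[OF Sg] and cl = sgroup_closed[OF Sg]
  let ?m = "sg_mult S"
  fix k assume k: "topgen A limgrp k"
  define g where "g = ?m e f"
  define M where "M j = (?m g ^^ j) e" for j
  \<comment> \<open>This is the \<open>q\<close>-th power of ef. It fixes every point
    \<open>M j\<close> of the orbit, and it absorbs \<open>f\<close> on the right because it ends in
    \<open>f\<close>.\<close>
  define u where "u = spow S g (q - 1)"
  have gc: "g \<in> carrier S" using S cl by (simp add: g_def)
  have uc: "u \<in> carrier S" unfolding u_def by (rule spow_closed[OF Sg gc])
  have Mc: "M j \<in> carrier S" for j unfolding M_def by (induction j) (simp_all add: S(2) gc cl)
  have gM: "?m g (M j) = M (Suc j)" for j by (simp add: M_def)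
  have eM: "?m e (M j) = M j" for j
  proof (cases j)
    case (Suc i)
    have "?m e g = g" using as[OF S(2,2,4)] S(3) by (simp add: g_def)
    then have "?m e (?m g (M i)) = ?m g (M i)" using as[OF S(2) gc Mc[of i]] by simp
    then show ?thesis using gM Suc by simp
  qed (simp add: M_def S(3))
  have uM: "?m u (M j) = M j" for j
  proof -
    have "?m u (M j) = (?m g ^^ q) (M j)"
      using funpow_mult_spow[OF Sg gc Mc, of "q - 1" j] q by (simp add: u_def)
    also have "\<dots> = (?m g ^^ (q + j)) e" by (simp add: M_def funpow_add)
    also have "\<dots> = (?m g ^^ j) ((?m g ^^ q) e)" by (subst add.commute) (simp add: funpow_add)
    also have "\<dots> = M j" using per by (simp add: M_def g_def)
    finally show ?thesis .
  qed
  have uf: "?m u f = u"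
  proof -
    have "?m (spow S g j) f = spow S g j" for j
    proof (induction j)
      case (Suc j)
      then show ?case using as[OF gc spow_closed[OF Sg gc] S(4)] by (simp add: spow_Suc)
    qed (use as[OF S(2,4,4)] S(5) in \<open>simp add: g_def\<close>)
    then show ?thesis by (simp add: u_def)
  qed
  \<comment> \<open>A letter offers \<open>f\<close> to its predecessor if it is b, and
    \<open>e\<close> to its successor if it is a. In place of a missing partner stands
    \<open>u\<close>, so only the combination ef advances the orbit: the products e u, u f and u u
    all fix it.\<close>
  define r where "r = (\<lambda>y. if y then f else u)"
  define l where "l = (\<lambda>y. if y then e else u)"
  have rc: "r y \<in> carrier S" and lc: "l y \<in> carrier S" for y using S uc by (simp_all add: r_def l_def)
  have lM: "?m (l y) (M j) = M j" for y j using eM uM by (simp add: l_def)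
  have ulM: "?m u (?m (r y) (M j)) = M j" for y j
    using uM as[OF uc S(4) Mc] uf by (simp add: r_def)
  have lrM: "?m (l y) (?m (r z) (M j)) = M ((if y \<and> z then 1 else 0) + j)" for y z j
  proof -
    have "?m e (?m f (M j)) = M (Suc j)" using as[OF S(2,4) Mc] gM by (simp add: g_def)
    then show ?thesis using ulM[of z j] eM uM by (simp add: r_def l_def)
  qed
  define \<phi> where "\<phi> = (\<lambda>(a, b). \<lambda>c\<in>A. ?m (r (c = b)) (l (c = a)))"
  have F: "(S, \<phi> i) \<in> gen_maps V A" for i
    by (rule gen_mapsI[OF S(1)]) (use rc lc cl in \<open>auto simp: \<phi>_def split: prod.split\<close>)
  note d = gen_mapsD(4,2)[OF F]
  \<comment> \<open>The factor \<open>e\<close> on the right supplies the starting point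
    \<open>M 0\<close> of the orbit and neutralises the unpaired right part of the last
    letter.\<close>
  have val: "?m (word_value S (\<phi> (a, b)) w) e = ?m (r (hd w = b)) (M (pair_count a b w))"
    if "w \<in> words A" for w a b
    using that
  proof (induction w)
    case (Cons c w)
    then have c: "\<phi> (a, b) c = ?m (r (c = b)) (l (c = a))" by (simp add: \<phi>_def words_Cons)
    have e0: "e = M 0" by (simp add: M_def)
    show ?case
    proof (cases "w = []")
      case True
      then show ?thesis using c as[OF rc lc S(2)] lM[of _ 0] e0 by simp
    next
      case False
      then have w: "w \<in> words A" using Cons.prems by (simp add: words_Cons words_def)
      have wc: "word_value S (\<phi> (a, b)) w \<in> carrier S" by (rule word_value_closed[OF d w])
      have "?m (word_value S (\<phi> (a, b)) (c # w)) e = ?m (r (c = b)) (?m (l (c = a)) (?m (word_value S (\<phi> (a, b)) w) e))"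
        unfolding word_value_Cons[OF False] c using rc lc wc S(2) by (simp add: as cl)
      also have "\<dots> = ?m (r (c = b)) (M (pair_count a b (c # w)))"
        unfolding Cons.IH[OF w] lrM pair_count_Cons[OF False] ..
      finally show ?thesis by simp
    qed
  qed (simp add: words_def)
  \<comment> \<open>The arcs from nonzero a to 0 are omitted: in a closed walk their multiplicities
    follow from the others by comparing entering and leaving arcs at a.\<close>
  define I where "I = insert (0, 0) ({..<n} \<times> {1..<n})"
  have cardI: "card I = n\<^sup>2 - n + 1"
    using n2 by (simp add: I_def power2_eq_square diff_mult_distrib2)
  \<comment> \<open>The appended 0 counts the passage to the next word from 0 to 0, which makes the
    count additive on \<open>Z\<close>.\<close>
  define cnt where "cnt = (\<lambda>(a, b) w. pair_count a b (w @ [0 :: nat]))"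
  have add: "cnt i (v @ w) = cnt i v + cnt i w" if "v \<in> Z" "w \<in> Z" for i v w
  proof -
    have "v \<noteq> []" "w \<noteq> []" "hd w = 0" using that by (auto simp: Z_def words_def)
    then show ?thesis by (cases i) (simp add: cnt_def pair_count_append)
  qed
  have "card I \<le> k"
  proof (rule topgen_lower[where q = q and S = "\<lambda>_. S" and \<phi> = \<phi> and cnt = cnt, OF q _ F add _ _ _ k])
    show "finite I" by (simp add: I_def)
    show "cnt i (h w) mod q = cnt i w mod q" if w: "w \<in> Z" for i w
    proof -
      obtain a b where i: "i = (a, b)" by (cases i)
      have hd\<tau>: "hd (\<tau> c) = c" "last (\<tau> c) = c" "\<tau> c \<noteq> []" if "c < n" for c
        using ff[OF that] rr[OF that] by (simp_all add: \<tau>_def)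
      have hh: "hd (h v) = hd v" "last (h v) = last v" if "v \<in> words A" for v
      proof -
        show "hd (h v) = hd v" using that hd\<tau> by (cases v) (auto simp: words_def)
        show "last (h v) = last v" using that hd\<tau> by (cases v rule: rev_exhaust) (auto simp: words_def)
      qed
      have "pair_count a b (h v) mod q = pair_count a b v mod q" if "v \<in> words A" for v
        using that
      proof (induction v)
        case (Cons c v)
        then have c: "c < n" by (simp add: words_Cons)
        show ?case
        proof (cases "v = []")
          case True
          then show ?thesis using pc[OF c] by simp
        next
          case False
          then have v: "v \<in> words A" using Cons.prems by (simp add: words_Cons words_def)
          \<comment> \<open>Since \<open>\<tau> c\<close> begins and ends with c, the pairs across
            block boundaries are the pairs of the original word; the interior counts vanish modulo
            \<open>q\<close>.\<close>
          have "pair_count a b (h (c # v)) = pair_count a b (\<tau> c) + ((if c = a \<and> hd v = b then 1 else 0) + pair_count a b (h v))"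
            using pair_count_append[OF hd\<tau>(3)[OF c] words_nonempty[OF h_words[OF v]], of a b] hd\<tau>(2)[OF c] hh(1)[OF v] by simp
          also have "\<dots> mod q = ((if c = a \<and> hd v = b then 1 else 0) + pair_count a b (h v)) mod q"
            by (subst mod_add_left_eq[symmetric]) (simp only: pc[OF c] add_0)
          also have "\<dots> = ((if c = a \<and> hd v = b then 1 else 0) + pair_count a b v) mod q"
            by (rule mod_add_cong[OF refl Cons.IH[OF v]])
          finally show ?thesis by (simp only: pair_count_Cons[OF False])
        qed
      qed (simp add: words_def)
      note hp = this[OF Z_words[OF w]]
      have w0: "w \<noteq> []" "h w \<noteq> []" using words_nonempty[OF Z_words[OF w]] words_nonempty[OF h_words[OF Z_words[OF w]]] by simp_all
      show ?thesis
        unfolding i cnt_def prod.case pair_count_append[OF w0(1) list.distinct(2)] pair_count_append[OF w0(2) list.distinct(2)]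
          hh(2)[OF Z_words[OF w]]
        by (intro mod_add_cong hp refl)
    qed
    show "cnt i v mod q = cnt i w mod q"
      if v: "v \<in> Z" and w: "w \<in> Z" and eq: "word_value S (\<phi> i) v = word_value S (\<phi> i) w" for i v w
    proof -
      obtain a b where i: "i = (a, b)" by (cases i)
      have h0: "hd v = 0" "hd w = 0" "last v = 0" "last w = 0" "v \<noteq> []" "w \<noteq> []" using v w by (auto simp: Z_def words_def)
      have "?m (r (0 = b)) (M (pair_count a b v)) = ?m (r (0 = b)) (M (pair_count a b w))"
        using val[OF Z_words[OF v], of a b] val[OF Z_words[OF w], of a b] eq h0 i by simp
      \<comment> \<open>Left multiplication by \<open>u\<close> removes the factor contributed by
        the first letter 0, whichever value it has.\<close>
      then have "M (pair_count a b v) = M (pair_count a b w)" using ulM by metis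
      then have "pair_count a b v mod q = pair_count a b w mod q" unfolding M_def g_def by (rule orb)
      then show ?thesis
        unfolding i cnt_def prod.case pair_count_append[OF h0(5) list.distinct(2)] pair_count_append[OF h0(6) list.distinct(2)] h0
        by (intro mod_add_cong refl)
    qed
    show "\<exists>u\<in>Z. \<forall>j\<in>I. cnt j u mod q = (if j = i then 1 else 0)" if i: "i \<in> I" for i
    proof -
      obtain a b where ab: "i = (a, b)" by (cases i)
      have n0: "0 < n" using n2 by simp
      have comb: "\<exists>w\<in>Z. \<forall>i\<in>I. cnt i w = cnt i v + m * cnt i z" if "v \<in> Z" "z \<in> Z" for v z m
        by (rule Z_combine) (use add that in simp_all)
      have qq: "Suc (q - 1) = q" using q by simp
      consider "a = 0" "b = 0" | "a = 0" "b \<noteq> 0" "b < n" | "a \<noteq> 0" "b \<noteq> 0" "a < n" "b < n"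
        using i ab by (auto simp: I_def)
      then show ?thesis
      proof cases
        case 1
        have "\<forall>j\<in>I. cnt j [0] mod q = (if j = i then 1 else 0)"
          using q 1 by (auto simp: cnt_def I_def ab)
        then show ?thesis using Z_0 by blast
      next
        case 2
        have z: "[0, b, 0] \<in> Z" using 2 n0 by (simp add: Z_def words_Cons)
        \<comment> \<open>Closing 0 b 0 costs one pair 00; the \<open>q - 1\<close> further copies
          of 0 bring the number of these pairs to \<open>q\<close>.\<close>
        obtain w where w: "w \<in> Z" "\<forall>j\<in>I. cnt j w = cnt j [0, b, 0] + (q - 1) * cnt j [0]"
          using comb[OF z Z_0] by blast
        have "cnt j w mod q = (if j = i then 1 else 0)" if j: "j \<in> I" for j
        proof -
          have "cnt j [0, b, 0] + (q - 1) * cnt j [0] = (if j = i then 1 else 0) + q * (if j = (0, 0) then 1 else 0)"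
            using j 2 qq by (cases j) (auto simp: cnt_def I_def ab)
          then show ?thesis using w(2) j q by simp
        qed
        then show ?thesis using w(1) by blast
      next
        case 3
        have z: "[0, a, b, 0] \<in> Z" "[0, a, 0] \<in> Z" using 3 n0 by (simp_all add: Z_def words_Cons)
        \<comment> \<open>Modulo \<open>q\<close>, the \<open>q - 1\<close> copies of 0 a 0 cancel
          the pair 0a and the closing pair 00, while the arcs into 0 are not recorded.\<close>
        obtain w where w: "w \<in> Z" "\<forall>j\<in>I. cnt j w = cnt j [0, a, b, 0] + (q - 1) * cnt j [0, a, 0]"
          using comb[OF z] by blast
        have "cnt j w mod q = (if j = i then 1 else 0)" if j: "j \<in> I" for j
        proof -
          have "cnt j [0, a, b, 0] + (q - 1) * cnt j [0, a, 0] =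
             (if j = i then 1 else 0) + q * ((if j = (0, 0) then 1 else 0) + (if j = (0, a) then 1 else 0))"
            using j 3 qq by (cases j) (auto simp: cnt_def I_def ab)
          then show ?thesis using w(2) j q by simp
        qed
        then show ?thesis using w(1) by blast
      qed
    qed
  qed
  then show "n\<^sup>2 - n + 1 \<le> k" using cardI by simp
qed

end

subsection \<open>The witnesses for at least two letters\<close>

definition all_pairs :: "nat \<Rightarrow> nat list" where
  "all_pairs n = concat (map (\<lambda>a. concat (map (\<lambda>b. [a, b]) [0..<n])) [0..<n])"

lemma concat_map_split:
  assumes "x \<in> set xs"
  shows "\<exists>u v. concat (map f xs) = u @ f x @ v"
proof -
  obtain ys zs where "xs = ys @ x # zs" using split_list[OF assms] by blast
  then have "concat (map f xs) = concat (map f ys) @ f x @ concat (map f zs)" by simp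
  then show ?thesis by blast
qed

lemma all_pairs_split:
  assumes "a < n" "b < n"
  shows "\<exists>u v. all_pairs n = u @ [a, b] @ v"
proof -
  have a: "a \<in> set [0..<n]" and b: "b \<in> set [0..<n]" using assms by simp_all
  obtain u v where 1: "all_pairs n = u @ concat (map (\<lambda>b. [a, b]) [0..<n]) @ v"
    using concat_map_split[OF a, of "\<lambda>a. concat (map (\<lambda>b. [a, b]) [0..<n])"] unfolding all_pairs_def by blast
  obtain u' v' where 2: "concat (map (\<lambda>b. [a, b]) [0..<n]) = u' @ [a, b] @ v'"
    using concat_map_split[OF b, of "\<lambda>b. [a, b]"] by blast
  have "all_pairs n = (u @ u') @ [a, b] @ (v' @ v)" unfolding 1 2 by simp
  then show ?thesis by blast
qed

lemma set_all_pairs: "set (all_pairs n) \<subseteq> {..<n}"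
  by (auto simp: all_pairs_def)

lemma set_concat_replicate: "set (concat (replicate k u)) \<subseteq> set u"
  by (induction k) auto

lemma length_concat_replicate: "length (concat (replicate k u)) = k * length u"
  by (induction k) simp_all

context pv
begin

lemma rank_optimal_letters:
  assumes LSl: "LSl \<subseteq> V" and n: "n \<ge> 2" and S: "S \<in> V" "is_group S" "card (carrier S) > 1"
  shows "rank_bound_optimal V n n"
proof -
  obtain e x q where ex: "e \<in> carrier S" "x \<in> carrier S" "\<And>y. y \<in> carrier S \<Longrightarrow> sg_mult S e y = y"
    "sg_mult S x e = x" and q: "q \<ge> 2"
    and orb: "\<And>i j. (sg_mult S x ^^ i) e = (sg_mult S x ^^ j) e \<Longrightarrow> i mod q = j mod q"
    using group_orbit[OF V_sgroup[OF S(1)] V_finite[OF S(1)] S(2,3)] by metis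
  define E where "E = all_pairs n"
  \<comment> \<open>The \<open>q - 1\<close> letters 1 complete the marker to \<open>q\<close> of
    them, and \<open>E\<close>, repeated \<open>q\<close> times, contributes multiples of
    \<open>q\<close>. Only the single c survives modulo \<open>q\<close>; the final 0 makes the
    block end in 0.\<close>
  define rest where "rest = (\<lambda>c. replicate (q - 1) 1 @ concat (replicate q E) @ [c, 0 :: nat])"
  define g where "g = q - 1 + q * length E + 2"
  \<comment> \<open>Besides those in \<open>E\<close> and the displayed c, a block has
    \<open>N + 2\<close> zeros: the first letter, the run and the last letter. This number is made a
    multiple of \<open>q\<close>, large enough for \<open>g < N\<close>.\<close>
  define N where "N = q * (g + 3) - 2"
  have "2 * (g + 3) \<le> q * (g + 3)" using q by (rule mult_le_mono1)
  then have N: "g < N" "N + 2 = q * (g + 3)" by (simp_all add: N_def)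
  interpret M: marked_limit V n "\<lambda>_. 0" N rest g
  proof
    show "2 \<le> n" by (rule n)
    show "0 < n" using n by simp
    show "set (rest c) \<subseteq> {..<n}" if "c < n" for c
      using set_concat_replicate[of q E] set_all_pairs[of n] that n by (auto simp: rest_def E_def)
    show "length (rest c) = g" for c
      by (simp add: rest_def g_def length_concat_replicate)
    show "g < N" by (rule N(1))
    show "c = d" if "rest c = rest d" for c d using that by (simp add: rest_def)
    show "(0 :: nat) = 0" ..
    show "rest 0 \<noteq> []" "last (rest 0) = 0" by (simp_all add: rest_def)
    show "LSl \<subseteq> V" by (rule LSl)
    fix a b c assume ab: "a < n" "b < n"
    obtain u v where uv: "E = u @ [a, b] @ v" using all_pairs_split[OF ab] by (auto simp: E_def)
    have "concat (replicate q E) = E @ concat (replicate (q - 1) E)" using q by (cases q) simp_all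
    then have "0 # replicate N 0 @ [1] @ rest c =
      (0 # replicate N 0 @ [1] @ replicate (q - 1) 1 @ u) @ [a, b] @ (v @ concat (replicate (q - 1) E) @ [c, 0])"
      by (simp add: rest_def uv)
    then show "\<exists>u v. u \<noteq> [] \<and> v \<noteq> [] \<and> 0 # replicate N 0 @ [1] @ rest c = u @ [a, b] @ v"
      by blast
  qed
  show ?thesis
  proof (rule M.rank_letters[OF q _ _ _ S(1) ex orb])
    show "rest c \<noteq> [] \<and> last (rest c) = 0" for c by (simp add: rest_def)
    fix c d
    have "count_list (M.\<tau> c) d = q * count_list E d + (if d = 0 then N + 2 else 0) + (if d = 1 then q else 0) + (if d = c then 1 else 0)"
      unfolding M.\<tau>_def using q by (simp add: rest_def count_list_replicate count_list_power)
    also have "\<dots> = q * (count_list E d + (if d = 0 then g + 3 else 0) + (if d = 1 then 1 else 0)) + (if d = c then 1 else 0)"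
      unfolding N(2) by (simp add: distrib_left)
    finally show "count_list (M.\<tau> c) d mod q = (if d = c then 1 else 0)" using q by simp
  qed simp
qed

lemma rank_optimal_pairs:
  assumes LSl: "LSl \<subseteq> V" and n: "n \<ge> 2" and S: "S \<in> V" "simple_sgrp S" "\<not> orthodox S"
  shows "rank_bound_optimal V n (n\<^sup>2 - n + 1)"
proof -
  obtain e f q where ef: "e \<in> carrier S" "sg_mult S e e = e" "f \<in> carrier S" "sg_mult S f f = f"
    and q: "q \<ge> 2" and per: "(sg_mult S (sg_mult S e f) ^^ q) e = e"
    and orb: "\<And>i j. (sg_mult S (sg_mult S e f) ^^ i) e = (sg_mult S (sg_mult S e f) ^^ j) e \<Longrightarrow> i mod q = j mod q"
    using simple_nonorthodox_orbit[OF V_sgroup[OF S(1)] V_finite[OF S(1)] S(2,3)] by metis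
  define E where "E = all_pairs n"
  \<comment> \<open>Read cyclically, this is a closed walk at c that contains the marker pattern 0
    1.\<close>
  define loop where "loop = (\<lambda>c. c # 0 # 1 # E)"
  define rest where "rest = (\<lambda>c. E @ concat (replicate (q - 1) (loop c)) @ [c])"
  define g where "g = length E + (q - 1) * (length E + 3) + 1"
  \<comment> \<open>Without \<open>q * g\<close> zeros of the run, the block is the closed walk
    \<open>loop c\<close> traversed \<open>q\<close> times and closed by c. The removed zeros
    account for \<open>q * g\<close> pairs 00, so every pair count is a multiple of
    \<open>q\<close>.\<close>
  define N where "N = q * g + 1"
  have "g \<le> q * g" using q by simp
  then have gN: "g < N" unfolding N_def by linarith
  have loop_len: "length (loop c) = length E + 3" for c by (simp add: loop_def)
  interpret M: marked_limit V n "\<lambda>c. c" N rest g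
  proof
    show "2 \<le> n" by (rule n)
    show "set (rest c) \<subseteq> {..<n}" if "c < n" for c
    proof -
      have "set (loop c) \<subseteq> {..<n}" using that n set_all_pairs[of n] by (simp add: loop_def E_def)
      then have "set (concat (replicate (q - 1) (loop c))) \<subseteq> {..<n}" using set_concat_replicate by (rule order.trans[rotated])
      then show ?thesis using that set_all_pairs[of n] by (simp add: rest_def E_def)
    qed
    show "length (rest c) = g" for c
      by (simp add: rest_def g_def length_concat_replicate loop_len)
    show "g < N" by (rule gN)
    show "(0 :: nat) = 0" ..
    show "rest 0 \<noteq> []" "last (rest 0) = 0" by (simp_all add: rest_def)
    show "LSl \<subseteq> V" by (rule LSl)
    fix a b c assume ab: "a < n" "b < n"
    obtain u v where uv: "E = u @ [a, b] @ v" using all_pairs_split[OF ab] by (auto simp: E_def)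
    have "c # replicate N 0 @ [1] @ rest c =
      (c # replicate N 0 @ [1] @ u) @ [a, b] @ (v @ concat (replicate (q - 1) (loop c)) @ [c])"
      by (simp add: rest_def uv)
    then show "\<exists>u v. u \<noteq> [] \<and> v \<noteq> [] \<and> c # replicate N 0 @ [1] @ rest c = u @ [a, b] @ v"
      by blast
  qed simp_all
  show ?thesis
  proof (rule M.rank_pairs[OF q _ _ _ S(1) ef per orb])
    show "rest c \<noteq> [] \<and> last (rest c) = c" for c by (simp add: rest_def)
    fix a b c :: nat
    have zeros: "pair_count a b (c # replicate k 0 @ 0 # w) = pair_count a b (c # 0 # w) + k * (if a = 0 \<and> b = 0 then 1 else 0)" for k w
    proof (induction k arbitrary: w)
      case (Suc k)
      have "replicate (Suc k) (0 :: nat) @ 0 # w = replicate k 0 @ 0 # 0 # w" by (metis append_Cons replicate_Suc replicate_app_Cons_same)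
      then show ?case using Suc[of "0 # w"] by simp
    qed simp
    have pow: "pair_count a b (concat (replicate k (loop c)) @ [c]) = k * pair_count a b (loop c @ [c])" for k
    proof (induction k)
      case (Suc k)
      let ?w = "concat (replicate k (loop c)) @ [c]"
      have ne: "loop c \<noteq> []" "?w \<noteq> []" "[c] \<noteq> []" by (simp_all add: loop_def)
      have "hd ?w = c" by (cases k) (simp_all add: loop_def)
      then have "pair_count a b (loop c @ ?w) = pair_count a b (loop c @ [c]) + pair_count a b ?w"
        using pair_count_append[OF ne(1,2)] pair_count_append[OF ne(1,3)] by simp
      then show ?case using Suc by simp
    qed simp
    have "M.\<tau> c = c # replicate (q * g) 0 @ 0 # (1 # E @ concat (replicate (q - 1) (loop c)) @ [c])"
      unfolding M.\<tau>_def by (simp add: N_def rest_def replicate_app_Cons_same)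
    then have "pair_count a b (M.\<tau> c) =
        pair_count a b (c # 0 # (1 # E @ concat (replicate (q - 1) (loop c)) @ [c])) + (q * g) * (if a = 0 \<and> b = 0 then 1 else 0)"
      using zeros by simp
    also have "c # 0 # (1 # E @ concat (replicate (q - 1) (loop c)) @ [c]) = concat (replicate q (loop c)) @ [c]"
      using q by (cases q) (simp_all add: loop_def)
    finally have "pair_count a b (M.\<tau> c) =
        q * (pair_count a b (loop c @ [c]) + g * (if a = 0 \<and> b = 0 then 1 else 0))"
      unfolding pow by (simp add: distrib_left)
    then show "pair_count a b (M.\<tau> c) mod q = 0" by simp
  qed simp
qed

end

subsection \<open>One letter\<close>

lemma words_one_letter: "w \<in> words {a} \<longleftrightarrow> (\<exists>k. w = replicate (Suc k) a)"
proof
  assume w: "w \<in> words {a}"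
  then have "replicate (length w) a = w" by (intro replicate_length_same) (auto simp: words_def)
  moreover obtain k where "length w = Suc k" using words_nonempty[OF w] by (cases w) auto
  ultimately show "\<exists>k. w = replicate (Suc k) a" by metis
qed (auto simp: words_def)

lemma word_value_replicate: "word_value S f (replicate (Suc m) a) = spow S (f a) m"
proof (induction m)
  case (Suc m)
  have "word_value S f (replicate (Suc (Suc m)) a) = sg_mult S (f a) (word_value S f (replicate (Suc m) a))"
    by simp
  then show ?case unfolding Suc spow_Suc .
qed simp

lemma spow_spow:
  assumes "sgroup_axioms S" "s \<in> carrier S"
  shows "spow S (spow S s k) m = spow S s (k + m * Suc k)"
proof (induction m)
  case (Suc m)
  show ?case unfolding spow_Suc[of S "spow S s k"] Suc spow_mult[OF assms] by (simp add: algebra_simps)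
qed simp

lemma spow_periodic:
  assumes S: "sgroup_axioms S" "finite (carrier S)" "s \<in> carrier S"
  obtains i p where "p \<ge> 1" "\<And>m k. m \<ge> i \<Longrightarrow> spow S s (m + p * k) = spow S s m"
proof -
  have F: "sg_mult S s y \<in> carrier S" if "y \<in> carrier S" for y using sgroup_closed[OF S(1,3) that] .
  have sp: "spow S s m = (sg_mult S s ^^ m) s" for m
    by (induction m) (simp_all add: spow_Suc)
  obtain i p where "p \<ge> 1" "\<And>m k. m \<ge> i \<Longrightarrow> (sg_mult S s ^^ (m + p * k)) s = (sg_mult S s ^^ m) s"
    using funpow_periodic[where F = "sg_mult S s", OF S(2,3) F] by metis
  then show ?thesis using that unfolding sp by blast
qed

definition zeros :: "nat \<Rightarrow> nat list set" where
  "zeros N = {replicate (Suc m) 0 | m. m \<ge> N}"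

lemma zeros_words: "zeros N \<subseteq> words {0}"
  unfolding zeros_def words_one_letter subset_iff by blast

lemma zeros_image: "word_value S f ` zeros N = spow S (f 0) ` {N..}"
proof -
  have "zeros N = (\<lambda>m. replicate (Suc m) 0) ` {N..}" by (auto simp: zeros_def)
  then show ?thesis unfolding image_image[symmetric] by (simp only: image_image word_value_replicate)
qed

text \<open>Past the preperiod every power recurs with arbitrarily large exponent, so it belongs to
  all the tails.\<close>

lemma zeros_INT:
  assumes p: "p \<ge> 1" and per: "\<And>m k. m \<ge> i \<Longrightarrow> spow S (f 0) (m + p * k) = spow S (f 0) m"
  shows "(\<Inter>N. word_value S f ` zeros N) = spow S (f 0) ` {i..}"
proof
  show "(\<Inter>N. word_value S f ` zeros N) \<subseteq> spow S (f 0) ` {i..}"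
    unfolding zeros_image by (rule INF_lower[OF UNIV_I])
  show "spow S (f 0) ` {i..} \<subseteq> (\<Inter>N. word_value S f ` zeros N)"
    unfolding zeros_image
  proof (intro INT_greatest image_subsetI)
    fix N m assume "m \<in> {i..}"
    then have "spow S (f 0) m = spow S (f 0) (m + p * N)" using per by simp
    moreover have "m + p * N \<in> {N..}"
      using mult_le_mono1[OF p, of N] unfolding atLeast_iff mult_1 by linarith
    ultimately show "spow S (f 0) m \<in> spow S (f 0) ` {N..}" by (rule image_eqI)
  qed
qed

lemma tail_subgroup:
  assumes S: "sgroup_axioms S" "s \<in> carrier S" and p: "p \<ge> 1"
    and per: "\<And>m k. m \<ge> i \<Longrightarrow> spow S s (m + p * k) = spow S s m"
  shows "subgroup_of (spow S s ` {i..}) S"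
proof (rule subgroup_of_solvable[OF S(1)])
  show "spow S s ` {i..} \<subseteq> carrier S" using spow_closed[OF S] by blast
  show "spow S s ` {i..} \<noteq> {}" by simp
  fix a b assume "a \<in> spow S s ` {i..}" "b \<in> spow S s ` {i..}"
  then obtain m k where m: "m \<ge> i" "a = spow S s m" and k: "k \<ge> i" "b = spow S s k" by auto
  show "sg_mult S a b \<in> spow S s ` {i..}"
    unfolding m(2) k(2) spow_mult[OF S] using m(1) by simp
  \<comment> \<open>The exponent solves the equation modulo the period; the multiple of
    \<open>p\<close> is chosen large enough to make the difference nonnegative and to keep
    \<open>t\<close> beyond the preperiod.\<close>
  define t where "t = k + p * Suc (m + i) - Suc m"
  have "p * Suc (m + i) \<ge> Suc (m + i)" using mult_le_mono1[OF p, of "Suc (m + i)"] by simp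
  then have t: "t \<ge> i" "Suc (m + t) = k + p * Suc (m + i)" "Suc (t + m) = k + p * Suc (m + i)"
    unfolding t_def by linarith+
  have "sg_mult S a (spow S s t) = b" "sg_mult S (spow S s t) a = b"
    unfolding m(2) k(2) spow_mult[OF S] t(2,3) by (rule per[OF k(1)])+
  then show "\<exists>x\<in>spow S s ` {i..}. sg_mult S a x = b" "\<exists>y\<in>spow S s ` {i..}. sg_mult S y a = b"
    using t(1) by blast+
qed

section \<open>The limit group over a single letter\<close>

locale one_letter = pv V for V +
  assumes LSl_V: "LSl \<subseteq> V"
begin

lemma coord_periodic:
  assumes Sf: "(S, f) \<in> gen_maps V {0 :: nat}"
  obtains i p where "p \<ge> 1" "\<And>m k. m \<ge> i \<Longrightarrow> spow S (f 0) (m + p * k) = spow S (f 0) m"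
    "(\<Inter>N. word_value S f ` zeros N) = spow S (f 0) ` {i..}" "f 0 \<in> carrier S"
proof -
  note d = gen_mapsD[OF Sf]
  have f0: "f 0 \<in> carrier S" using d(2) by auto
  obtain i p where ip: "p \<ge> 1" "\<And>m k. m \<ge> i \<Longrightarrow> spow S (f 0) (m + p * k) = spow S (f 0) m"
    using spow_periodic[OF d(4,5) f0] by metis
  show ?thesis by (rule that[OF ip zeros_INT[of p i S f, OF ip] f0])
qed

text \<open>Powers with exponent \<open>fact j + 1\<close> converge to the pseudoword with exponent
  omega + 1, a topological generator of the procyclic limit group.\<close>

lemma limit_generator:
  obtains z where "z \<in> carrier (free_pro V {0 :: nat})"
    "\<And>S f. (S, f) \<in> gen_maps V {0 :: nat} \<Longrightarrow> \<exists>J. \<forall>j\<ge>J. word_value S f (replicate (Suc (fact j)) 0) = z (S, f)"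
proof (rule limit_elt[of "\<lambda>j. replicate (Suc (fact j)) 0" "{0 :: nat}"])
  show "replicate (Suc (fact j)) 0 \<in> words {0 :: nat}" for j unfolding words_one_letter by blast
  show "\<exists>J s. \<forall>j\<ge>J. word_value S f (replicate (Suc (fact j)) 0) = s" if Sf: "(S, f) \<in> gen_maps V {0 :: nat}" for S f
  proof -
    obtain i p where ip: "p \<ge> 1" "\<And>m k. m \<ge> i \<Longrightarrow> spow S (f 0) (m + p * k) = spow S (f 0) m"
      using coord_periodic[OF Sf] by metis
    define J where "J = max i p"
    have "spow S (f 0) (fact j) = spow S (f 0) (fact J)" if j: "j \<ge> J" for j
    proof -
      have pJ: "p \<le> J" "i \<le> J" by (simp_all add: J_def)
      have le: "(fact J :: nat) \<le> fact j" using j by (rule fact_mono)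
      have "p dvd fact j - fact J"
        by (intro dvd_diff_nat dvd_fact[OF ip(1)] order.trans[OF pJ(1) j] pJ(1))
      then obtain k where "fact j - fact J = p * k" by (auto simp: dvd_def)
      then have "(fact j :: nat) = fact J + p * k" using le by linarith
      moreover have "i \<le> fact J" using pJ(2) fact_ge_self order.trans by blast
      ultimately show ?thesis using ip(2)[of "fact J" k] by simp
    qed
    then show ?thesis unfolding word_value_replicate by blast
  qed
qed (rule that)

sublocale limit_words V "{0}" "words {0}" zeros
proof
  show "LSl \<subseteq> V" by (rule LSl_V)
  show "finite {0 :: nat}" "{0 :: nat} \<noteq> {}" by simp_all
  show "words {0 :: nat} \<subseteq> words {0}" by simp
  show "u \<in> words {0 :: nat}" if "w \<in> words {0}" "sublist u w" "u \<noteq> []" for u w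
    using set_mono_sublist[OF that(2)] that(1,3) by (auto simp: words_def)
  show "zeros N \<subseteq> words {0}" for N by (rule zeros_words)
  show "zeros M \<subseteq> zeros N" if "N \<le> M" for N M using that by (auto simp: zeros_def)
  show "N < length w" if "w \<in> zeros N" for N w using that by (auto simp: zeros_def)
  show "subgroup_of (\<Inter>N. word_value S f ` zeros N) S" if Sf: "(S, f) \<in> gen_maps V {0 :: nat}" for S f
  proof -
    obtain i p where ip: "p \<ge> 1" "\<And>m k. m \<ge> i \<Longrightarrow> spow S (f 0) (m + p * k) = spow S (f 0) m"
      "(\<Inter>N. word_value S f ` zeros N) = spow S (f 0) ` {i..}" "f 0 \<in> carrier S"
      using coord_periodic[OF Sf] by metis
    show ?thesis unfolding ip(3) by (rule tail_subgroup[OF gen_mapsD(4)[OF Sf] ip(4,1,2)])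
  qed
  show "\<exists>m\<ge>1. \<forall>u\<in>zeros N. \<forall>w\<in>words {0}. u @ w @ u \<in> tested (words {0}) m \<longrightarrow> u @ w @ u \<in> zeros N" for N
  \<comment> \<open>Every nonempty word over the letter is in the language, so membership in
    \<open>zeros N\<close> depends on the length alone.\<close>
  proof (intro exI[of _ 1] conjI ballI impI)
    fix u w assume u: "u \<in> zeros N" and w: "w \<in> words {0 :: nat}"
    have "u @ w @ u \<in> words {0}" using u w zeros_words by blast
    then obtain k where k: "u @ w @ u = replicate (Suc k) 0" unfolding words_one_letter by blast
    have "length u > N" using u by (auto simp: zeros_def)
    then have "k \<ge> N" using arg_cong[OF k, of length] by simp
    then show "u @ w @ u \<in> zeros N" unfolding k zeros_def by blast
  qed simp
  show "\<exists>m. \<forall>w\<in>words {0}. m \<le> length w \<longrightarrow> (\<exists>x\<in>words {0}. \<exists>u\<in>zeros N. \<exists>y\<in>words {0}. w = x @ u @ y)" for N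
  proof (intro exI[of _ "N + 3"] ballI impI)
    fix w assume w: "w \<in> words {0 :: nat}" "N + 3 \<le> length w"
    obtain k where k: "w = replicate (Suc k) 0" using w(1) unfolding words_one_letter by blast
    then have "Suc k = Suc 0 + (Suc N + Suc (k - N - 2))" using w(2) by simp
    then have "w = replicate (Suc 0) 0 @ replicate (Suc N) 0 @ replicate (Suc (k - N - 2)) 0"
      unfolding k by (metis replicate_add)
    moreover have "replicate (Suc j) 0 \<in> words {0 :: nat}" for j unfolding words_one_letter by blast
    moreover have "replicate (Suc N) 0 \<in> zeros N" unfolding zeros_def by blast
    ultimately show "\<exists>x\<in>words {0}. \<exists>u\<in>zeros N. \<exists>y\<in>words {0}. w = x @ u @ y" by blast
  qed
  show "\<exists>x\<in>words {0}. \<exists>y\<in>words {0}. word_value S f (x @ w @ y) \<in> (\<Inter>N. word_value S f ` zeros N)"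
    if Sf: "(S, f) \<in> gen_maps V {0 :: nat}" and w: "w \<in> words {0}" for S f w
  proof -
    obtain i p where ip: "(\<Inter>N. word_value S f ` zeros N) = spow S (f 0) ` {i..}"
      using coord_periodic[OF Sf] by metis
    obtain k where k: "w = replicate (Suc k) 0" using w unfolding words_one_letter by blast
    have "replicate (Suc 0) 0 @ w @ replicate (Suc i) 0 = replicate (Suc 0 + (Suc k + Suc i)) (0 :: nat)"
      unfolding k replicate_add ..
    then have "replicate (Suc 0) 0 @ w @ replicate (Suc i) 0 = replicate (Suc (k + i + 2)) (0 :: nat)" by simp
    then have "word_value S f (replicate (Suc 0) 0 @ w @ replicate (Suc i) 0) = spow S (f 0) (k + i + 2)"
      by (simp only: word_value_replicate)
    then have "word_value S f (replicate (Suc 0) 0 @ w @ replicate (Suc i) 0) \<in> (\<Inter>N. word_value S f ` zeros N)"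
      unfolding ip by simp
    moreover have "replicate (Suc j) 0 \<in> words {0 :: nat}" for j unfolding words_one_letter by blast
    ultimately show ?thesis by blast
  qed
  obtain z where z: "z \<in> carrier (free_pro V {0 :: nat})"
    "\<And>S f. (S, f) \<in> gen_maps V {0 :: nat} \<Longrightarrow> \<exists>J. \<forall>j\<ge>J. word_value S f (replicate (Suc (fact j)) 0) = z (S, f)"
    using limit_generator by metis
  show "\<exists>z\<in>carrier (free_pro V {0}). \<forall>S f. (S, f) \<in> gen_maps V {0 :: nat} \<longrightarrow>
     z (S, f) \<in> (\<Inter>N. word_value S f ` zeros N) \<and> z (S, f) \<in> word_value S f ` words {0}"
  proof (intro bexI[OF _ z(1)] allI impI)
    fix S f assume Sf: "(S, f) \<in> gen_maps V {0 :: nat}"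
    obtain i where i: "(\<Inter>N. word_value S f ` zeros N) = spow S (f 0) ` {i..}"
      using coord_periodic[OF Sf] by metis
    obtain J where J: "\<forall>j\<ge>J. word_value S f (replicate (Suc (fact j)) 0) = z (S, f)" using z(2)[OF Sf] by blast
    define j where "j = max J i"
    have zj: "z (S, f) = word_value S f (replicate (Suc (fact j)) 0)" using J by (simp add: j_def)
    have "i \<le> j" by (simp add: j_def)
    then have "i \<le> fact j" using fact_ge_self order.trans by blast
    then have "z (S, f) \<in> spow S (f 0) ` {i..}" unfolding zj word_value_replicate by simp
    moreover have "replicate (Suc (fact j)) 0 \<in> words {0 :: nat}" unfolding words_one_letter by blast
    ultimately show "z (S, f) \<in> (\<Inter>N. word_value S f ` zeros N) \<and> z (S, f) \<in> word_value S f ` words {0}"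
      unfolding i using zj by blast
  qed
qed

lemma topgen_one: "topgen {0} limgrp 1"
proof -
  obtain z where z: "z \<in> carrier (free_pro V {0 :: nat})"
    "\<And>S f. (S, f) \<in> gen_maps V {0 :: nat} \<Longrightarrow> \<exists>J. \<forall>j\<ge>J. word_value S f (replicate (Suc (fact j)) 0) = z (S, f)"
    using limit_generator by metis
  let ?F = "free_pro V {0 :: nat}"
  have val: "spow ?F z m (S, f) = spow S (z (S, f)) m" if "(S, f) \<in> gen_maps V {0 :: nat}" for S f m
    by (induction m) (simp_all add: spow_Suc free_pro_mult[OF that])
  have fac: "\<exists>j\<ge>i. p dvd fact j \<and> fact j \<ge> i \<and> z (S, f) = spow S (f 0) (fact j)"
    if Sf: "(S, f) \<in> gen_maps V {0 :: nat}" and p: "p \<ge> 1" for S f i and p :: nat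
  proof -
    obtain J where J: "\<forall>j\<ge>J. word_value S f (replicate (Suc (fact j)) 0) = z (S, f)" using z(2)[OF Sf] by blast
    define j where "j = max J (max i p)"
    have j: "j \<ge> J" "j \<ge> i" "j \<ge> p" by (simp_all add: j_def)
    then have "z (S, f) = spow S (f 0) (fact j)" using J by (simp only: word_value_replicate)
    moreover have "i \<le> fact j" using j(2) fact_ge_self order.trans by blast
    ultimately show ?thesis using j(2) dvd_fact[OF p j(3)] by blast
  qed
  show ?thesis
    unfolding topgen_def
  proof (intro exI[of _ "{z}"] conjI ballI allI impI)
    have "z \<in> limgrp"
    proof (rule limgrpI[OF z(1)])
      fix S f assume Sf: "(S, f) \<in> gen_maps V {0 :: nat}"
      obtain i where i: "(\<Inter>N. word_value S f ` zeros N) = spow S (f 0) ` {i..}"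
        using coord_periodic[OF Sf] by metis
      obtain j where "fact j \<ge> i" "z (S, f) = spow S (f 0) (fact j)" using fac[OF Sf, of 1 i] by auto
      then show "z (S, f) \<in> lims S f" unfolding lims_def i by simp
    qed
    then show "{z} \<subseteq> limgrp" by simp
    fix x S f assume x: "x \<in> limgrp" and Sf: "(S, f) \<in> gen_maps V {0 :: nat}"
    obtain i p where ip: "p \<ge> 1" "\<And>m k. m \<ge> i \<Longrightarrow> spow S (f 0) (m + p * k) = spow S (f 0) m"
      "(\<Inter>N. word_value S f ` zeros N) = spow S (f 0) ` {i..}" "f 0 \<in> carrier S"
      using coord_periodic[OF Sf] by metis
    obtain m where m: "m \<ge> i" "x (S, f) = spow S (f 0) m"
      using limgrpD(2)[OF x Sf] unfolding lims_def ip(3) by auto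
    obtain j where j: "p dvd fact j" "z (S, f) = spow S (f 0) (fact j)" using fac[OF Sf ip(1)] by blast
    obtain k where k: "fact j = p * k" using j(1) by (auto simp: dvd_def)
    \<comment> \<open>The generator has exponent congruent to 1 modulo the period, so its power with
      index \<open>m\<close> agrees with that of the letter; the surplus exponent is a multiple of
      the period.\<close>
    have "spow ?F z m (S, f) = spow S (f 0) (fact j + m * Suc (fact j))"
      unfolding val[OF Sf] j(2) by (rule spow_spow[OF gen_mapsD(4)[OF Sf] ip(4)])
    also have "fact j + m * Suc (fact j) = m + p * (k * Suc m)" unfolding k by (simp add: algebra_simps)
    also have "spow S (f 0) (m + p * (k * Suc m)) = x (S, f)" unfolding m(2) by (rule ip(2)[OF m(1)])
    finally have "x (S, f) = spow ?F z m (S, f)" ..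
    moreover have "spow ?F z m \<in> sg_generated ?F {z}"
      by (rule spow_mem) (use sg_generated_incl[of "{z}" ?F] sg_generated_closed in auto)
    ultimately show "\<exists>y\<in>sg_generated ?F {z}. x (S, f) = y (S, f)" by blast
  qed simp_all
qed

text \<open>The limit group is nonempty, while the empty set generates the empty
  subsemigroup.\<close>

lemma topgen_positive: "topgen {0} limgrp k \<Longrightarrow> 1 \<le> k"
proof (rule ccontr)
  assume gen: "topgen {0} limgrp k" and k: "\<not> 1 \<le> k"
  obtain G where G: "finite G" "card G \<le> k"
    "\<forall>x\<in>limgrp. \<forall>S f. (S, f) \<in> gen_maps V {0 :: nat} \<longrightarrow> (\<exists>y\<in>sg_generated (free_pro V {0}) G. x (S, f) = y (S, f))"
    using gen unfolding topgen_def by blast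
  have "card G = 0" using G(2) k by linarith
  then have "G = {}" using G(1) by simp
  moreover have "sg_generated (free_pro V {0 :: nat}) {} \<subseteq> {}" by (rule sg_generated_least) simp_all
  moreover obtain S f where "(S, f) \<in> gen_maps V {0 :: nat}" using test_coord[of 1] by blast
  ultimately show False using G(3) limone_limgrp by blast
qed

section \<open>The doubling sequence\<close>

abbreviation double :: "nat list \<Rightarrow> nat list" where "double w \<equiv> replicate (2 * length w) 0"

lemma dcomp_double: "w \<in> words {0} \<Longrightarrow> dcomp (\<lambda>_. double) k j w = replicate (2 ^ j * length w) 0"
proof (induction j arbitrary: w)
  case 0
  then show ?case by (auto simp: words_one_letter)
next
  case (Suc j)
  have "double w \<in> words {0}" using words_nonempty[OF Suc.prems] by (auto simp: words_def)
  then show ?case using Suc.IH[of "double w"] by (simp add: algebra_simps)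
qed

lemma lang_double: "lang (\<lambda>_. {0}) (\<lambda>_. double) = words {0}"
proof (intro equalityI subsetI)
  fix w assume "w \<in> lang (\<lambda>_. {0 :: nat}) (\<lambda>_. double)"
  then obtain k where "w \<noteq> []" "sublist w (dcomp (\<lambda>_. double) 0 k [0])"
    by (auto simp: lang_def factors_def dseq_def)
  moreover have "dcomp (\<lambda>_. double) 0 k [0] = replicate (2 ^ k) 0" using dcomp_double[of "[0]"] by simp
  ultimately show "w \<in> words {0}" using set_mono_sublist by (fastforce simp: words_def)
next
  fix w assume "w \<in> words {0 :: nat}"
  then obtain k where k: "w = replicate (Suc k) 0" unfolding words_one_letter by blast
  have "Suc k \<le> 2 ^ Suc k" using less_exp[of "Suc k"] by (rule less_imp_le)
  then have "dcomp (\<lambda>_. double) 0 (Suc k) [0] = w @ replicate (2 ^ Suc k - Suc k) 0"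
    using dcomp_double[of "[0]" 0 "Suc k"] by (simp only: k replicate_add[symmetric]) simp
  then have "sublist w (dcomp (\<lambda>_. double) 0 (Suc k) [0])" by (simp only: sublist_append_rightI)
  then show "w \<in> lang (\<lambda>_. {0}) (\<lambda>_. double)"
    unfolding lang_def factors_def dseq_def using k by (auto intro!: exI[of _ "Suc k"])
qed

lemma rank_optimal_one: "rank_bound_optimal V 1 1"
  unfolding rank_bound_optimal_def
proof (intro exI conjI impI)
  have hom: "double \<in> sg_hom (free_sgrp {0}) (free_sgrp {0})"
    unfolding sg_hom_def by (auto simp: words_def replicate_add[symmetric] distrib_left)
  show "directive_sequence (\<lambda>_. {0}) (\<lambda>_. double)" using hom by (simp add: directive_sequence_def)
  show "primitive (\<lambda>_. {0}) (\<lambda>_. double)"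
    unfolding primitive_def
  proof
    fix k
    have "positive_hom {0} {0} (dseq (\<lambda>_. double) k (Suc k))"
      unfolding positive_hom_def dseq_def using dcomp_double[of "[0]" k 1] by simp
    then show "\<exists>m>k. positive_hom {0} {0} (dseq (\<lambda>_. double) k m)" by blast
  qed
  show "alphabet_rank (\<lambda>_. {0 :: nat}) = enat 1" by (simp add: alphabet_rank_def Liminf_const)
  show "schutz_rank_is V (\<lambda>_. {0}) (\<lambda>_. double) 1"
    by (rule schutz_rank_isI[OF _ _ _ topgen_one topgen_positive]) (simp_all add: lang_double)
  show "saturating V (\<lambda>_. {0}) (\<lambda>_. double)" if "(1 :: nat) \<ge> 2" using that by simp
qed

end

theorem theorem11p15:
  fixes V :: "nat sgrp set" and n :: nat
  assumes "pseudovariety V" and "LSl \<subseteq> V" and "n \<ge> 1"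
  shows "((\<exists>S\<in>V. simple_sgrp S \<and> \<not> orthodox S) \<longrightarrow> rank_bound_optimal V n (n\<^sup>2 - n + 1)) \<and>
    ((\<forall>S\<in>V. simple_sgrp S \<longrightarrow> orthodox S) \<and> (\<exists>S\<in>V. is_group S \<and> card (carrier S) > 1)
       \<longrightarrow> rank_bound_optimal V n n)"
proof (cases "n = 1")
  case True
  interpret one_letter V by unfold_locales (fact assms)+
  \<comment> \<open>For one letter \<open>n\<^sup>2 - n + 1\<close> and \<open>n\<close> are both 1,
    so one witness serves both claims.\<close>
  show ?thesis using rank_optimal_one True by simp
next
  case False
  then have n: "n \<ge> 2" using assms(3) by simp
  interpret pv V by unfold_locales (fact assms(1))
  show ?thesis
    using rank_optimal_pairs[OF assms(2) n] rank_optimal_letters[OF assms(2) n] by blast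
qed

end
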